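(* Let $G$ be a simple planar graph with girth $g(G)\geq 6$ and maximum degree $\Delta=\Delta(G)\geq 6$. Then $\chi_2(G)\leq \Delta+4$.
   Context: A 2-distance coloring of a graph $G$ is a vertex coloring in which any two distinct vertices at distance at most $2$ from each other (i.e. adjacent, or having a common neighbour) receive different colors. The 2-distance chromatic number $\chi_2(G)$ is the least number of colors for which $G$ admits a 2-distance coloring. The girth $g(G)$ is the length of a shortest cycle of $G$ (infinite if $G$ is acyclic). *)

theory Defs
  imports
    "HOL-Analysis.Analysis"
    "HOL-Library.Extended_Nat"
    "Graph_Theory.Digraph"
    "Graph_Theory.Arc_Walk"
begin

text \<open>
  Finite simple graphs are the symmetric, loop-free digraphs without parallel arcs of the locale
  \<^locale>\<open>graph\<close>: an undirected edge between \<open>u\<close> and \<open>v\<close> is a pair of opposite arcs.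
  Hence the degree of a vertex is its \<^const>\<open>out_degree\<close>.
\<close>

text \<open>On \<^typ>\<open>nat\<close> the supremum of a finite nonempty set is its maximum, and that of the empty set is 0.\<close>

definition max_degree :: "('a, 'b) pre_digraph \<Rightarrow> nat" where
  "max_degree G = (SUP v\<in>verts G. out_degree G v)"

text \<open>
  The directed cycles of length 2 that run along an edge and back are not cycles of the undirected
  graph, whence the restriction to length at least 3. The infimum over the empty set is \<open>\<infinity>\<close>.
\<close>

definition girth :: "('a, 'b) pre_digraph \<Rightarrow> enat" where
  "girth G = (INF p\<in>{p. pre_digraph.cycle G p \<and> 3 \<le> length p}. enat (length p))"

text \<open>
  A drawing places the vertices at distinct points \<open>pos v\<close> of the plane and represents the undirected
  edge \<open>{u, v}\<close> by the point set \<open>D {u, v}\<close>, which is a simple arc from \<open>pos u\<close> to \<open>pos v\<close>. The arc of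
  an edge contains no vertex other than its two ends, and the arcs of distinct edges meet at most
  in vertices.
\<close>

definition plane_drawing ::
    "('a, 'b) pre_digraph \<Rightarrow> ('a \<Rightarrow> complex) \<Rightarrow> ('a set \<Rightarrow> complex set) \<Rightarrow> bool" where
  "plane_drawing G pos D \<longleftrightarrow>
     inj_on pos (verts G) \<and>
     (\<forall>u v. u \<rightarrow>\<^bsub>G\<^esub> v \<longrightarrow>
        (\<exists>g. arc g \<and> pathstart g = pos u \<and> pathfinish g = pos v \<and> path_image g = D {u, v}) \<and>
        D {u, v} \<inter> pos ` verts G = {pos u, pos v}) \<and>
     (\<forall>u v x y. u \<rightarrow>\<^bsub>G\<^esub> v \<and> x \<rightarrow>\<^bsub>G\<^esub> y \<and> {u, v} \<noteq> {x, y} \<longrightarrow>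
        D {u, v} \<inter> D {x, y} \<subseteq> pos ` verts G)"

definition planar :: "('a, 'b) pre_digraph \<Rightarrow> bool" where
  "planar G \<longleftrightarrow> (\<exists>pos D. plane_drawing G pos D)"

definition two_distance_coloring :: "('a, 'b) pre_digraph \<Rightarrow> ('a \<Rightarrow> nat) \<Rightarrow> bool" where
  "two_distance_coloring G c \<longleftrightarrow>
     (\<forall>u\<in>verts G. \<forall>v\<in>verts G.
        u \<noteq> v \<and> (u \<rightarrow>\<^bsub>G\<^esub> v \<or> (\<exists>w. u \<rightarrow>\<^bsub>G\<^esub> w \<and> w \<rightarrow>\<^bsub>G\<^esub> v)) \<longrightarrow> c u \<noteq> c v)"

definition chi2 :: "('a, 'b) pre_digraph \<Rightarrow> nat" where
  "chi2 G = (LEAST k. \<exists>c. two_distance_coloring G c \<and> c ` verts G \<subseteq> {..<k})"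

end

theory Submission
  imports Defs
begin

text \<open>
  Fix \<open>D = \<Delta>\<close> and colour with \<open>D + 4\<close> colours the vertices of a vertex-minimal induced subgraph that cannot be
  coloured. Every vertex \<open>v\<close> of it starts with the charge \<open>2 deg v - 6\<close>, every face with its length minus 6; by Euler's
  formula the total is at most \<open>-12\<close>. Vertices of degree at least 6 give 1 to every neighbour and every vertex of degree
  at least 3 gives 1 to each neighbour of degree 2; since 2-vertices next to low degrees can be coloured last,
  minimality leaves only two kinds of vertices with a deficit: 4-vertices with three neighbours of degree 2 and
  5-vertices all but at most one of whose neighbours have degree 2. Uncolouring such a vertex with its neighbours
  leaves a clique with lists that violate Hall's condition by exactly one colour. Recolouring a 2-vertex that
  is opposite to it on a face of length 6 would repair the violation, so around a deficient vertex most
  faces are longer than 6 or have a vertex of degree at least 3 in that position, and those pay for the deficit.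
\<close>

section \<open>Crosscuts of plane continua\<close>

text \<open>Why recolouring works: since Hall's condition fails by a single colour, the lists of the
  clique are rigid; they coincide, or all lie in one list of smallest possible size. On a face of
  length 6 through a deficient vertex \<open>x\<close>, the opposite vertex \<open>t\<close> is
  within distance 2 of the two neighbours of \<open>x\<close> on this face, but by the girth not of
  some other vertex of the clique. A new colour for \<open>t\<close> changes one list and leaves
  another as it was, against the rigidity. The unit of payment is 1/4. A deficient 4-vertex has
  three 2-neighbours, hence six sides of edges, each worth 1/4; the two sides of its fourth edge may
  spoil two of them, and the remaining four cover the deficit 1. At a deficient 5-vertex 1/4 per
  2-neighbour suffices. The obstacle on the topological side is that a critical graph may have
  bridges, so the boundary of a face need not be a cycle. Borders are therefore plain sets of edges,
  and a side that is missing, because of a bridge or of a face that is not listed, is booked as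
  charge of the edge.\<close>

lemma components_eqI:
  assumes "connected G" "G \<noteq> {}" "G \<subseteq> U" "\<And>H. connected H \<Longrightarrow> H \<subseteq> U \<Longrightarrow> G \<inter> H \<noteq> {} \<Longrightarrow> H \<subseteq> G"
  shows "G \<in> components U"
  unfolding in_components_maximal
proof (intro conjI allI impI)
  fix d assume d: "d \<noteq> {} \<and> G \<subseteq> d \<and> d \<subseteq> U \<and> connected d"
  with assms(2) have "G \<inter> d \<noteq> {}" by blast
  with assms(4) d have "d \<subseteq> G" by blast
  with d show "d = G" by blast
qed (use assms in auto)

text \<open>A connected set that meets both \<open>G\<close> and its complement meets the frontier
  of \<open>G\<close>, which lies outside \<open>U\<close>; so \<open>G\<close> absorbs every
  connected subset of \<open>U\<close> that it meets.\<close>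

lemma open_clopen_component:
  fixes G U :: "'a::real_normed_vector set"
  assumes "open G" "connected G" "G \<noteq> {}" "G \<subseteq> U" "frontier G \<inter> U = {}"
  shows "G \<in> components U"
proof (rule components_eqI)
  fix H assume H: "connected H" "H \<subseteq> U" "G \<inter> H \<noteq> {}"
  show "H \<subseteq> G"
  proof (rule ccontr)
    assume "\<not> H \<subseteq> G"
    then have "H - G \<noteq> {}" by blast
    with H have "H \<inter> frontier G \<noteq> {}"
      using connected_Int_frontier[of H G] by (simp add: Int_commute)
    with H assms show False by blast
  qed
qed (use assms in auto)

text \<open>
  An arc \<open>P\<close> that closes up to a Jordan curve inside \<open>K \<union> P\<close> has exactly two faces along it, one on each side of the
  curve: two points of the same face \<open>f0\<close> of \<open>K\<close> on the same side are not separated by \<open>K \<union> P\<close>, because \<open>K\<close> meets the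
  curve in an arc and Janiszewski's theorem applies.
\<close>

lemma thread:
  fixes P :: "real \<Rightarrow> complex"
  assumes P: "arc P" and K: "compact K"
    and KP: "K \<inter> path_image P = {pathstart P, pathfinish P}"
    and pc: "path_component K (pathfinish P) (pathstart P)"
  obtains f0 g1 g2 where
    "f0 \<in> components (- K)" "path_image P - {pathstart P, pathfinish P} \<subseteq> f0"
    "g1 \<in> components (- (K \<union> path_image P))" "g2 \<in> components (- (K \<union> path_image P))"
    "g1 \<inter> g2 = {}" "g1 \<subseteq> f0" "g2 \<subseteq> f0"
    "\<And>p. p \<in> path_image P - {pathstart P, pathfinish P} \<Longrightarrow> p \<in> closure g1 \<and> p \<in> closure g2"
    "\<And>p. p \<in> path_image P - {pathstart P, pathfinish P} \<Longrightarrow>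
        \<exists>N. open N \<and> p \<in> N \<and> N \<subseteq> path_image P \<union> g1 \<union> g2"
proof -
  let ?a = "pathstart P" and ?b = "pathfinish P"
  let ?Po = "path_image P - {?a, ?b}"
  have ab: "?a \<noteq> ?b" using P arc_distinct_ends by metis
  \<comment> \<open>A path in \<open>K\<close> between the ends of \<open>P\<close> is thinned to an
    arc \<open>Q\<close>. As \<open>K\<close> meets \<open>P\<close> only in these ends,
    \<open>P\<close> and \<open>Q\<close> close up to a Jordan curve.\<close>
  obtain q where q: "path q" "path_image q \<subseteq> K" "pathstart q = ?b" "pathfinish q = ?a"
    using pc unfolding path_component_def by auto
  obtain Q where Q: "arc Q" "path_image Q \<subseteq> path_image q" "pathstart Q = ?b" "pathfinish Q = ?a"
    using path_contains_arc[OF q(1) q(3) q(4)] ab by metis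
  have QK: "path_image Q \<subseteq> K" using Q q by blast
  have Qe: "?a \<in> path_image Q" "?b \<in> path_image Q"
    using Q by (metis pathfinish_in_path_image, metis pathstart_in_path_image)
  define c where "c = P +++ Q"
  have c: "simple_path c" "pathfinish c = pathstart c"
    unfolding c_def using P Q QK KP by (auto intro!: simple_path_join_loop)
  have imc: "path_image c = path_image P \<union> path_image Q"
    unfolding c_def using Q by (simp add: path_image_join)
  have KC: "K \<inter> path_image c = path_image Q"
    unfolding imc Int_Un_distrib KP using QK Qe by blast
  have KuC: "K \<union> path_image c = K \<union> path_image P" using imc QK by auto
  note J = Jordan_inside_outside[OF c]
  have oK: "open (- K)" using K by (simp add: compact_imp_closed open_Compl)
  have conPo: "connected ?Po" using connected_simple_path_endless P arc_imp_simple_path by blast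
  have nePo: "?Po \<noteq> {}" using nonempty_simple_path_endless P arc_imp_simple_path by blast
  have PoK: "?Po \<subseteq> - K" using KP by auto
  obtain f0 where f0: "f0 \<in> components (- K)" "?Po \<subseteq> f0"
    using exists_component_superset[OF PoK _ conPo] nePo PoK by blast
  have of0: "open f0" using f0 oK open_components by blast
  have f0K: "f0 \<subseteq> - K" "connected f0" using f0 in_components_subset in_components_connected by auto
  \<comment> \<open>Stated for an abstract \<open>I\<close>, so that the inside and the outside of
    the curve are treated at once.\<close>
  have key: "f0 \<inter> I \<in> components (- (K \<union> path_image P)) \<and> (\<forall>p\<in>?Po. p \<in> closure (f0 \<inter> I))"
    if I: "open I" "connected I" "I \<subseteq> - path_image c" "frontier I = path_image c" for I
  proof -
    have cl: "p \<in> closure (f0 \<inter> I)" if p: "p \<in> ?Po" for p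
    proof -
      have "p \<in> closure I" using p I(4) imc by (auto simp: frontier_def)
      moreover have "p \<in> f0" using p f0 by blast
      ultimately have "p \<in> f0 \<inter> closure I" by blast
      then show ?thesis using open_Int_closure_subset[OF of0, of I] by blast
    qed
    have ne: "f0 \<inter> I \<noteq> {}" using cl nePo closure_empty by (metis all_not_in_conv)
    have con: "connected_component (- (K \<union> path_image P)) x y" if "x \<in> f0 \<inter> I" "y \<in> f0 \<inter> I" for x y
      unfolding KuC[symmetric]
    proof (rule Janiszewski)
      show "closed (path_image c)" using c closed_simple_path_image by blast
      show "connected (K \<inter> path_image c)" unfolding KC using Q connected_arc_image by blast
      show "connected_component (- K) x y" unfolding connected_component_def using that f0K by blast
      show "connected_component (- path_image c) x y" unfolding connected_component_def using that I by blast
    qed (use K in auto)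
    have sub: "H \<subseteq> f0 \<inter> I" if H: "connected H" "H \<subseteq> - (K \<union> path_image P)" "(f0 \<inter> I) \<inter> H \<noteq> {}" for H
    proof -
      have "H \<subseteq> f0" using H f0 by (intro components_maximal[OF f0(1) H(1)]) auto
      moreover have "H \<subseteq> I"
      proof (rule ccontr)
        assume "\<not> H \<subseteq> I"
        then have "H \<inter> frontier I \<noteq> {}" using connected_Int_frontier[of H I] H by blast
        with I H KuC show False by blast
      qed
      ultimately show ?thesis by blast
    qed
    have subU: "f0 \<inter> I \<subseteq> - (K \<union> path_image P)" using f0K I KuC by auto
    have "connected (f0 \<inter> I)"
      unfolding connected_iff_connected_component
    proof (intro ballI)
      fix x y assume xy: "x \<in> f0 \<inter> I" "y \<in> f0 \<inter> I"
      obtain H where H: "connected H" "H \<subseteq> - (K \<union> path_image P)" "x \<in> H" "y \<in> H"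
        using con[OF xy] unfolding connected_component_def by blast
      then have "H \<subseteq> f0 \<inter> I" using sub xy by blast
      with H show "connected_component (f0 \<inter> I) x y" unfolding connected_component_def by blast
    qed
    then have "f0 \<inter> I \<in> components (- (K \<union> path_image P))"
      using components_eqI ne subU sub by blast
    with cl show ?thesis by blast
  qed
  let ?g1 = "f0 \<inter> inside (path_image c)" and ?g2 = "f0 \<inter> outside (path_image c)"
  have io: "inside (path_image c) \<subseteq> - path_image c" "outside (path_image c) \<subseteq> - path_image c"
    using J by (metis Un_upper1, metis Un_upper2)
  have 1: "?g1 \<in> components (- (K \<union> path_image P)) \<and> (\<forall>p\<in>?Po. p \<in> closure ?g1)"
    by (rule key) (use J io in simp_all)
  have 2: "?g2 \<in> components (- (K \<union> path_image P)) \<and> (\<forall>p\<in>?Po. p \<in> closure ?g2)"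
    by (rule key) (use J io in simp_all)
  have 3: "\<exists>N. open N \<and> p \<in> N \<and> N \<subseteq> path_image P \<union> ?g1 \<union> ?g2" if "p \<in> ?Po" for p
  proof (intro exI conjI)
    show "f0 \<subseteq> path_image P \<union> ?g1 \<union> ?g2"
    proof
      fix z assume z: "z \<in> f0"
      then have "z \<notin> path_image Q" using f0K QK by blast
      moreover have "z \<in> path_image c \<or> z \<in> inside (path_image c) \<or> z \<in> outside (path_image c)"
        using J by blast
      ultimately show "z \<in> path_image P \<union> ?g1 \<union> ?g2" using z imc by blast
    qed
  qed (use of0 f0 that in auto)
  have d12: "?g1 \<inter> ?g2 = {}" using inside_Int_outside by blast
  have 4: "\<And>p. p \<in> ?Po \<Longrightarrow> p \<in> closure ?g1 \<and> p \<in> closure ?g2" using 1 2 by blast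
  show ?thesis
    by (rule that[OF f0 conjunct1[OF 1] conjunct1[OF 2] d12 _ _ 4 3]) blast+
qed

section \<open>Faces of plane drawings\<close>

lemma component_eqI:
  assumes "f \<in> components U" "g \<in> components U" "z \<in> f" "z \<in> g"
  shows "f = g"
  using assms components_nonoverlap[of f U g] by blast

text \<open>The undirected form of a plane drawing. Separating it from the digraph lets it restrict
  to induced subgraphs, and its faces are studied for arbitrary sets of edges.\<close>

locale drawing =
  fixes V :: "'a set" and E :: "'a set set" and pos :: "'a \<Rightarrow> complex" and D :: "'a set \<Rightarrow> complex set"
  assumes finV: "finite V" and inj: "inj_on pos V"
    and edge: "e \<in> E \<Longrightarrow> \<exists>u v g. e = {u, v} \<and> u \<noteq> v \<and> u \<in> V \<and> v \<in> V \<and> arc g \<and>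
                 pathstart g = pos u \<and> pathfinish g = pos v \<and> path_image g = D e"
    and ends: "e \<in> E \<Longrightarrow> D e \<inter> pos ` V = pos ` e"
    and cross: "e \<in> E \<Longrightarrow> e' \<in> E \<Longrightarrow> e \<noteq> e' \<Longrightarrow> D e \<inter> D e' \<subseteq> pos ` V"
begin

text \<open>All vertices stay, whatever the edge set: deleting an edge then deletes exactly its open
  arc, and finitely many points do not separate the plane.\<close>

definition pts :: "'a set set \<Rightarrow> complex set" where
  "pts X = pos ` V \<union> \<Union> (D ` X)"

definition open_arc :: "'a set \<Rightarrow> complex set" where
  "open_arc e = D e - pos ` e"

definition faces :: "'a set set \<Rightarrow> complex set set" where
  "faces X = components (- pts X)"

text \<open>One common point with the closure is enough, because the faces along an edge do not
  change in the interior of its arc. As a set it counts a bridge once, unlike a boundary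
  walk.\<close>

definition border :: "'a set set \<Rightarrow> complex set \<Rightarrow> 'a set set" where
  "border X f = {e \<in> X. open_arc e \<inter> closure f \<noteq> {}}"

definition reach :: "'a set set \<Rightarrow> ('a \<times> 'a) set" where
  "reach X = {(p, q). {p, q} \<in> X}\<^sup>*"

lemma edge_sub: "e \<in> E \<Longrightarrow> e \<subseteq> V"
  using edge by blast

lemma finE: "finite E"
  by (rule finite_subset[of E "Pow V"]) (use edge_sub finV in auto)

lemma arc_of:
  assumes "{u, v} \<in> E"
  obtains g where "arc g" "pathstart g = pos u" "pathfinish g = pos v" "path_image g = D {u, v}"
    "u \<noteq> v" "u \<in> V" "v \<in> V"
proof -
  obtain u' v' g where g: "{u, v} = {u', v'}" "u' \<noteq> v'" "u' \<in> V" "v' \<in> V" "arc g"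
     "pathstart g = pos u'" "pathfinish g = pos v'" "path_image g = D {u, v}"
    using edge[OF assms] by auto
  then consider "u = u'" "v = v'" | "u = v'" "v = u'" by (auto simp: doubleton_eq_iff)
  then show ?thesis
  proof cases
    case 1 then show ?thesis using g that by auto
  next
    case 2 then show ?thesis using g that[of "reversepath g"] by (auto simp: arc_reversepath)
  qed
qed

lemma compact_D: "e \<in> E \<Longrightarrow> compact (D e)"
  using edge by (metis arc_imp_path compact_path_image)

lemma compact_pts: "X \<subseteq> E \<Longrightarrow> compact (pts X)"
  unfolding pts_def using finV finite_subset[OF _ finE, of X] compact_D
  by (intro compact_Un compact_UN) (auto simp: finite_imp_compact)

lemma open_face: "X \<subseteq> E \<Longrightarrow> f \<in> faces X \<Longrightarrow> open f"
  unfolding faces_def using compact_pts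
  by (meson compact_imp_closed open_Compl open_components)

lemma face_disj: "f \<in> faces X \<Longrightarrow> f \<inter> pts X = {}"
  unfolding faces_def using in_components_subset by blast

lemma vert_on: "e \<in> E \<Longrightarrow> z \<in> V \<Longrightarrow> pos z \<in> D e \<Longrightarrow> z \<in> e"
  using ends[of e] edge_sub[of e] inj by (metis IntI image_eqI inj_on_image_mem_iff)

lemma pos_in_D: "e \<in> E \<Longrightarrow> z \<in> e \<Longrightarrow> pos z \<in> D e"
  using ends by blast

lemma D_inter: "e \<in> E \<Longrightarrow> e' \<in> E \<Longrightarrow> e \<noteq> e' \<Longrightarrow> D e \<inter> D e' \<subseteq> pos ` (e \<inter> e')"
  using cross[of e e'] vert_on by blast

lemma open_arc_disj: "e \<in> E \<Longrightarrow> X \<subseteq> E \<Longrightarrow> e \<notin> X \<Longrightarrow> open_arc e \<inter> pts X = {}"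
proof -
  assume a: "e \<in> E" "X \<subseteq> E" "e \<notin> X"
  have 1: "D e \<inter> D e' \<subseteq> pos ` e" if "e' \<in> X" for e'
    using D_inter[of e e'] a that by blast
  have 2: "D e \<inter> pos ` V \<subseteq> pos ` e" using ends[OF a(1)] by simp
  show "open_arc e \<inter> pts X = {}" unfolding open_arc_def pts_def using 1 2 by blast
qed

lemma open_arc_pos: "e \<in> E \<Longrightarrow> open_arc e \<inter> pos ` V = {}"
  unfolding open_arc_def using ends by blast

lemma D_pts: "e \<in> E \<Longrightarrow> X \<subseteq> E \<Longrightarrow> e \<notin> X \<Longrightarrow> pts X \<inter> D e = pos ` e"
proof -
  assume a: "e \<in> E" "X \<subseteq> E" "e \<notin> X"
  have "pts X \<inter> D e \<subseteq> pos ` e" using open_arc_disj[OF a] unfolding open_arc_def by blast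
  moreover have "pos ` e \<subseteq> pts X" using edge_sub[OF a(1)] unfolding pts_def by blast
  moreover have "pos ` e \<subseteq> D e" using ends[OF a(1)] by blast
  ultimately show ?thesis by blast
qed

lemma pts_insert: "pts (insert e X) = pts X \<union> D e"
  unfolding pts_def by auto

lemma pts_mono: "X \<subseteq> Y \<Longrightarrow> pts X \<subseteq> pts Y"
  unfolding pts_def by auto

lemma open_arc_nonempty: "e \<in> E \<Longrightarrow> open_arc e \<noteq> {}"
  and open_arc_connected: "e \<in> E \<Longrightarrow> connected (open_arc e)"
proof -
  assume "e \<in> E"
  then obtain u v g where g: "e = {u, v}" "arc g" "pathstart g = pos u" "pathfinish g = pos v" "path_image g = D e"
    using edge by blast
  then have "open_arc e = path_image g - {pathstart g, pathfinish g}" unfolding open_arc_def by auto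
  then show "open_arc e \<noteq> {}" "connected (open_arc e)"
    using nonempty_simple_path_endless[of g] connected_simple_path_endless[of g] g arc_imp_simple_path by metis+
qed

lemma reach_sym: "(p, q) \<in> reach X \<Longrightarrow> (q, p) \<in> reach X"
proof -
  have "sym {(p, q). {p, q} \<in> X}" by (auto simp: sym_def insert_commute)
  then show "(p, q) \<in> reach X \<Longrightarrow> (q, p) \<in> reach X"
    unfolding reach_def by (meson symD sym_rtrancl)
qed

lemma reach_mono: "X \<subseteq> Y \<Longrightarrow> reach X \<subseteq> reach Y"
  unfolding reach_def by (rule rtrancl_mono) auto

lemma reach_trans: "(p, q) \<in> reach X \<Longrightarrow> (q, r) \<in> reach X \<Longrightarrow> (p, r) \<in> reach X"
  unfolding reach_def by simp

lemma reach_edge: "{p, q} \<in> X \<Longrightarrow> (p, q) \<in> reach X"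
  unfolding reach_def by auto

lemma reach_path:
  assumes "X \<subseteq> E" "(p, q) \<in> reach X" "pos p \<in> K" "\<Union> (D ` X) \<subseteq> K"
  shows "path_component K (pos p) (pos q)"
  using assms(2) unfolding reach_def
proof (induction rule: rtrancl_induct)
  case base then show ?case using assms by (simp add: path_component_refl)
next
  case (step y z)
  then have yz: "{y, z} \<in> X" by simp
  obtain g where "arc g" "pathstart g = pos y" "pathfinish g = pos z" "path_image g = D {y, z}"
    using arc_of yz assms(1) by (metis subsetD)
  then have "path_component K (pos y) (pos z)"
    unfolding path_component_def using yz assms(4) by (intro exI[of _ g]) (auto simp: arc_imp_path)
  with step.IH show ?case by (rule path_component_trans)
qed

text \<open>The crosscut result for a single edge: a walk in \<open>X\<close> between its ends
  provides the connection that closes the edge up to a Jordan curve.\<close>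

lemma edge_thread:
  assumes X: "X \<subseteq> E" and e: "{u, v} \<in> E" "{u, v} \<notin> X" and r: "(u, v) \<in> reach X"
  obtains f0 g1 g2 where "f0 \<in> faces X" "open_arc {u, v} \<subseteq> f0"
    "g1 \<in> faces (insert {u, v} X)" "g2 \<in> faces (insert {u, v} X)" "g1 \<inter> g2 = {}" "g1 \<subseteq> f0" "g2 \<subseteq> f0"
    "\<And>p. p \<in> open_arc {u, v} \<Longrightarrow> p \<in> closure g1 \<and> p \<in> closure g2"
    "\<And>p. p \<in> open_arc {u, v} \<Longrightarrow> \<exists>N. open N \<and> p \<in> N \<and> N \<subseteq> D {u, v} \<union> g1 \<union> g2"
proof -
  obtain P where P: "arc P" "pathstart P = pos u" "pathfinish P = pos v" "path_image P = D {u, v}" "v \<in> V"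
    using arc_of[OF e(1)] by metis
  have KP: "pts X \<inter> path_image P = {pathstart P, pathfinish P}"
    using D_pts[OF e(1) X e(2)] P by simp
  have pc: "path_component (pts X) (pathfinish P) (pathstart P)"
    unfolding P by (rule reach_path[OF X reach_sym[OF r]]) (use P in \<open>auto simp: pts_def\<close>)
  have i: "open_arc {u, v} = path_image P - {pathstart P, pathfinish P}" unfolding open_arc_def P by auto
  show ?thesis
  proof (rule thread[OF P(1) compact_pts[OF X] KP pc, folded i, unfolded P])
    fix f0 g1 g2
    assume *: "f0 \<in> components (- pts X)" "open_arc {u, v} \<subseteq> f0"
      "g1 \<in> components (- (pts X \<union> D {u, v}))" "g2 \<in> components (- (pts X \<union> D {u, v}))"
      "g1 \<inter> g2 = {}" "g1 \<subseteq> f0" "g2 \<subseteq> f0"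
      "\<And>p. p \<in> open_arc {u, v} \<Longrightarrow> p \<in> closure g1 \<and> p \<in> closure g2"
      "\<And>p. p \<in> open_arc {u, v} \<Longrightarrow> \<exists>N. open N \<and> p \<in> N \<and> N \<subseteq> D {u, v} \<union> g1 \<union> g2"
    show thesis
      by (rule that[OF _ *(2) _ _ *(5-9)]) (simp_all only: *(1,3,4) faces_def pts_insert)
  qed
qed

text \<open>Janiszewski's theorem is applied twice, to glue the edge to the two parts of the drawing that it joins.\<close>

lemma bridge:
  assumes X: "X \<subseteq> E" and e: "{u, v} \<in> E" "{u, v} \<notin> X" and r: "(u, v) \<notin> reach X"
    and cc: "connected_component (- pts X) x y" and xy: "x \<notin> D {u, v}" "y \<notin> D {u, v}"
  shows "connected_component (- pts (insert {u, v} X)) x y"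
proof -
  obtain P where P: "arc P" "pathstart P = pos u" "pathfinish P = pos v" "path_image P = D {u, v}" "u \<in> V" "v \<in> V"
    using arc_of[OF e(1)] by metis
  \<comment> \<open>\<open>A\<close> is the part of the drawing that can be reached from
    \<open>u\<close>, and \<open>B\<close> is the rest; the new edge meets each of them in one end
    point.\<close>
  define VA where "VA = {z \<in> V. (u, z) \<in> reach X}"
  define XA where "XA = {e' \<in> X. e' \<inter> VA \<noteq> {}}"
  define A where "A = pos ` VA \<union> \<Union> (D ` XA)"
  define B where "B = pos ` (V - VA) \<union> \<Union> (D ` (X - XA))"
  have VV: "VA \<subseteq> V" unfolding VA_def by auto
  have XX: "XA \<subseteq> X" unfolding XA_def by auto
  have AB: "A \<union> B = pts X"
  proof -
    have 1: "pos ` V = pos ` VA \<union> pos ` (V - VA)" using VV by blast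
    have 2: "\<Union> (D ` X) = \<Union> (D ` XA) \<union> \<Union> (D ` (X - XA))" using XX by blast
    show ?thesis unfolding A_def B_def pts_def 1 2 by auto
  qed
  have XA: "e' \<subseteq> VA" if e': "e' \<in> XA" for e'
  proof -
    obtain p where p: "p \<in> e'" "p \<in> VA" using e' unfolding XA_def by blast
    have eX: "e' \<in> X" using e' unfolding XA_def by blast
    obtain s t where st: "e' = {s, t}" "s \<in> V" "t \<in> V" using edge X eX by blast
    then have "(s, t) \<in> reach X" "(t, s) \<in> reach X"
      using eX reach_edge reach_sym by blast+
    moreover have "(u, p) \<in> reach X" using p unfolding VA_def by simp
    ultimately have "(u, s) \<in> reach X" "(u, t) \<in> reach X"
      using p(1) st(1) reach_trans by blast+
    then show ?thesis using st unfolding VA_def by simp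
  qed
  have zA: "z \<in> VA" if z: "pos z \<in> A" "z \<in> V" for z
  proof -
    consider w where "w \<in> VA" "pos z = pos w" | e' where "e' \<in> XA" "pos z \<in> D e'"
      using z unfolding A_def by blast
    then show ?thesis
    proof cases
      case 1 then have "w = z" using inj z unfolding VA_def by (simp add: inj_on_eq_iff)
      with 1 show ?thesis by simp
    next
      case 2 then have "e' \<in> E" using X unfolding XA_def by blast
      with 2 z have "z \<in> e'" using vert_on by blast
      with 2 XA show ?thesis by blast
    qed
  qed
  have zB: "z \<notin> VA" if z: "pos z \<in> B" "z \<in> V" for z
  proof -
    consider w where "w \<in> V - VA" "pos z = pos w" | e' where "e' \<in> X - XA" "pos z \<in> D e'"
      using z unfolding B_def by blast
    then show ?thesis
    proof cases
      case 1 then have "w = z" using inj z by (metis DiffD1 inj_on_eq_iff)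
      with 1 show ?thesis by simp
    next
      case 2 then have "e' \<in> E" using X by blast
      with 2 z have "z \<in> e'" using vert_on by blast
      with 2 show ?thesis unfolding XA_def by blast
    qed
  qed
  have disj: "A \<inter> B = {}"
  proof (rule ccontr)
    assume "A \<inter> B \<noteq> {}"
    then obtain q where q: "q \<in> A" "q \<in> B" by blast
    have "q \<in> pos ` V"
    proof (rule ccontr)
      assume n: "q \<notin> pos ` V"
      have "q \<in> \<Union> (D ` XA)" using q(1) n VV unfolding A_def by blast
      then obtain e1 where e1: "e1 \<in> XA" "q \<in> D e1" by blast
      have "q \<in> \<Union> (D ` (X - XA))" using q(2) n unfolding B_def by blast
      then obtain e2 where e2: "e2 \<in> X - XA" "q \<in> D e2" by blast
      have "D e1 \<inter> D e2 \<subseteq> pos ` V"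
        by (rule cross) (use e1 e2 X XX in auto)
      then show False using n e1 e2 by blast
    qed
    then obtain z where "z \<in> V" "q = pos z" by blast
    then show False using q zA[of z] zB[of z] by simp
  qed
  have int: "pts X \<inter> D {u, v} = {pos u, pos v}" using D_pts[OF e(1) X e(2)] by simp
  have uA: "u \<in> VA" "v \<notin> VA" using P r unfolding VA_def reach_def by auto
  have Ae: "A \<inter> D {u, v} = {pos u}"
  proof -
    have "pos v \<notin> A" using zA[of v] P uA by blast
    moreover have "pos u \<in> A" using uA unfolding A_def by blast
    ultimately show ?thesis using int AB by blast
  qed
  have Be: "B \<inter> D {u, v} = {pos v}"
  proof -
    have "pos u \<notin> B" using zB[of u] P uA by blast
    moreover have "pos v \<in> B" using uA P unfolding B_def by blast
    moreover have "B \<inter> D {u, v} = B \<inter> {pos u, pos v}" unfolding int[symmetric] using AB by blast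
    ultimately show ?thesis by simp
  qed
  have fin: "finite X" using X finE finite_subset by blast
  have cA: "compact A" "compact B"
  proof -
    have f: "finite VA" "finite (V - VA)" "finite XA" "finite (X - XA)"
      using finV VV fin XX finite_subset by auto
    have c: "e' \<in> X \<Longrightarrow> compact (D e')" for e' using X compact_D by blast
    have "compact (pos ` VA)" "compact (pos ` (V - VA))" using f by (auto intro: finite_imp_compact)
    moreover have "compact (\<Union> (D ` XA))" "compact (\<Union> (D ` (X - XA)))"
      using f c XX by (auto intro!: compact_UN)
    ultimately show "compact A" "compact B" unfolding A_def B_def by (auto intro: compact_Un)
  qed
  have ccA: "connected_component (- A) x y" "connected_component (- B) x y"
    using cc AB connected_component_of_subset by (metis Compl_anti_mono Un_upper1, metis Compl_anti_mono Un_upper2)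
  have cDe: "closed (D {u, v})" "compact (D {u, v})" using compact_D e compact_imp_closed by auto
  have "connected (- D {u, v})" using connected_arc_complement[OF P(1)] P by simp
  then have ccD: "connected_component (- D {u, v}) x y"
    using xy unfolding connected_component_def by blast
  \<comment> \<open>Janiszewski's theorem needs connected intersections, hence the splitting of
    \<open>pts X\<close>. An arc alone separates nothing and meets \<open>A\<close> in one point;
    the union of both then meets \<open>B\<close> in one point.\<close>
  have 1: "connected_component (- (A \<union> D {u, v})) x y"
    by (rule Janiszewski[OF cA(1) cDe(1) _ ccA(1) ccD]) (simp add: Ae)
  have 2: "(A \<union> D {u, v}) \<inter> B = {pos v}" using disj Be by blast
  have "connected_component (- ((A \<union> D {u, v}) \<union> B)) x y"
    by (rule Janiszewski[OF _ _ _ 1 ccA(2)]) (use 2 cA cDe compact_imp_closed in auto)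
  moreover have "(A \<union> D {u, v}) \<union> B = pts (insert {u, v} X)" using AB unfolding pts_insert by blast
  ultimately show ?thesis by simp
qed


text \<open>The ends stay joined without \<open>e\<close>; for an edge of \<open>X\<close> this says
  that it lies on a cycle, that is, that it is not a bridge.\<close>

definition cyc :: "'a set set \<Rightarrow> 'a set \<Rightarrow> bool" where
  "cyc X e \<longleftrightarrow> (\<exists>u v. e = {u, v} \<and> (u, v) \<in> reach (X - {e}))"

lemma cyc_iff: "cyc X {u, v} \<longleftrightarrow> (u, v) \<in> reach (X - {{u, v}})"
  unfolding cyc_def using reach_sym by (auto simp: doubleton_eq_iff)

lemma cyc_mono: "cyc X e \<Longrightarrow> X \<subseteq> Y \<Longrightarrow> cyc Y e"
  unfolding cyc_def using reach_mono[of "X - {e}" "Y - {e}"] by blast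

lemma edgeE:
  assumes "e \<in> E"
  obtains u v where "e = {u, v}" "u \<noteq> v" "u \<in> V" "v \<in> V"
  using edge[OF assms] by blast

text \<open>The way to identify faces: \<open>T\<close> lies on the drawing, so the part of
  \<open>f\<close> near \<open>p\<close> must lie in \<open>g\<close>.\<close>

lemma near_point:
  assumes X: "X \<subseteq> E" and f: "f \<in> faces X" and p: "p \<in> closure f"
    and N: "open N" "p \<in> N" "N \<subseteq> T \<union> g" "T \<subseteq> pts X"
  obtains z where "z \<in> f" "z \<in> g"
proof -
  obtain z where z: "z \<in> f" "z \<in> N"
    using p N by (metis IntI closure_iff_nhds_not_empty disjoint_iff order_refl)
  moreover have "z \<notin> pts X" using face_disj[OF f] z by blast
  ultimately show ?thesis using N that by blast
qed

text \<open>In a forest every edge that is added joins two parts not yet connected, and by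
  \<open>bridge\<close> such an edge separates nothing.\<close>

lemma forest_connected:
  assumes X: "X \<subseteq> E" and fo: "\<And>e. e \<in> X \<Longrightarrow> \<not> cyc X e"
  shows "connected (- pts X)"
proof -
  have "finite X" using X finE finite_subset by blast
  then show ?thesis using assms
  proof (induction X rule: finite_induct)
    case empty
    have "connected (UNIV - pos ` V)"
      by (rule connected_open_delete_finite) (use finV in auto)
    then show ?case unfolding pts_def by (simp add: Compl_eq_Diff_UNIV)
  next
    case (insert e X)
    have eE: "e \<in> E" and XE: "X \<subseteq> E" using insert.prems by auto
    have IH: "connected (- pts X)"
      using insert.IH[OF XE] insert.prems(2) cyc_mono[of X _ "insert e X"] by blast
    obtain u v where uv: "e = {u, v}" using edgeE[OF eE] by metis
    have "(u, v) \<notin> reach X"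
      using insert.prems(2)[of e] insert.hyps(2) unfolding uv cyc_iff by (simp add: insert_Diff_if)
    then have "connected_component (- pts (insert e X)) x y"
      if xy: "x \<in> - pts (insert e X)" "y \<in> - pts (insert e X)" for x y
      unfolding uv
    proof (intro bridge XE)
      have "x \<in> - pts X" "y \<in> - pts X" using xy unfolding pts_insert by auto
      then show "connected_component (- pts X) x y" using IH connected_iff_connected_component by blast
    qed (use xy eE insert.hyps(2) uv in \<open>auto simp: pts_insert\<close>)
    then show ?case unfolding connected_iff_connected_component by blast
  qed
qed

text \<open>The map \<open>f\<close> labels vertices so that equal labels imply reachability. Each
  new edge merges two labels, and at least one label is left at the end.\<close>

lemma forest_card:
  assumes X: "X \<subseteq> E" and fo: "\<And>e. e \<in> X \<Longrightarrow> \<not> cyc X e" and V: "V \<noteq> {}"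
  shows "card X + 1 \<le> card V"
proof -
  have "finite X" using X finE finite_subset by blast
  then have "\<exists>f::'a \<Rightarrow> 'a. (\<forall>x\<in>V. \<forall>y\<in>V. f x = f y \<longrightarrow> (x, y) \<in> reach X) \<and> card X + card (f ` V) \<le> card V"
    using X fo
  proof (induction X rule: finite_induct)
    case empty
    show ?case by (rule exI[of _ id]) (auto simp: reach_def)
  next
    case (insert e X)
    have eE: "e \<in> E" and XE: "X \<subseteq> E" using insert.prems by auto
    obtain f :: "'a \<Rightarrow> 'a" where f: "\<And>x y. x \<in> V \<Longrightarrow> y \<in> V \<Longrightarrow> f x = f y \<Longrightarrow> (x, y) \<in> reach X"
      "card X + card (f ` V) \<le> card V"
      using insert.IH[OF XE] insert.prems(2) cyc_mono[of X _ "insert e X"] by blast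
    obtain u v where uv: "e = {u, v}" "u \<in> V" "v \<in> V" using edgeE[OF eE] by metis
    have "(u, v) \<notin> reach X"
      using insert.prems(2)[of e] insert.hyps(2) unfolding uv cyc_iff by (simp add: insert_Diff_if)
    then have ne: "f u \<noteq> f v" using f(1) uv by blast
    define g where "g = (\<lambda>x. if f x = f u then f v else f x)"
    have "g ` V \<subseteq> f ` V - {f u}" unfolding g_def using uv ne by auto
    then have "card (g ` V) \<le> card (f ` V - {f u})" using finV by (intro card_mono) auto
    also have "\<dots> < card (f ` V)" using finV uv by (intro psubset_card_mono) auto
    finally have c: "card (insert e X) + card (g ` V) \<le> card V"
      using f(2) insert.hyps by simp
    have mono: "(x, y) \<in> reach X \<Longrightarrow> (x, y) \<in> reach (insert e X)" for x y
      using reach_mono[of X "insert e X"] by blast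
    have uvr: "(u, v) \<in> reach (insert e X)" "(v, u) \<in> reach (insert e X)"
      using reach_edge[of u v "insert e X"] reach_sym uv by auto
    have "(x, y) \<in> reach (insert e X)" if xy: "x \<in> V" "y \<in> V" "g x = g y" for x y
    proof -
      have to: "z \<in> V \<Longrightarrow> f z = f u \<Longrightarrow> (z, v) \<in> reach (insert e X)" for z
        using f(1)[of z u] uv uvr mono reach_trans by meson
      have to2: "z \<in> V \<Longrightarrow> f z = f v \<Longrightarrow> (z, v) \<in> reach (insert e X)" for z
        using f(1)[of z v] uv mono by meson
      show ?thesis
      proof (cases "f x = f y")
        case True then show ?thesis using f(1) xy mono by blast
      next
        case False
        then have "(x, v) \<in> reach (insert e X) \<and> (y, v) \<in> reach (insert e X)"
          using xy to to2 unfolding g_def by (auto split: if_splits)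
        then show ?thesis using reach_trans reach_sym by blast
      qed
    qed
    with c show ?case by blast
  qed
  then obtain f :: "'a \<Rightarrow> 'a" where "card X + card (f ` V) \<le> card V" by blast
  moreover have "card (f ` V) > 0" using V finV by (simp add: card_gt_0_iff)
  ultimately show ?thesis by simp
qed

text \<open>
  The inequality of Euler's formula that is needed. The faces are not shown to be finitely many:
  a finite set of sufficiently many faces is enough for counting.
\<close>

lemma exists_faces:
  assumes X: "X \<subseteq> E" and V: "V \<noteq> {}"
  shows "\<exists>F \<subseteq> faces X. finite F \<and> card X + 2 \<le> card V + card F"
proof -
  have "finite X" using X finE finite_subset by blast
  then show ?thesis using X
  proof (induction X rule: finite_psubset_induct)
    case (psubset X)
    have XE: "X \<subseteq> E" using psubset.prems by blast
    show ?case
    proof (cases "\<exists>e\<in>X. cyc X e")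
      case False
      then have c: "card X + 1 \<le> card V" using forest_card[OF XE _ V] by blast
      \<comment> \<open>Even a forest leaves one face: its drawing is compact, hence not the whole
        plane.\<close>
      have "pts X \<noteq> UNIV" using compact_pts[OF XE] not_compact_UNIV by metis
      then obtain f where "f \<in> components (- pts X)" by (metis Compl_empty_eq components_eq_empty ex_in_conv double_compl)
      then have "{f} \<subseteq> faces X \<and> finite {f} \<and> card X + 2 \<le> card V + card {f}" using c unfolding faces_def by simp
      then show ?thesis by blast
    next
      case True
      then obtain e where e: "e \<in> X" "cyc X e" by blast
      define Y where "Y = X - {e}"
      have Y: "Y \<subset> X" "Y \<subseteq> E" "e \<notin> Y" "X = insert e Y" using e XE unfolding Y_def by auto
      obtain u v where uv: "e = {u, v}" using edgeE[of e] e XE by (metis subsetD)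
      have r: "(u, v) \<in> reach Y" using e(2) unfolding uv cyc_iff Y_def by simp
      obtain F where F: "F \<subseteq> faces Y" "finite F" "card Y + 2 \<le> card V + card F"
        using psubset.IH[OF Y(1) Y(2)] by blast
      have eE: "{u, v} \<in> E" "{u, v} \<notin> Y" using e XE Y uv by auto
      obtain f0 g1 g2 where g: "f0 \<in> faces Y" "open_arc {u, v} \<subseteq> f0"
        "g1 \<in> faces X" "g2 \<in> faces X" "g1 \<inter> g2 = {}" "g1 \<subseteq> f0" "g2 \<subseteq> f0"
        using edge_thread[OF Y(2) eE r] uv Y(4) by metis
      have ne: "g1 \<noteq> {}" "g2 \<noteq> {}" using g in_components_nonempty unfolding faces_def by blast+
      \<comment> \<open>Only \<open>f0\<close> contains the open arc of the removed edge, so all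
        other faces survive when the edge is put back, while \<open>f0\<close> makes room for
        two.\<close>
      have keep: "f \<in> faces X" if f: "f \<in> faces Y" "f \<noteq> f0" for f
      proof -
        have d: "f \<inter> f0 = {}" using components_nonoverlap[of f "- pts Y" f0] f g unfolding faces_def by blast
        have "f \<inter> pts Y = {}" using face_disj f by blast
        moreover have "D e \<subseteq> pts Y \<union> f0" using g(2) D_pts[OF eE(1) Y(2) eE(2)] uv unfolding open_arc_def by blast
        ultimately have sub: "f \<subseteq> - pts X" using d unfolding Y(4) pts_insert by blast
        have nf: "f \<noteq> {}" "connected f"
          using f(1) in_components_nonempty in_components_connected unfolding faces_def by blast+
        show ?thesis unfolding faces_def
        proof (rule components_eqI)
          fix H assume H: "connected H" "H \<subseteq> - pts X" "f \<inter> H \<noteq> {}"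
          have "H \<subseteq> - pts Y" using H(2) pts_mono Y by blast
          then show "H \<subseteq> f"
            using components_maximal[of f "- pts Y" H] f(1) H unfolding faces_def by blast
        qed (rule nf sub)+
      qed
      define F' where "F' = insert g1 (insert g2 (F - {f0}))"
      have F's: "F' \<subseteq> faces X" using keep F g unfolding F'_def by blast
      have out: "g \<notin> F - {f0}" if gg: "g \<subseteq> f0" "g \<noteq> {}" for g
      proof
        assume "g \<in> F - {f0}"
        then have "g \<in> faces Y" "g \<noteq> f0" using F by auto
        then have "g \<inter> f0 = {}" using components_nonoverlap[of g "- pts Y" f0] g(1) unfolding faces_def by blast
        with gg show False by blast
      qed
      have n1: "g1 \<notin> insert g2 (F - {f0})" using out[OF g(6) ne(1)] ne g(5) by blast
      have n2: "g2 \<notin> F - {f0}" using out[OF g(7) ne(2)] .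
      have "card F' = card (F - {f0}) + 2" unfolding F'_def using n1 n2 F(2) by simp
      moreover have "card (F - {f0}) + 1 \<ge> card F" by (metis F(2) Suc_eq_plus1 card_Suc_Diff1 Diff_insert_absorb Diff_empty insert_Diff1 Suc_leI le_SucI order_refl Diff_insert0)
      moreover have "card X = card Y + 1" using Y(3,4) psubset.hyps by (metis One_nat_def Suc_eq_plus1 card_insert_disjoint finite_insert)
      ultimately have "card X + 2 \<le> card V + card F'" using F(3) by simp
      moreover have "finite F'" unfolding F'_def using F(2) by simp
      ultimately show ?thesis using F's by blast
    qed
  qed
qed

text \<open>An edge on a cycle has only the two faces of the crosscut result along it. For a bridge,
  the points near its arc lie in one face of the drawing without it, and by \<open>bridge\<close>
  putting it back does not separate them.\<close>

lemma border_two: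
  assumes X: "X \<subseteq> E" and e: "e \<in> X"
  shows "\<exists>g1 g2. \<forall>f\<in>faces X. e \<in> border X f \<longrightarrow> f = g1 \<or> f = g2"
    and "\<not> cyc X e \<Longrightarrow> \<exists>g. \<forall>f\<in>faces X. e \<in> border X f \<longrightarrow> f = g"
proof -
  define Y where "Y = X - {e}"
  have Y: "Y \<subseteq> E" "e \<notin> Y" "X = insert e Y" using e X unfolding Y_def by auto
  obtain u v where uv: "e = {u, v}" using edgeE[of e] e X by (metis subsetD)
  have eE: "{u, v} \<in> E" "{u, v} \<notin> Y" using e X Y uv by auto
  have cY: "cyc X e \<longleftrightarrow> (u, v) \<in> reach Y" unfolding uv cyc_iff Y_def ..
  have DX: "D e \<subseteq> pts X" unfolding pts_def using e by blast
  show br: "\<exists>g. \<forall>f\<in>faces X. e \<in> border X f \<longrightarrow> f = g" if nc: "\<not> cyc X e"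
  proof -
    have nr: "(u, v) \<notin> reach Y" using nc cY by simp
    have oY: "open (- pts Y)" using compact_pts[OF Y(1)] compact_imp_closed open_Compl by blast
    have sub: "open_arc e \<subseteq> - pts Y" using open_arc_disj[of e Y] e X Y by blast
    have ci: "connected (open_arc e)" "open_arc e \<noteq> {}" using open_arc_connected open_arc_nonempty e X by blast+
    obtain f0 where f0: "f0 \<in> components (- pts Y)" "open_arc e \<subseteq> f0"
      using exists_component_superset[OF sub _ ci(1)] ci sub by blast
    have of0: "open f0" using f0(1) oY open_components by blast
    have cf0: "connected f0" "f0 \<subseteq> - pts Y" using f0 in_components_connected in_components_subset by blast+
    have pick: "\<exists>z. z \<in> f \<and> z \<in> f0 \<and> z \<notin> pts X" if f: "f \<in> faces X" "e \<in> border X f" for f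
    proof -
      obtain p where p: "p \<in> open_arc e" "p \<in> closure f" using f unfolding border_def by blast
      then obtain z where "z \<in> f" "z \<in> f0"
        using near_point[OF X f(1) p(2) of0, of "{}" f0] f0 by blast
      then show ?thesis using face_disj[OF f(1)] by blast
    qed
    have "f = f'" if f: "f \<in> faces X" "e \<in> border X f" and f': "f' \<in> faces X" "e \<in> border X f'" for f f'
    proof -
      obtain z where z: "z \<in> f" "z \<in> f0" "z \<notin> pts X" using pick[OF f] by blast
      obtain w where w: "w \<in> f'" "w \<in> f0" "w \<notin> pts X" using pick[OF f'] by blast
      have "connected_component (- pts Y) z w"
        unfolding connected_component_def using z w cf0 by blast
      then have "connected_component (- pts X) z w"
        unfolding Y(3) uv by (rule bridge[OF Y(1) eE nr]) (use z w DX uv in auto)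
      then obtain H where H: "connected H" "H \<subseteq> - pts X" "z \<in> H" "w \<in> H"
        unfolding connected_component_def by blast
      have "H \<subseteq> f" by (rule components_maximal[of f "- pts X"]) (use f H z in \<open>auto simp: faces_def\<close>)
      then show "f = f'" using f f' w H component_eqI unfolding faces_def by blast
    qed
    then show ?thesis by blast
  qed
  show "\<exists>g1 g2. \<forall>f\<in>faces X. e \<in> border X f \<longrightarrow> f = g1 \<or> f = g2"
  proof (cases "cyc X e")
    case False
    then show ?thesis using br by blast
  next
    case True
    then have r: "(u, v) \<in> reach Y" using cY by simp
    show ?thesis
    proof (rule edge_thread[OF Y(1) eE r])
      fix f0 g1 g2
      assume g: "g1 \<in> faces (insert {u, v} Y)" "g2 \<in> faces (insert {u, v} Y)"
        and N: "\<And>p. p \<in> open_arc {u, v} \<Longrightarrow> \<exists>N. open N \<and> p \<in> N \<and> N \<subseteq> D {u, v} \<union> g1 \<union> g2"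
      have "f = g1 \<or> f = g2" if f: "f \<in> faces X" "e \<in> border X f" for f
      proof -
        obtain p where p: "p \<in> open_arc e" "p \<in> closure f" using f unfolding border_def by blast
        obtain N where "open N" "p \<in> N" "N \<subseteq> D e \<union> (g1 \<union> g2)" using N p uv by (metis Un_assoc)
        then obtain z where "z \<in> f" "z \<in> g1 \<union> g2"
          using near_point[OF X f(1) p(2)] DX by metis
        then show ?thesis using f g component_eqI uv Y(3) unfolding faces_def by (metis UnE)
      qed
      then show ?thesis by blast
    qed
  qed
qed

section \<open>Borders of faces\<close>

lemma frontier_face:
  assumes X: "X \<subseteq> E" and f: "f \<in> faces X"
  shows "frontier f \<subseteq> pts (border X f)"
proof
  fix p assume p: "p \<in> frontier f"
  have "open (- pts X)" using compact_pts[OF X] compact_imp_closed open_Compl by blast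
  then have "frontier f \<inter> - pts X = {}"
    using f frontier_of_components_subset frontier_disjoint_eq unfolding faces_def
    by (metis (no_types, lifting) disjoint_iff frontier_of_components_subset subsetD)
  then have "p \<in> pts X" using p by blast
  then consider "p \<in> pos ` V" | e where "e \<in> X" "p \<in> D e" "p \<notin> pos ` V" unfolding pts_def by blast
  then show "p \<in> pts (border X f)"
  proof cases
    case 1 then show ?thesis unfolding pts_def by simp
  next
    case 2
    then have "p \<in> open_arc e" unfolding open_arc_def using X edge_sub by blast
    moreover have "p \<in> closure f" using p unfolding frontier_def by blast
    ultimately have "e \<in> border X f" unfolding border_def using 2 by blast
    then show ?thesis unfolding pts_def using 2 by blast
  qed
qed

text \<open>The frontier of \<open>f\<close> only uses edges of its border, so \<open>f\<close>
  remains open, connected and relatively closed when other edges are deleted. This reduces questions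
  about a face to a few edges.\<close>

lemma face_of_border:
  assumes X: "X \<subseteq> E" and f: "f \<in> faces X" and Z: "border X f \<subseteq> Z" "Z \<subseteq> X"
  shows "f \<in> faces Z"
  unfolding faces_def
proof (rule open_clopen_component)
  show "open f" using open_face X f by blast
  show "connected f" "f \<noteq> {}" using f in_components_connected in_components_nonempty unfolding faces_def by blast+
  show "f \<subseteq> - pts Z" using face_disj[OF f] pts_mono[OF Z(2)] by blast
  show "frontier f \<inter> - pts Z = {}" using frontier_face[OF X f] pts_mono[OF Z(1)] by blast
qed

text \<open>If the border were a forest, its complement would be connected and equal to
  \<open>f\<close>, leaving no room for \<open>f'\<close>.\<close>

lemma border_has_cycle:
  assumes X: "X \<subseteq> E" and f: "f \<in> faces X" "f' \<in> faces X" "f \<noteq> f'"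
  shows "\<exists>e\<in>border X f. cyc (border X f) e"
proof (rule ccontr)
  assume "\<not> ?thesis"
  moreover have sub: "border X f \<subseteq> X" unfolding border_def by blast
  ultimately have "connected (- pts (border X f))" using X by (intro forest_connected) auto
  moreover have fB: "f \<in> components (- pts (border X f))" using face_of_border[OF X f(1)] sub unfolding faces_def by blast
  ultimately have "- pts (border X f) \<subseteq> f"
    using components_maximal[OF fB, of "- pts (border X f)"] in_components_subset[OF fB] in_components_nonempty[OF fB] by blast
  moreover have "f' \<subseteq> - pts (border X f)" using face_disj[OF f(2)] pts_mono[OF sub] by blast
  moreover have "f' \<noteq> {}" using f(2) in_components_nonempty unfolding faces_def by blast
  ultimately have "\<exists>z. z \<in> f \<and> z \<in> f'" by blast
  then show False using f component_eqI unfolding faces_def by blast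
qed

text \<open>The crosscut result for the path through a vertex \<open>v\<close> of degree 2. Compared
  with \<open>edge_thread\<close> it gives both edges the same pair of faces and describes a
  neighbourhood of \<open>pos v\<close> itself.\<close>

lemma two_thread:
  assumes Y: "Y \<subseteq> E" and e1: "{u, v} \<in> Y" and e2: "{v, w} \<in> Y" and uw: "u \<noteq> w"
    and deg: "\<And>e. e \<in> Y \<Longrightarrow> v \<in> e \<Longrightarrow> e = {u, v} \<or> e = {v, w}"
    and c: "cyc Y {u, v}"
  obtains g1 g2 where "g1 \<in> faces Y" "g2 \<in> faces Y"
    "\<And>p. p \<in> open_arc {u, v} \<union> open_arc {v, w} \<union> {pos v} \<Longrightarrow> p \<in> closure g1 \<and> p \<in> closure g2"
    "\<And>p. p \<in> open_arc {u, v} \<union> open_arc {v, w} \<union> {pos v} \<Longrightarrow>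
        \<exists>N. open N \<and> p \<in> N \<and> N \<subseteq> (D {u, v} \<union> D {v, w}) \<union> (g1 \<union> g2)"
proof -
  have E12: "{u, v} \<in> E" "{v, w} \<in> E" using e1 e2 Y by auto
  obtain P1 where P1: "arc P1" "pathstart P1 = pos u" "pathfinish P1 = pos v" "path_image P1 = D {u, v}" "u \<noteq> v" "u \<in> V" "v \<in> V"
    using arc_of[OF E12(1)] by blast
  obtain P2 where P2: "arc P2" "pathstart P2 = pos v" "pathfinish P2 = pos w" "path_image P2 = D {v, w}" "v \<noteq> w" "w \<in> V"
    using arc_of[OF E12(2)] by blast
  have ne: "{u, v} \<noteq> {v, w}" using uw P1 P2 by (auto simp: doubleton_eq_iff)
  have pne: "pos u \<noteq> pos v" "pos v \<noteq> pos w" "pos u \<noteq> pos w"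
    using inj P1 P2 uw by (auto simp: inj_on_eq_iff)
  have "{u, v} \<inter> {v, w} = {v}" using uw P1 P2 by auto
  then have i12: "D {u, v} \<inter> D {v, w} = {pos v}"
    using D_inter[OF E12 ne] pos_in_D[OF E12(1), of v] pos_in_D[OF E12(2), of v] by auto
  define P where "P = P1 +++ P2"
  have P: "arc P" "pathstart P = pos u" "pathfinish P = pos w" "path_image P = D {u, v} \<union> D {v, w}"
  proof -
    show "arc P" unfolding P_def by (rule arc_join) (use P1 P2 i12 in simp_all)
    show "pathstart P = pos u" "pathfinish P = pos w" unfolding P_def using P1(2) P2(3) by simp_all
    show "path_image P = D {u, v} \<union> D {v, w}" unfolding P_def using P1(3,4) P2(2,4) by (simp add: path_image_join)
  qed
  define Z where "Z = Y - {{u, v}, {v, w}}"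
  have ZE: "Z \<subseteq> E" using Y unfolding Z_def by blast
  have Zv: "v \<notin> e" if "e \<in> Z" for e using deg that unfolding Z_def by blast
  \<comment> \<open>\<open>pos v\<close> is left out because it becomes an inner point of the
    crosscut.\<close>
  define K where "K = pos ` (V - {v}) \<union> \<Union> (D ` Z)"
  have vK: "pos v \<notin> K"
  proof
    assume "pos v \<in> K"
    then consider z where "z \<in> V" "z \<noteq> v" "pos v = pos z" | e where "e \<in> Z" "pos v \<in> D e" unfolding K_def by blast
    then show False
    proof cases
      case 1 then show False using inj P1(7) by (simp add: inj_on_eq_iff)
    next
      case 2 then show False using Zv[of e] vert_on[of e v] ZE P1(7) by blast
    qed
  qed
  have pY: "pts Y = K \<union> path_image P"
  proof -
    have 1: "pos ` V = insert (pos v) (pos ` (V - {v}))" using P1(7) by blast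
    have 2: "\<Union> (D ` Y) = D {u, v} \<union> D {v, w} \<union> \<Union> (D ` Z)" unfolding Z_def using e1 e2 by blast
    have "pos v \<in> D {u, v}" using i12 by blast
    then show ?thesis unfolding pts_def K_def P(4) 1 2 by blast
  qed
  have KZ: "K \<subseteq> pts Z" unfolding K_def pts_def by blast
  have KP: "K \<inter> path_image P = {pathstart P, pathfinish P}"
  proof -
    have "pts Z \<inter> D {u, v} = {pos u, pos v}" "pts Z \<inter> D {v, w} = {pos v, pos w}"
      using D_pts[OF E12(1) ZE] D_pts[OF E12(2) ZE] unfolding Z_def by auto
    then have "K \<inter> path_image P \<subseteq> {pos u, pos w}" unfolding P(4) using KZ vK by blast
    moreover have "pos u \<in> K" "pos w \<in> K" unfolding K_def using P1 P2 by blast+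
    moreover have "pos u \<in> path_image P" "pos w \<in> path_image P" unfolding P(4)
      using pos_in_D[OF E12(1), of u] pos_in_D[OF E12(2), of w] by simp_all
    ultimately show ?thesis unfolding P(2,3) by blast
  qed
  have cK: "compact K"
  proof -
    have "compact (pos ` (V - {v}))" using finV by (auto intro: finite_imp_compact)
    moreover have "compact (\<Union> (D ` Z))"
      using finite_subset[OF ZE finE] compact_D ZE by (intro compact_UN) auto
    ultimately show ?thesis unfolding K_def by (rule compact_Un)
  qed
  \<comment> \<open>A walk from \<open>w\<close> that avoids \<open>{u, v}\<close> can enter and
    leave \<open>v\<close> only through \<open>w\<close>; so it ends in \<open>v\<close> or can be
    shortened to avoid \<open>v\<close>.\<close>
  have key: "z = v \<or> (w, z) \<in> reach Z" if "(w, z) \<in> reach (Y - {{u, v}})" for z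
    using that unfolding reach_def
  proof (induction rule: rtrancl_induct)
    case base then show ?case by simp
  next
    case (step y z)
    then have yz: "{y, z} \<in> Y" "{y, z} \<noteq> {u, v}" by auto
    show ?case
    proof (cases "{y, z} = {v, w}")
      case True then show ?thesis by (auto simp: doubleton_eq_iff)
    next
      case False
      then have yzZ: "{y, z} \<in> Z" using yz unfolding Z_def by blast
      then have "y \<noteq> v" using Zv by blast
      with step.IH have "(w, y) \<in> {(p, q). {p, q} \<in> Z}\<^sup>*" by simp
      then show ?thesis using yzZ by (meson CollectI case_prodI rtrancl.rtrancl_into_rtrancl)
    qed
  qed
  have "(v, u) \<in> reach (Y - {{u, v}})" using c reach_sym unfolding cyc_iff by blast
  then obtain z where z: "{v, z} \<in> Y - {{u, v}}" "(z, u) \<in> reach (Y - {{u, v}})"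
    unfolding reach_def by (rule converse_rtranclE) (use P1(5) in auto)
  then have "z = w" using deg[of "{v, z}"] by (auto simp: doubleton_eq_iff)
  then have wu: "(w, u) \<in> reach Z" using key[of u] z P1(5) by blast
  have pc: "path_component K (pathfinish P) (pathstart P)"
    unfolding P(2,3) by (rule reach_path[OF ZE wu]) (use P2(5,6) K_def in auto)
  have ends: "open_arc {u, v} \<union> open_arc {v, w} \<union> {pos v} \<subseteq> path_image P - {pathstart P, pathfinish P}"
  proof -
    have "pos w \<notin> D {u, v}" "pos u \<notin> D {v, w}"
      using vert_on[OF E12(1), of w] vert_on[OF E12(2), of u] P1 P2 uw by auto
    moreover have "pos u \<in> D {u, v}" "pos w \<in> D {v, w}" "pos v \<in> D {u, v}"
      using pos_in_D[OF E12(1)] pos_in_D[OF E12(2)] by simp_all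
    ultimately have "open_arc {u, v} \<subseteq> path_image P - {pos u, pos w}" "open_arc {v, w} \<subseteq> path_image P - {pos u, pos w}"
      "pos v \<in> path_image P - {pos u, pos w}"
      unfolding open_arc_def P(4) using pne by auto
    then show ?thesis unfolding P(2,3) by simp
  qed
  show ?thesis
  proof (rule thread[OF P(1) cK KP pc])
    fix f0 g1 g2
    assume *: "g1 \<in> components (- (K \<union> path_image P))" "g2 \<in> components (- (K \<union> path_image P))"
      "\<And>p. p \<in> path_image P - {pathstart P, pathfinish P} \<Longrightarrow> p \<in> closure g1 \<and> p \<in> closure g2"
      "\<And>p. p \<in> path_image P - {pathstart P, pathfinish P} \<Longrightarrow> \<exists>N. open N \<and> p \<in> N \<and> N \<subseteq> path_image P \<union> g1 \<union> g2"
    show thesis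
    proof (rule that[of g1 g2])
      show "g1 \<in> faces Y" "g2 \<in> faces Y" unfolding faces_def pY using * by auto
      show "\<And>p. p \<in> open_arc {u, v} \<union> open_arc {v, w} \<union> {pos v} \<Longrightarrow> p \<in> closure g1 \<and> p \<in> closure g2"
        using *(3) ends by blast
      show "\<exists>N. open N \<and> p \<in> N \<and> N \<subseteq> (D {u, v} \<union> D {v, w}) \<union> (g1 \<union> g2)"
        if "p \<in> open_arc {u, v} \<union> open_arc {v, w} \<union> {pos v}" for p
      proof -
        have "p \<in> path_image P - {pathstart P, pathfinish P}" using that ends by blast
        from *(4)[OF this] show ?thesis unfolding P(4) by (simp only: Un_assoc)
      qed
    qed
  qed
qed

text \<open>A face along the first edge is one of the two faces of the path, and both of these also
  lie along the second edge.\<close>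

lemma border_thread:
  assumes X: "X \<subseteq> E" and e1: "{u, v} \<in> X" and e2: "{v, w} \<in> X" and uw: "u \<noteq> w"
    and deg: "\<And>e. e \<in> X \<Longrightarrow> v \<in> e \<Longrightarrow> e = {u, v} \<or> e = {v, w}"
    and c: "cyc X {u, v}" and f: "f \<in> faces X" and b: "{u, v} \<in> border X f"
  shows "{v, w} \<in> border X f"
proof (rule two_thread[OF X e1 e2 uw deg c])
  fix g1 g2
  assume g: "g1 \<in> faces X" "g2 \<in> faces X"
    and cl: "\<And>p. p \<in> open_arc {u, v} \<union> open_arc {v, w} \<union> {pos v} \<Longrightarrow> p \<in> closure g1 \<and> p \<in> closure g2"
    and N: "\<And>p. p \<in> open_arc {u, v} \<union> open_arc {v, w} \<union> {pos v} \<Longrightarrow>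
        \<exists>N. open N \<and> p \<in> N \<and> N \<subseteq> (D {u, v} \<union> D {v, w}) \<union> (g1 \<union> g2)"
  obtain p where p: "p \<in> open_arc {u, v}" "p \<in> closure f" using b unfolding border_def by blast
  obtain N where N: "open N" "p \<in> N" "N \<subseteq> (D {u, v} \<union> D {v, w}) \<union> (g1 \<union> g2)" using N p by blast
  have "D {u, v} \<union> D {v, w} \<subseteq> pts X" unfolding pts_def using e1 e2 by blast
  then obtain z where "z \<in> f" "z \<in> g1 \<union> g2" using near_point[OF X f p(2) N] by metis
  then have "f = g1 \<or> f = g2" using f g component_eqI unfolding faces_def by (metis UnE)
  moreover obtain q where "q \<in> open_arc {v, w}" using open_arc_nonempty e2 X by blast
  ultimately have "q \<in> closure f" using cl by blast
  then show ?thesis unfolding border_def using e2 \<open>q \<in> open_arc {v, w}\<close> by blast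
qed auto

text \<open>In the union of the two borders \<open>v\<close> has degree 2, so near
  \<open>pos v\<close> there is nothing but the two edges, \<open>f\<close> and \<open>f'\<close>. A
  third edge at \<open>v\<close> would have to pass through there.\<close>

lemma shared_sides:
  assumes X: "X \<subseteq> E" and uw: "u \<noteq> w"
    and f: "f \<in> faces X" "f' \<in> faces X" "f \<noteq> f'"
    and e: "{u, v} \<in> border X f" "{v, w} \<in> border X f" "{u, v} \<in> border X f'"
    and deg: "\<And>e. e \<in> border X f \<union> border X f' \<Longrightarrow> v \<in> e \<Longrightarrow> e = {u, v} \<or> e = {v, w}"
    and c: "cyc (border X f) {u, v}" and e3: "e3 \<in> X" "v \<in> e3"
  shows "e3 = {u, v} \<or> e3 = {v, w}"
proof (rule ccontr)
  assume n: "\<not> ?thesis"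
  define Y where "Y = border X f \<union> border X f'"
  have YX: "Y \<subseteq> X" unfolding Y_def border_def by blast
  then have YE: "Y \<subseteq> E" using X by blast
  have f_Y: "f \<in> faces Y" "f' \<in> faces Y"
    by (rule face_of_border[OF X]; use f YX Y_def in blast)+
  have e12: "{u, v} \<in> Y" "{v, w} \<in> Y" using e unfolding Y_def by auto
  have cY: "cyc Y {u, v}" using cyc_mono[OF c] unfolding Y_def by blast
  have degY: "\<And>e. e \<in> Y \<Longrightarrow> v \<in> e \<Longrightarrow> e = {u, v} \<or> e = {v, w}" using deg unfolding Y_def by blast
  show False
  proof (rule two_thread[OF YE e12 uw degY cY])
    fix g1 g2
    assume g: "g1 \<in> faces Y" "g2 \<in> faces Y"
      and N: "\<And>p. p \<in> open_arc {u, v} \<union> open_arc {v, w} \<union> {pos v} \<Longrightarrow>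
          \<exists>N. open N \<and> p \<in> N \<and> N \<subseteq> (D {u, v} \<union> D {v, w}) \<union> (g1 \<union> g2)"
    have Dp: "D {u, v} \<union> D {v, w} \<subseteq> pts Y" unfolding pts_def using e12 by blast
    have in_g: "h = g1 \<or> h = g2" if h: "h \<in> faces Y" "{u, v} \<in> border X h" for h
    proof -
      obtain p where p: "p \<in> open_arc {u, v}" "p \<in> closure h" using h unfolding border_def by blast
      obtain N where N: "open N" "p \<in> N" "N \<subseteq> (D {u, v} \<union> D {v, w}) \<union> (g1 \<union> g2)" using N p by blast
      obtain z where "z \<in> h" "z \<in> g1 \<union> g2" using near_point[OF YE h(1) p(2) N Dp] by metis
      then show ?thesis using h g component_eqI unfolding faces_def by (metis UnE)
    qed
    \<comment> \<open>\<open>f\<close> and \<open>f'\<close> are both among \<open>g1\<close> and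
      \<open>g2\<close>; since they differ, the pairs agree.\<close>
    have gf: "g1 \<union> g2 \<subseteq> f \<union> f'" using in_g[OF f_Y(1) e(1)] in_g[OF f_Y(2) e(3)] f(3) by blast
    obtain N where N: "open N" "pos v \<in> N" "N \<subseteq> (D {u, v} \<union> D {v, w}) \<union> (g1 \<union> g2)" using N by blast
    have e3E: "e3 \<in> E" using e3 X by blast
    obtain t where t: "e3 = {v, t}" "t \<noteq> v" using edgeE[OF e3E] e3(2) by (metis doubleton_eq_iff insertE singletonD)
    obtain Q where Q: "arc Q" "pathstart Q = pos v" "pathfinish Q = pos t" "path_image Q = D e3"
      using arc_of e3E t by metis
    \<comment> \<open>An arc is connected and not a single point, so its end is a limit of inner
      points.\<close>
    have "pos v \<in> closure (open_arc e3)"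
    proof -
      have 1: "open_arc e3 = path_image Q - {pathstart Q, pathfinish Q}" unfolding open_arc_def Q t by simp
      have ne: "pathstart Q \<noteq> pathfinish Q" using arc_distinct_ends[OF Q(1)] by simp
      have "pathstart Q islimpt path_image Q"
      proof (rule connected_imp_perfect)
        show "path_image Q \<noteq> {x}" for x
          using ne pathstart_in_path_image pathfinish_in_path_image by (metis singletonD)
      qed (use Q(1) connected_arc_image in auto)
      moreover have "path_image Q = insert (pathstart Q) (insert (pathfinish Q) (open_arc e3))"
        unfolding 1 using pathstart_in_path_image pathfinish_in_path_image by blast
      ultimately have "pathstart Q islimpt open_arc e3" by (simp add: islimpt_insert)
      then show ?thesis unfolding Q(2) closure_def by simp
    qed
    then obtain z where z: "z \<in> N" "z \<in> open_arc e3"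
      using N by (metis IntI closure_iff_nhds_not_empty disjoint_iff order_refl)
    have "z \<notin> f \<union> f'" using z(2) face_disj[OF f(1)] face_disj[OF f(2)] e3(1) unfolding open_arc_def pts_def by blast
    then have zz: "z \<in> D {u, v} \<or> z \<in> D {v, w}" using N z gf by blast
    have zV: "z \<notin> pos ` V" using open_arc_pos[OF e3E] z by blast
    have "z \<in> D e3" using z unfolding open_arc_def by blast
    then show False using cross[OF e3E, of "{u, v}"] cross[OF e3E, of "{v, w}"] zz zV n e12 YE by blast
  qed
qed

end

section \<open>Hall's theorem\<close>

lemma card_minus1: "finite X \<Longrightarrow> card X \<le> card (X - {a}) + 1"
proof (cases "a \<in> X")
  case True
  assume "finite X"
  from card_Suc_Diff1[OF this True] show ?thesis by simp
qed simp

text \<open>Induction on \<open>S\<close>: if every nonempty proper subset has a colour to spare,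
  one vertex is coloured arbitrarily. Otherwise a tight subset \<open>T\<close> is coloured first,
  and tightness keeps the condition for the rest once the colours of \<open>T\<close> are
  removed.\<close>

lemma hall:
  assumes "finite S" "\<And>x. x \<in> S \<Longrightarrow> finite (L x)" "\<And>T. T \<subseteq> S \<Longrightarrow> card T \<le> card (\<Union> (L ` T))"
  shows "\<exists>g. inj_on g S \<and> (\<forall>x\<in>S. g x \<in> L x)"
  using assms
proof (induction S arbitrary: L rule: finite_psubset_induct)
  case (psubset S)
  note finL = psubset.prems(1) and H = psubset.prems(2)
  show ?case
  proof (cases "S = {}")
    case True then show ?thesis by auto
  next
    case False
    then obtain s where s: "s \<in> S" by blast
    show ?thesis
    proof (cases "\<forall>T. T \<subseteq> S \<longrightarrow> T \<noteq> {} \<longrightarrow> T \<noteq> S \<longrightarrow> card T < card (\<Union> (L ` T))")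
      case True
      have "card {s} \<le> card (\<Union> (L ` {s}))" using H[of "{s}"] s by blast
      then obtain a where a: "a \<in> L s" by fastforce
      have "\<exists>g. inj_on g (S - {s}) \<and> (\<forall>x\<in>S - {s}. g x \<in> L x - {a})"
      proof (rule psubset.IH)
        show "S - {s} \<subset> S" using s by blast
        show "\<And>x. x \<in> S - {s} \<Longrightarrow> finite (L x - {a})" using finL by blast
        fix T assume T: "T \<subseteq> S - {s}"
        show "card T \<le> card (\<Union>x\<in>T. L x - {a})"
        proof (cases "T = {}")
          case False
          then have "card T < card (\<Union> (L ` T))" using True T s by blast
          moreover have "(\<Union>x\<in>T. L x - {a}) = \<Union> (L ` T) - {a}" by blast
          moreover have "card (\<Union> (L ` T)) \<le> card (\<Union> (L ` T) - {a}) + 1"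
          proof (rule card_minus1)
            show "finite (\<Union> (L ` T))" using T finL psubset.hyps finite_subset by blast
          qed
          ultimately show ?thesis by simp
        qed simp
      qed
      then obtain g where g: "inj_on g (S - {s})" "\<And>x. x \<in> S - {s} \<Longrightarrow> g x \<in> L x - {a}" by blast
      have "inj_on (g(s := a)) S"
        using g unfolding inj_on_def by (metis Diff_iff fun_upd_apply insertCI singletonD)
      moreover have "\<forall>x\<in>S. (g(s := a)) x \<in> L x" using g a by auto
      ultimately show ?thesis by blast
    next
      case False
      then obtain T where T: "T \<subseteq> S" "T \<noteq> {}" "T \<noteq> S" "card (\<Union> (L ` T)) \<le> card T"
        by (meson not_le_imp_less)
      then have eq: "card (\<Union> (L ` T)) = card T" using H[OF T(1)] by simp
      have finS: "finite S" and finT: "finite T" using psubset.hyps T finite_subset by auto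
      obtain g where g: "inj_on g T" "\<And>x. x \<in> T \<Longrightarrow> g x \<in> L x"
        using psubset.IH[of T L] T finL H by (meson psubsetI subset_trans subsetD)
      let ?B = "\<Union> (L ` T)"
      have finB: "finite ?B" using finT T finL by blast
      have "\<exists>h. inj_on h (S - T) \<and> (\<forall>x\<in>S - T. h x \<in> L x - ?B)"
      proof (rule psubset.IH)
        show "S - T \<subset> S" using T by blast
        show "\<And>x. x \<in> S - T \<Longrightarrow> finite (L x - ?B)" using finL by blast
        fix R assume R: "R \<subseteq> S - T"
        have finR: "finite R" using R finS finite_subset by blast
        have "card R + card T = card (R \<union> T)" using R finR finT by (intro card_Un_disjoint[symmetric]) auto
        also have "\<dots> \<le> card (\<Union> (L ` (R \<union> T)))" using H[of "R \<union> T"] R T by blast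
        also have "\<Union> (L ` (R \<union> T)) = (\<Union>x\<in>R. L x - ?B) \<union> ?B" by blast
        also have "card \<dots> \<le> card (\<Union>x\<in>R. L x - ?B) + card ?B" by (rule card_Un_le)
        finally show "card R \<le> card (\<Union>x\<in>R. L x - ?B)" using eq by simp
      qed
      then obtain h where h: "inj_on h (S - T)" "\<And>x. x \<in> S - T \<Longrightarrow> h x \<in> L x - ?B" by blast
      define f where "f x = (if x \<in> T then g x else h x)" for x
      have "inj_on f S"
      proof (rule inj_onI)
        fix x y assume xy: "x \<in> S" "y \<in> S" "f x = f y"
        have m: "z \<in> T \<Longrightarrow> f z \<in> ?B" "z \<in> S - T \<Longrightarrow> f z \<notin> ?B" for z
          using g(2) h(2) unfolding f_def by auto
        have iff: "x \<in> T \<longleftrightarrow> y \<in> T" using m[of x] m[of y] xy by auto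
        show "x = y"
        proof (cases "x \<in> T")
          case True then show ?thesis using iff xy g(1) unfolding f_def inj_on_def by simp
        next
          case False then show ?thesis using iff xy h(1) unfolding f_def inj_on_def by simp
        qed
      qed
      moreover have "\<forall>x\<in>S. f x \<in> L x" using g(2) h(2) unfolding f_def by auto
      ultimately show ?thesis by blast
    qed
  qed
qed

lemma card_le1_eq: "card A \<le> 1 \<Longrightarrow> finite A \<Longrightarrow> x \<in> A \<Longrightarrow> y \<in> A \<Longrightarrow> x = y"
  by (simp add: card_le_Suc0_iff_eq)

section \<open>Critical graphs\<close>

locale sgraph =
  fixes V :: "'a set" and adj :: "'a \<Rightarrow> 'a \<Rightarrow> bool"
  assumes finV: "finite V" and adj_sym: "adj u v \<Longrightarrow> adj v u" and adj_irr: "\<not> adj v v"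
    and adj_V: "adj u v \<Longrightarrow> u \<in> V \<and> v \<in> V"
begin

definition N :: "'a \<Rightarrow> 'a set" where "N v = {w. adj v w}"
definition deg :: "'a \<Rightarrow> nat" where "deg v = card (N v)"
text \<open>Adjacency in the square of the graph, whose proper colourings are the 2-distance
  colourings.\<close>

definition sq :: "'a \<Rightarrow> 'a \<Rightarrow> bool" where
  "sq u v \<longleftrightarrow> u \<noteq> v \<and> (adj u v \<or> (\<exists>w. adj u w \<and> adj w v))"
definition N2 :: "'a \<Rightarrow> 'a set" where "N2 v = {u. sq v u}"
text \<open>What \<open>x\<close> sees through its neighbour \<open>w\<close>: exactly
  \<open>deg w\<close> vertices, pairwise adjacent in the square. So the degrees of the neighbours
  bound the number of forbidden colours.\<close>

definition star :: "'a \<Rightarrow> 'a \<Rightarrow> 'a set" where "star x w = insert w (N w - {x})"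

lemma N_iff[simp]: "w \<in> N v \<longleftrightarrow> adj v w" unfolding N_def by simp
lemma adj_comm: "adj u v \<longleftrightarrow> adj v u" using adj_sym by blast
lemma N_sub: "N v \<subseteq> V" using adj_V by auto
lemma fin_N[simp]: "finite (N v)" using N_sub finV finite_subset by blast
lemma sq_sym: "sq u v \<Longrightarrow> sq v u" unfolding sq_def using adj_sym by blast
lemma N2_sub: "N2 v \<subseteq> V" unfolding N2_def sq_def using adj_V by blast
lemma fin_N2[simp]: "finite (N2 v)" using N2_sub finV finite_subset by blast
lemma fin_star[simp]: "finite (star x w)" unfolding star_def by simp

lemma N2_star: "N2 x \<subseteq> (\<Union>w\<in>N x. star x w)"
  unfolding N2_def sq_def star_def by auto

lemma card_star: "adj x w \<Longrightarrow> card (star x w) = deg w"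
proof -
  assume a: "adj x w"
  then have "x \<in> N w" "w \<notin> N w - {x}" using adj_sym adj_irr by auto
  then show ?thesis unfolding star_def deg_def
    by (metis card_Suc_Diff1 card_insert_disjoint fin_N finite_Diff)
qed

lemma star_sq: "p \<in> star x w \<Longrightarrow> q \<in> star x w \<Longrightarrow> p \<noteq> q \<Longrightarrow> sq p q"
  unfolding star_def sq_def using adj_sym by auto

end

text \<open>\<open>D\<close> comes from the whole graph and is only an upper bound for the degrees
  here. The colouring in \<open>minimal\<close> belongs to the induced subgraph without
  \<open>r\<close>: vertices whose only common neighbour is \<open>r\<close> may share a
  colour.\<close>

locale critical = sgraph +
  fixes D k :: nat
  assumes D_ge6: "6 \<le> D" and k_def: "k = D + 4" and deg_le: "deg v \<le> D"
    and noncol: "\<not> (\<exists>c::'a \<Rightarrow> nat. (\<forall>v\<in>V. c v < k) \<and> (\<forall>u\<in>V. \<forall>v\<in>V. sq u v \<longrightarrow> c u \<noteq> c v))"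
    and minimal: "r \<in> V \<Longrightarrow> \<exists>c::'a \<Rightarrow> nat. (\<forall>v\<in>V - {r}. c v < k) \<and>
        (\<forall>u\<in>V - {r}. \<forall>v\<in>V - {r}. u \<noteq> v \<and> (adj u v \<or> (\<exists>w\<in>V - {r}. adj u w \<and> adj w v)) \<longrightarrow> c u \<noteq> c v)"
    and girth6: "distinct vs \<Longrightarrow> 3 \<le> length vs \<Longrightarrow> successively adj vs \<Longrightarrow> adj (last vs) (hd vs) \<Longrightarrow> 6 \<le> length vs"
begin

section \<open>Excluded short cycles and partial colourings\<close>

lemma no3: "adj a b \<Longrightarrow> adj b c \<Longrightarrow> adj c a \<Longrightarrow> False"
proof -
  assume "adj a b" "adj b c" "adj c a"
  moreover from this have "a \<noteq> b" "b \<noteq> c" "c \<noteq> a" using adj_irr by auto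
  ultimately show False using girth6[of "[a, b, c]"] by simp
qed

lemma no4: "adj a b \<Longrightarrow> adj b c \<Longrightarrow> adj c d \<Longrightarrow> adj d a \<Longrightarrow> a \<noteq> c \<Longrightarrow> b \<noteq> d \<Longrightarrow> False"
proof -
  assume "adj a b" "adj b c" "adj c d" "adj d a" "a \<noteq> c" "b \<noteq> d"
  moreover from this have "a \<noteq> b" "b \<noteq> c" "c \<noteq> d" "d \<noteq> a" using adj_irr by auto
  ultimately show False using girth6[of "[a, b, c, d]"] by simp
qed

text \<open>Distinctness of non-consecutive vertices is automatic: a repetition would leave a
  triangle.\<close>

lemma no5: "adj a b \<Longrightarrow> adj b c \<Longrightarrow> adj c d \<Longrightarrow> adj d e \<Longrightarrow> adj e a \<Longrightarrow> False"
proof -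
  assume h: "adj a b" "adj b c" "adj c d" "adj d e" "adj e a"
  have ne: "a \<noteq> b" "b \<noteq> c" "c \<noteq> d" "d \<noteq> e" "e \<noteq> a" using h adj_irr by auto
  have "a \<noteq> c" using h no3[of c d e] by blast
  moreover have "a \<noteq> d" using h no3[of a b c] by blast
  moreover have "b \<noteq> d" using h no3[of d e a] by blast
  moreover have "b \<noteq> e" using h no3[of b c d] by blast
  moreover have "c \<noteq> e" using h no3[of e a b] by blast
  ultimately show False using h ne girth6[of "[a, b, c, d, e]"] by simp
qed

text \<open>Distances are those of the whole graph, also through uncoloured vertices; a colouring of
  \<open>W\<close> can then be extended without being touched.\<close>

definition valid :: "('a \<Rightarrow> nat) \<Rightarrow> 'a set \<Rightarrow> bool" where
  "valid c W \<longleftrightarrow> (\<forall>v\<in>W. c v < k) \<and> (\<forall>u\<in>W. \<forall>v\<in>W. sq u v \<longrightarrow> c u \<noteq> c v)"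

definition avail :: "('a \<Rightarrow> nat) \<Rightarrow> 'a set \<Rightarrow> 'a \<Rightarrow> nat set" where
  "avail c W x = {..<k} - c ` (N2 x \<inter> W)"

lemma valid_subset: "valid c W \<Longrightarrow> W' \<subseteq> W \<Longrightarrow> valid c W'"
  unfolding valid_def by blast

lemma not_valid_V: "\<not> valid c V"
  using noncol unfolding valid_def by blast

lemma fin_avail[simp]: "finite (avail c W x)"
  unfolding avail_def by simp

lemma avail_ge: "N2 x \<inter> W \<subseteq> B \<Longrightarrow> finite B \<Longrightarrow> k - card B \<le> card (avail c W x)"
proof -
  assume B: "N2 x \<inter> W \<subseteq> B" "finite B"
  have "card (c ` (N2 x \<inter> W)) \<le> card (N2 x \<inter> W)" by (rule card_image_le) simp
  also have "\<dots> \<le> card B" using B by (rule card_mono[rotated])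
  finally have "card (c ` (N2 x \<inter> W)) \<le> card B" .
  moreover have "card {..<k} - card (c ` (N2 x \<inter> W)) \<le> card ({..<k} - c ` (N2 x \<inter> W))"
    by (rule diff_card_le_card_Diff) simp
  ultimately show ?thesis unfolding avail_def by simp
qed

text \<open>Different colours on all of \<open>S\<close> are no loss when \<open>S\<close> is a
  vertex with its neighbours, a clique in the square.\<close>

lemma extend:
  assumes c: "valid c W" and S: "S \<inter> W = {}" and g: "inj_on g S" "\<And>x. x \<in> S \<Longrightarrow> g x \<in> avail c W x"
  shows "valid (\<lambda>v. if v \<in> S then g v else c v) (W \<union> S)"
  unfolding valid_def
proof (intro conjI ballI impI)
  fix v assume "v \<in> W \<union> S"
  then show "(if v \<in> S then g v else c v) < k" using c g(2) unfolding valid_def avail_def by auto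
next
  fix u v assume uv: "u \<in> W \<union> S" "v \<in> W \<union> S" "sq u v"
  have ne: "u \<noteq> v" using uv(3) unfolding sq_def by simp
  have cross: "g x \<noteq> c y" if "x \<in> S" "y \<in> W" "sq x y" for x y
    using g(2)[OF that(1)] that unfolding avail_def N2_def by blast
  show "(if u \<in> S then g u else c u) \<noteq> (if v \<in> S then g v else c v)"
    using uv ne c cross[of u v] cross[of v u] sq_sym g(1) unfolding valid_def inj_on_def by (metis Un_iff)
qed

lemma extend1:
  assumes c: "valid c W" and x: "x \<notin> W" and a: "a \<in> avail c W x"
  shows "valid (c(x := a)) (insert x W)"
proof -
  have "valid (\<lambda>v. if v \<in> {x} then (\<lambda>_. a) v else c v) (W \<union> {x})"
    by (rule extend[OF c]) (use x a in auto)
  moreover have "(\<lambda>v. if v \<in> {x} then (\<lambda>_. a) v else c v) = c(x := a)" by auto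
  ultimately show ?thesis by simp
qed

lemma greedy:
  assumes c: "valid c W" and x: "x \<notin> W" and B: "N2 x \<inter> W \<subseteq> B" "finite B" "card B < k"
  shows "\<exists>a. valid (c(x := a)) (insert x W)"
proof -
  have "card (avail c W x) > 0" using avail_ge[OF B(1,2), of c] B(3) by simp
  then obtain a where "a \<in> avail c W x" by (metis card_gt_0_iff ex_in_conv)
  then show ?thesis using extend1[OF c x] by blast
qed

text \<open>Minimality only ignores pairs joined through \<open>r\<close>. With at most one
  neighbour of \<open>r\<close> outside \<open>U\<close> no such pair remains, so the restricted
  colouring obeys all constraints.\<close>

lemma reduce:
  assumes r: "r \<in> V" "r \<in> U" and n: "\<And>p q. adj r p \<Longrightarrow> adj r q \<Longrightarrow> p \<notin> U \<Longrightarrow> q \<notin> U \<Longrightarrow> p = q"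
  obtains c where "valid c (V - U)"
proof -
  obtain c :: "'a \<Rightarrow> nat" where c: "\<forall>v\<in>V - {r}. c v < k"
    "\<forall>u\<in>V - {r}. \<forall>v\<in>V - {r}. u \<noteq> v \<and> (adj u v \<or> (\<exists>w\<in>V - {r}. adj u w \<and> adj w v)) \<longrightarrow> c u \<noteq> c v"
    using minimal[OF r(1)] by (elim exE conjE)
  have "valid c (V - U)" unfolding valid_def
  proof (intro conjI ballI impI)
    fix v assume "v \<in> V - U" then show "c v < k" using c(1) r by blast
  next
    fix u v assume uv: "u \<in> V - U" "v \<in> V - U" "sq u v"
    show "c u \<noteq> c v"
    proof (rule c(2)[rule_format], goal_cases)
      case 3
      have "adj u v \<or> (\<exists>w\<in>V - {r}. adj u w \<and> adj w v)"
      proof (cases "adj u v")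
        case False
        then obtain w where w: "adj u w" "adj w v" "u \<noteq> v" using uv(3) unfolding sq_def by blast
        have "w \<noteq> r" using n[of u v] w uv adj_sym by blast
        then show ?thesis using w adj_V by blast
      qed simp
      then show ?case using uv(3) unfolding sq_def by simp
    qed (use uv r in auto)
  qed
  then show ?thesis using that by blast
qed

text \<open>Light vertices see fewer than \<open>k\<close> others within distance 2, so they can always be coloured last.\<close>

definition light :: "'a set" where
  "light = {a \<in> V. deg a = 2 \<and> (\<Sum>w\<in>N a. deg w) \<le> D + 3}"

lemma card_N2_le: "card (N2 x) \<le> (\<Sum>w\<in>N x. deg w)"
proof -
  have "card (N2 x) \<le> card (\<Union>w\<in>N x. star x w)" by (rule card_mono) (use N2_star in auto)
  also have "\<dots> \<le> (\<Sum>w\<in>N x. card (star x w))" by (rule card_UN_le) simp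
  also have "\<dots> = (\<Sum>w\<in>N x. deg w)" by (rule sum.cong) (auto simp: card_star)
  finally show ?thesis .
qed

lemma fin_light: "finite light" unfolding light_def using finV by auto

lemma not_valid_heavy: "\<not> valid c (V - light)"
proof
  assume c: "valid c (V - light)"
  have "\<exists>c'. valid c' ((V - light) \<union> T)" if "finite T" "T \<subseteq> light" for T
    using that
  proof (induction T rule: finite_induct)
    case empty then show ?case using c by auto
  next
    case (insert x T)
    then obtain c' where c': "valid c' ((V - light) \<union> T)" by auto
    have "\<exists>a. valid (c'(x := a)) (insert x ((V - light) \<union> T))"
    proof (rule greedy[OF c'])
      show "card (N2 x) < k" using card_N2_le[of x] insert.prems k_def unfolding light_def by auto
    qed (use insert in auto)
    then show ?case by auto
  qed
  then obtain c' where "valid c' ((V - light) \<union> light)" using fin_light by blast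
  moreover have "(V - light) \<union> light = V" unfolding light_def by blast
  ultimately show False using not_valid_V by simp
qed

section \<open>Vertices of degree at most 3 in a critical graph\<close>

lemma deg2E:
  assumes "deg v = 2" "adj v y"
  obtains w where "w \<noteq> y" "N v = {y, w}" "adj v w"
proof -
  obtain p q where pq: "N v = {p, q}" "p \<noteq> q" using assms(1) unfolding deg_def by (auto simp: card_2_iff)
  have "y \<in> {p, q}" using assms(2) pq by (metis N_iff)
  then have "(y = p \<and> q \<noteq> y \<and> N v = {y, q}) \<or> (y = q \<and> p \<noteq> y \<and> N v = {y, p})" using pq by auto
  then show ?thesis using that by (metis N_iff insertI1 insert_commute)
qed

lemma deg_ge2: "v \<in> V \<Longrightarrow> 2 \<le> deg v"
proof (rule ccontr)
  assume v: "v \<in> V" and n: "\<not> 2 \<le> deg v"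
  then have c1: "card (N v) \<le> 1" unfolding deg_def by simp
  obtain c where c: "valid c (V - {v})"
    by (rule reduce[of v "{v}"]) (use v card_le1_eq[OF c1] in auto)
  have "card (N2 v) \<le> D"
  proof (cases "N v = {}")
    case True then show ?thesis using card_N2_le[of v] by simp
  next
    case False
    then obtain w where "N v = {w}" using card_le1_eq[OF c1] by (metis fin_N is_singletonI' is_singleton_def)
    then show ?thesis using card_N2_le[of v] deg_le[of w] by simp
  qed
  then have "\<exists>a. valid (c(v := a)) (insert v (V - {v}))"
    by (intro greedy[OF c, of v "N2 v"]) (auto simp: k_def)
  then show False using not_valid_V v by (auto simp: insert_absorb)
qed

text \<open>After uncolouring both, \<open>a\<close> sees at most \<open>D + 1\<close> coloured
  vertices, and then \<open>b\<close> at most \<open>D + 2\<close>.\<close>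

lemma no_adj_2: "deg a = 2 \<Longrightarrow> deg b = 2 \<Longrightarrow> adj a b \<Longrightarrow> False"
proof -
  assume a2: "deg a = 2" and b2: "deg b = 2" and ab: "adj a b"
  have aV: "a \<in> V" "b \<in> V" using ab adj_V by auto
  obtain a' where a': "N a = {b, a'}" "a' \<noteq> b" "adj a a'" using deg2E[OF a2 ab] by metis
  obtain b' where b': "N b = {a, b'}" "b' \<noteq> a" "adj b b'" using deg2E[OF b2 adj_sym[OF ab]] by metis
  have ap: "adj a p \<longleftrightarrow> p = b \<or> p = a'" for p using a'(1) by (metis N_iff insert_iff singletonD)
  obtain c where c: "valid c (V - {a, b})"
    by (rule reduce[of a "{a, b}"]) (use aV ap in auto)
  have ne: "a \<noteq> b" using ab adj_irr by auto
  have 1: "N2 a \<inter> (V - {a, b}) \<subseteq> {b'} \<union> star a a'"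
    using N2_star[of a] unfolding a'(1) by (auto simp: star_def b')
  have "card ({b'} \<union> star a a') \<le> 1 + D"
    using card_Un_le[of "{b'}" "star a a'"] card_star[OF a'(3)] deg_le[of a'] by simp
  then obtain \<alpha> where c1: "valid (c(a := \<alpha>)) (insert a (V - {a, b}))"
    using greedy[OF c _ 1] by (auto simp: k_def)
  have 2: "N2 b \<inter> insert a (V - {a, b}) \<subseteq> star b a \<union> star b b'"
    using N2_star[of b] unfolding b'(1) by auto
  have "card (star b a \<union> star b b') \<le> 2 + D"
    using card_Un_le[of "star b a" "star b b'"] card_star[OF b'(3)] card_star[OF adj_sym[OF ab]] a2 deg_le[of b'] by simp
  then obtain \<beta> where "valid (c(a := \<alpha>, b := \<beta>)) (insert b (insert a (V - {a, b})))"
    using greedy[OF c1 _ 2] ne by (auto simp: k_def)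
  moreover have "insert b (insert a (V - {a, b})) = V" using aV by auto
  ultimately show False using not_valid_V by simp
qed

text \<open>Otherwise \<open>x\<close> could be coloured before the light vertices, and these last.
  Removing \<open>a\<close> provides the starting colouring, because its neighbour \<open>x\<close>
  is uncoloured as well.\<close>

lemma light_nbr:
  assumes a: "a \<in> light" and x: "adj x a"
  shows "k \<le> card (N2 x - light)"
proof (rule ccontr)
  assume n: "\<not> ?thesis"
  have a2: "deg a = 2" "a \<in> V" using a unfolding light_def by auto
  have xV: "x \<in> V" using x adj_V by auto
  obtain w where w: "N a = {x, w}" using deg2E[OF a2(1) adj_sym[OF x]] by metis
  have ap: "adj a p \<longleftrightarrow> p = x \<or> p = w" for p using w by (metis N_iff insert_iff singletonD)
  obtain c where c: "valid c (V - insert x light)"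
    by (rule reduce[of a "insert x light"]) (use a a2 ap in auto)
  have "\<exists>\<alpha>. valid (c(x := \<alpha>)) (insert x (V - insert x light))"
    by (rule greedy[OF c, of x "N2 x - light"]) (use n in auto)
  then obtain c' where "valid c' (insert x (V - insert x light))" by blast
  then have "valid c' (V - light)" by (rule valid_subset) (use xV in auto)
  then show False using not_valid_heavy by blast
qed

lemma light_of_deg3: "deg x = 3 \<Longrightarrow> deg a = 2 \<Longrightarrow> adj x a \<Longrightarrow> a \<in> light"
proof -
  assume x: "deg x = 3" and a: "deg a = 2" and xa: "adj x a"
  obtain w where w: "N a = {x, w}" "w \<noteq> x" using deg2E[OF a adj_sym[OF xa]] by metis
  then have "(\<Sum>w\<in>N a. deg w) = 3 + deg w" using x by simp
  then show ?thesis using a xa adj_V deg_le[of w] unfolding light_def by auto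
qed

text \<open>Since \<open>a\<close> is light, the vertices seen by \<open>x\<close> that are not
  light are among the far neighbour of \<open>a\<close> and the stars of \<open>y\<close> and
  \<open>z\<close>: at most \<open>1 + deg y + deg z\<close>, while \<open>light_nbr\<close> asks
  for \<open>D + 4\<close>.\<close>

lemma deg3_sum:
  assumes x: "deg x = 3" and N: "N x = {a, y, z}" and a: "deg a = 2"
  shows "D + 3 \<le> deg y + deg z"
proof -
  have adj: "adj x a" "adj x y" "adj x z" using N by (metis N_iff insertCI)+
  have aL: "a \<in> light" using light_of_deg3[OF x a adj(1)] .
  obtain w where w: "N a = {x, w}" using deg2E[OF a adj_sym[OF adj(1)]] by metis
  have "N2 x - light \<subseteq> {w} \<union> (star x y \<union> star x z)"
    using N2_star[of x] aL unfolding N by (auto simp: star_def w)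
  then have "card (N2 x - light) \<le> card ({w} \<union> (star x y \<union> star x z))" by (intro card_mono) auto
  also have "\<dots> \<le> 1 + (deg y + deg z)"
    using card_Un_le[of "{w}" "star x y \<union> star x z"] card_Un_le[of "star x y" "star x z"]
      card_star[OF adj(2)] card_star[OF adj(3)] by simp
  finally show ?thesis using light_nbr[OF aL adj(1)] k_def by simp
qed

end

section \<open>Reducible configurations\<close>

text \<open>A proper subset has at most three vertices, and if it meets \<open>A\<close>, one of
  them has three colours; so only the whole set can violate Hall's condition.\<close>

lemma hall4:
  assumes A: "finite A" "card A = 3" "x \<notin> A" and fin: "\<And>a. finite (L a)"
    and L: "\<And>a. a \<in> A \<Longrightarrow> 3 \<le> card (L a)" "2 \<le> card (L x)" "4 \<le> card (\<Union> (L ` insert x A))"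
  shows "\<exists>g. inj_on g (insert x A) \<and> (\<forall>a\<in>insert x A. g a \<in> L a)"
proof (rule hall)
  fix T assume T: "T \<subseteq> insert x A"
  have finT: "finite T" using T A finite_subset by blast
  show "card T \<le> card (\<Union> (L ` T))"
  proof (cases "T = insert x A")
    case True then show ?thesis using L(3) A by simp
  next
    case F: False
    have fU: "finite (\<Union> (L ` T))" using finT fin by blast
    have "card T < card (insert x A)" using F T A by (intro psubset_card_mono) auto
    then have c3: "card T \<le> 3" using A by simp
    show ?thesis
    proof (cases "T \<inter> A = {}")
      case True
      then have "T \<subseteq> {x}" using T by blast
      then consider "T = {}" | "T = {x}" by blast
      then show ?thesis using L(2) by cases auto
    next
      case False
      then obtain a where a: "a \<in> T" "a \<in> A" by blast
      then have "card (L a) \<le> card (\<Union> (L ` T))" using fU by (intro card_mono) auto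
      then show ?thesis using L(1)[OF a(2)] c3 by linarith
    qed
  qed
qed (use A fin in auto)

text \<open>Proper subsets of \<open>A\<close> have at most 4 vertices, proper subsets containing
  \<open>x\<close> at most 5. Hence only \<open>A\<close> and the whole set can fail, the two
  alternatives of \<open>full_stuck\<close>.\<close>

lemma hall6:
  assumes A: "finite A" "card A = 5" "x \<notin> A" and fin: "\<And>a. finite (L a)"
    and L: "\<And>a. a \<in> A \<Longrightarrow> 4 \<le> card (L a)" "5 \<le> card (L x)" "5 \<le> card (\<Union> (L ` A))" "6 \<le> card (\<Union> (L ` insert x A))"
  shows "\<exists>g. inj_on g (insert x A) \<and> (\<forall>a\<in>insert x A. g a \<in> L a)"
proof (rule hall)
  fix T assume T: "T \<subseteq> insert x A"
  have finT: "finite T" using T A finite_subset by blast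
  have fU: "finite (\<Union> (L ` T))" using finT fin by blast
  consider "T = insert x A" | "T = A" | "x \<in> T" "T \<noteq> insert x A" | "T \<subset> A" using T by blast
  then show "card T \<le> card (\<Union> (L ` T))"
  proof cases
    case 1 then show ?thesis using L(4) A by simp
  next
    case 2 then show ?thesis using L(3) A by simp
  next
    case 3
    have "card T < card (insert x A)" using 3 T A by (intro psubset_card_mono) auto
    moreover have "card (L x) \<le> card (\<Union> (L ` T))" using fU 3 by (intro card_mono) auto
    ultimately show ?thesis using L(2) A by simp
  next
    case 4
    have "card T < card A" using 4 A by (intro psubset_card_mono) auto
    then have c4: "card T \<le> 4" using A by simp
    show ?thesis
    proof (cases "T = {}")
      case False
      then obtain a where a: "a \<in> T" "a \<in> A" using 4 by blast
      then have "card (L a) \<le> card (\<Union> (L ` T))" using fU by (intro card_mono) auto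
      then show ?thesis using L(1)[OF a(2)] c4 by linarith
    qed simp
  qed
qed (use A fin in auto)

context critical begin

section \<open>Recolouring, and 4-vertices with three neighbours of degree 2\<close>

lemma recolor:
  assumes c: "valid c W" and t: "t \<in> W" and l: "l < k" "l \<notin> c ` (N2 t \<inter> W)"
  shows "valid (c(t := l)) W"
proof -
  have "valid (c(t := l)) (insert t (W - {t}))"
    by (rule extend1) (use valid_subset[OF c] l in \<open>auto simp: avail_def\<close>)
  then show ?thesis using t by (simp add: insert_absorb)
qed

lemma avail_unchanged: "t \<notin> N2 a \<Longrightarrow> avail (c(t := l)) W a = avail c W a"
  unfolding avail_def by (auto simp: image_iff)

lemma avail_freed:
  assumes "valid c W" "t \<in> W" "l \<noteq> c t" "\<And>p. p \<in> N2 a \<inter> W \<Longrightarrow> p \<noteq> t \<Longrightarrow> c p \<noteq> c t"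
  shows "c t \<in> avail (c(t := l)) W a"
proof -
  have "(c(t := l)) p \<noteq> c t" if "p \<in> N2 a \<inter> W" for p
    using assms(3,4) that by (cases "p = t") auto
  then show ?thesis using assms(1,2) unfolding avail_def valid_def by (metis DiffI imageE lessThan_iff)
qed

text \<open>Uncolouring \<open>x\<close> and \<open>A\<close> leaves at most \<open>D + 1\<close>
  forbidden colours at a vertex of \<open>A\<close> and \<open>3 + deg z\<close> at
  \<open>x\<close>. With \<open>k = D + 4 \<ge> 10\<close> and \<open>deg z \<le> 5\<close> this
  gives lists of size at least 3 and 2, so by \<open>hall4\<close> only a union of at most three
  colours is left.\<close>

lemma four_core:
  assumes x: "deg x = 4" and A: "card A = 3" "\<forall>a\<in>A. deg a = 2"
    and Nx: "N x = insert z A" "z \<notin> A"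
  shows "\<exists>c. valid c (V - insert x A)"
    and "valid c (V - insert x A) \<Longrightarrow> deg z \<le> 5 \<Longrightarrow>
       card (\<Union> (avail c (V - insert x A) ` insert x A)) \<le> 3"
    and "a \<in> A \<Longrightarrow> N a = {x, w} \<Longrightarrow> N2 a \<inter> (V - insert x A) \<subseteq> insert z (star a w)"
    and "a \<in> A \<Longrightarrow> N a = {x, w} \<Longrightarrow> k - (1 + deg w) \<le> card (avail c (V - insert x A) a)"
    and "k - (3 + deg z) \<le> card (avail c (V - insert x A) x)"
proof -
  let ?W = "V - insert x A"
  have A2: "deg a = 2" if "a \<in> A" for a using A(2) that by blast
  have finA: "finite A" using A(1) card.infinite by force
  have xV: "x \<in> V" using x deg_le N_sub[of x] finA A Nx adj_V by (metis N_iff insertI1)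
  have xA: "x \<notin> A" using Nx adj_irr by (metis N_iff insertCI)
  have adjA: "adj x a" if "a \<in> A" for a using Nx that by (metis N_iff insertCI)
  have xz: "adj x z" using Nx by (metis N_iff insertI1)
  have Na: "\<exists>w. w \<noteq> x \<and> N a = {x, w}" if a: "a \<in> A" for a
    using deg2E[OF A2[OF a] adj_sym[OF adjA[OF a]]] by metis
  obtain a0 where a0: "a0 \<in> A" using A(1) by fastforce
  show "\<exists>c. valid c ?W"
  proof -
    obtain w0 where w0: "N a0 = {x, w0}" using Na[OF a0] by blast
    have ap: "adj a0 p \<longleftrightarrow> p = x \<or> p = w0" for p using w0 by (metis N_iff insert_iff singletonD)
    obtain c where "valid c ?W"
      by (rule reduce[of a0 "insert x A"]) (use a0 ap adjA[OF a0] adj_V in auto)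
    then show ?thesis by blast
  qed
  show sub: "N2 a \<inter> ?W \<subseteq> insert z (star a w)" if a: "a \<in> A" "N a = {x, w}" for a w
    using N2_star[of a] unfolding a(2) by (auto simp: star_def Nx)
  show av: "k - (1 + deg w) \<le> card (avail c ?W a)" if a: "a \<in> A" "N a = {x, w}" for a w c
  proof -
    have "adj a w" using a(2) by (metis N_iff insertCI)
    then have "card (insert z (star a w)) \<le> 1 + deg w"
      using card_star[of a w] by (simp add: card_insert_if)
    then show ?thesis using avail_ge[OF sub[OF a], of c] by simp
  qed
  have subx: "N2 x \<inter> ?W \<subseteq> (\<Union>a\<in>A. N a - {x}) \<union> star x z"
    using N2_star[of x] unfolding Nx(1) by (auto simp: star_def)
  show avx: "k - (3 + deg z) \<le> card (avail c ?W x)" for c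
  proof -
    have "card (N a - {x}) = 1" if "a \<in> A" for a using Na[OF that] by auto
    then have "card (\<Union>a\<in>A. N a - {x}) \<le> (\<Sum>a\<in>A. 1)" using finA
      by (intro order_trans[OF card_UN_le]) auto
    then have "card ((\<Union>a\<in>A. N a - {x}) \<union> star x z) \<le> 3 + deg z"
      using card_Un_le[of "\<Union>a\<in>A. N a - {x}" "star x z"] A card_star[OF xz] by simp
    then show ?thesis using avail_ge[OF subx, of c] finA by simp
  qed
  show "card (\<Union> (avail c ?W ` insert x A)) \<le> 3" if c: "valid c ?W" and z5: "deg z \<le> 5"
  proof (rule ccontr)
    assume "\<not> ?thesis"
    then have 4: "4 \<le> card (\<Union> (avail c ?W ` insert x A))" by simp
    have "\<exists>g. inj_on g (insert x A) \<and> (\<forall>a\<in>insert x A. g a \<in> avail c ?W a)"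
    proof (rule hall4[OF finA A(1) xA _ _ _ 4])
      fix a assume a: "a \<in> A"
      obtain w where w: "N a = {x, w}" using Na[OF a] by blast
      show "3 \<le> card (avail c ?W a)" using av[OF a w, of c] deg_le[of w] k_def by simp
    next
      show "2 \<le> card (avail c ?W x)" using avx[of c] z5 k_def D_ge6 by simp
    qed simp
    then obtain g where g: "inj_on g (insert x A)" "\<And>a. a \<in> insert x A \<Longrightarrow> g a \<in> avail c ?W a" by blast
    have "valid (\<lambda>v. if v \<in> insert x A then g v else c v) (?W \<union> insert x A)"
      by (rule extend[OF c _ g]) auto
    moreover have "?W \<union> insert x A = V" using xV adjA adj_V by blast
    ultimately show False using not_valid_V by simp
  qed
qed

text \<open>For \<open>deg z \<le> 5\<close> the three 2-neighbours share one list of exactly three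
  colours; any slack in the counts contradicts this. For the last claim \<open>t\<close> is
  recoloured: the lists of \<open>a\<close> and of the third 2-neighbour must still agree, yet only
  the former gains the old colour of \<open>t\<close>.\<close>

lemma four_vertex:
  assumes x: "deg x = 4" and A: "card A = 3" "\<forall>a\<in>A. deg a = 2"
    and Nx: "N x = insert z A" "z \<notin> A"
  shows "4 \<le> deg z"
    and "deg z \<le> 5 \<Longrightarrow> a \<in> A \<Longrightarrow> N a = {x, w} \<Longrightarrow> deg w = D"
    and "deg z \<le> 5 \<Longrightarrow> a \<in> A \<Longrightarrow> b \<in> A \<Longrightarrow> a \<noteq> b \<Longrightarrow> N a = {x, w} \<Longrightarrow> N b = {x, w'} \<Longrightarrow> N t = {w, w'} \<Longrightarrow> False"
proof -
  let ?W = "V - insert x A"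
  have A2: "deg a = 2" if "a \<in> A" for a using A(2) that by blast
  note core = four_core[OF x A Nx]
  have finA: "finite A" using A(1) card.infinite by force
  obtain c where c: "valid c ?W" using core(1) by blast
  have finU: "finite (\<Union> (avail c' ?W ` insert x A))" for c' using finA by auto
  have mem: "card (avail c' ?W v) \<le> 3" if "valid c' ?W" "deg z \<le> 5" "v \<in> insert x A" for v c'
  proof -
    have "card (avail c' ?W v) \<le> card (\<Union> (avail c' ?W ` insert x A))"
      using that finU[of c'] by (intro card_mono) auto
    then show ?thesis using core(2)[of c'] that by simp
  qed
  show "4 \<le> deg z"
    using mem[OF c, of x] core(5)[of c] k_def D_ge6 by (cases "deg z \<le> 3") auto
  have wD: "deg w = D" if "deg z \<le> 5" "a \<in> A" "N a = {x, w}" for a w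
    using mem[OF c that(1), of a] core(4)[OF that(2,3), of c] that k_def deg_le[of w] by simp
  then show "deg z \<le> 5 \<Longrightarrow> a \<in> A \<Longrightarrow> N a = {x, w} \<Longrightarrow> deg w = D" .
  show False if z5: "deg z \<le> 5" and a: "a \<in> A" and b: "b \<in> A" and ab: "a \<noteq> b"
    and Na: "N a = {x, w}" and Nb: "N b = {x, w'}" and Nt: "N t = {w, w'}"
  proof -
    have xz: "adj x z" using Nx by (metis N_iff insertI1)
    have adjA: "adj x a" if "a \<in> A" for a using Nx that by (metis N_iff insertCI)
    have xw: "x \<noteq> w" "x \<noteq> w'" using A2[OF a] A2[OF b] Na Nb unfolding deg_def by auto
    have aw: "adj a w" "adj b w'" using Na Nb by (metis N_iff insertCI)+
    have tw: "adj t w" "adj t w'" using Nt by (metis N_iff insertCI)+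
    have tx: "\<not> adj t x" using Nt xw by (metis N_iff insert_iff singletonD)
    have tA: "t \<notin> A" using tx adjA adj_sym by blast
    have ww: "w \<noteq> w'" using no4[of x a w b] ab adjA a b aw adj_sym xw by metis
    have "deg t = 2" unfolding deg_def Nt using ww by simp
    then have tW: "t \<in> ?W" using tA tw adj_V x by auto
    have tz: "t \<noteq> z" using tx xz adj_sym by blast
    have all3: "avail c' ?W v = \<Union> (avail c' ?W ` insert x A)" if c': "valid c' ?W" and v: "v \<in> A" for c' v
    proof (rule card_seteq[OF finU])
      obtain u where "N v = {x, u}" using deg2E[OF A2[OF v] adj_sym[OF adjA[OF v]]] by metis
      then have "3 \<le> card (avail c' ?W v)" using core(4)[OF v, of u c'] deg_le[of u] k_def by simp
      then show "card (\<Union> (avail c' ?W ` insert x A)) \<le> card (avail c' ?W v)" using core(2)[OF c' z5] by linarith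
    qed (use v in auto)
    obtain l where l: "l \<in> avail c ?W a"
      using core(4)[OF a Na, of c] deg_le[of w] k_def by fastforce
    have lb: "l \<in> avail c ?W b" using l all3[OF c a] all3[OF c b] by simp
    \<comment> \<open>Apart from \<open>a\<close> and \<open>b\<close>, whatever \<open>t\<close>
      sees through \<open>w\<close> is seen by \<open>a\<close>, and through \<open>w'\<close> by
      \<open>b\<close>. So a colour available at both can be given to \<open>t\<close>.\<close>
    have subt: "N2 t \<inter> ?W \<subseteq> (N2 a \<inter> ?W) \<union> (N2 b \<inter> ?W)"
    proof
      fix p assume p: "p \<in> N2 t \<inter> ?W"
      then have pn: "p \<noteq> a" "p \<noteq> b" using a b by auto
      have "p \<in> star t w \<or> p \<in> star t w'" using p N2_star[of t] unfolding Nt by auto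
      then show "p \<in> (N2 a \<inter> ?W) \<union> (N2 b \<inter> ?W)"
        using p pn aw unfolding star_def N2_def sq_def by auto
    qed
    define c' where "c' = c(t := l)"
    have c': "valid c' ?W" unfolding c'_def
    proof (rule recolor[OF c tW])
      show "l < k" using l unfolding avail_def by simp
      show "l \<notin> c ` (N2 t \<inter> ?W)" using subt l lb unfolding avail_def by blast
    qed
    have ta: "t \<in> N2 a" unfolding N2_def sq_def using aw tw adj_sym tA a by auto
    have za: "z \<in> N2 a" unfolding N2_def sq_def using xz adjA[OF a] adj_sym Nx(2) a by auto
    have zW: "z \<in> ?W" using xz adj_V Nx(2) adj_irr by auto
    \<comment> \<open>\<open>a\<close> sees at most \<open>D + 1\<close> coloured vertices but has
      only three of the \<open>D + 4\<close> colours left. All these vertices thus have different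
      colours, and recolouring \<open>t\<close> really frees its old one.\<close>
    have inj: "inj_on c (N2 a \<inter> ?W)"
    proof (rule eq_card_imp_inj_on)
      have s: "N2 a \<inter> ?W \<subseteq> insert z (star a w)" by (rule core(3)[OF a Na])
      have "card (N2 a \<inter> ?W) \<le> card (insert z (star a w))" by (rule card_mono[OF _ s]) simp
      also have "\<dots> \<le> D + 1" using card_star[OF aw(1)] deg_le[of w] by (simp add: card_insert_if)
      finally have 1: "card (N2 a \<inter> ?W) \<le> D + 1" .
      have "card (avail c ?W a) \<ge> card {..<k} - card (c ` (N2 a \<inter> ?W))"
        unfolding avail_def by (rule diff_card_le_card_Diff) simp
      then have "D + 1 \<le> card (c ` (N2 a \<inter> ?W))" using mem[OF c z5, of a] a k_def by simp
      then show "card (c ` (N2 a \<inter> ?W)) = card (N2 a \<inter> ?W)"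
        using 1 card_image_le[of "N2 a \<inter> ?W" c] by simp
    qed simp
    have ct: "c t \<notin> avail c ?W a" using ta tW unfolding avail_def by blast
    have "c t \<in> avail c' ?W a" unfolding c'_def
    proof (rule avail_freed[OF c tW])
      show "l \<noteq> c t" using l ct by blast
      fix p assume p: "p \<in> N2 a \<inter> ?W" "p \<noteq> t"
      then show "c p \<noteq> c t" using inj ta tW unfolding inj_on_def by blast
    qed
    have "\<exists>d. d \<in> A - {a, b}"
    proof (rule ccontr)
      assume "\<not> ?thesis"
      then have "A \<subseteq> {a, b}" by blast
      then have "card A \<le> 2" using card_mono[of "{a, b}" A] ab by simp
      then show False using A by simp
    qed
    then obtain d where d: "d \<in> A" "d \<noteq> a" "d \<noteq> b" by blast
    obtain v where v: "N d = {x, v}" "v \<noteq> x" "adj d v"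
      using deg2E[OF A2[OF d(1)] adj_sym[OF adjA[OF d(1)]]] by metis
    have vw: "v \<noteq> w" "v \<noteq> w'"
      using no4[of x d v a] no4[of x d v b] d v adjA a b aw adj_sym by metis+
    have dp: "adj d p \<longleftrightarrow> p = x \<or> p = v" for p using v(1) by (metis N_iff insert_iff singletonD)
    have tp: "adj t p \<longleftrightarrow> p = w \<or> p = w'" for p using Nt by (metis N_iff insert_iff singletonD)
    \<comment> \<open>A common neighbour of \<open>t\<close> and \<open>d\<close> would be
      \<open>w\<close> or \<open>w'\<close> and close a 4-cycle through \<open>x\<close>; adjacency
      would close a triangle.\<close>
    have "t \<notin> N2 d"
    proof
      assume "t \<in> N2 d"
      then have "adj d t \<or> (\<exists>p. adj d p \<and> adj p t)" unfolding N2_def sq_def using adj_sym by blast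
      then show False
      proof
        assume "adj d t"
        then have "t = x \<or> t = v" using dp by blast
        moreover have "t \<noteq> x" using tW by blast
        ultimately have "adj t d" using v adj_sym by blast
        then have "d = w \<or> d = w'" using tp by blast
        then show False using no3[of x d a] no3[of x d b] adjA a b d aw adj_sym by metis
      next
        assume "\<exists>p. adj d p \<and> adj p t"
        then obtain p where p: "adj d p" "adj t p" using adj_sym by blast
        then show False using dp[of p] tp[of p] xw vw by auto
      qed
    qed
    then have "avail c' ?W d = avail c ?W d" unfolding c'_def by (rule avail_unchanged)
    then have "avail c' ?W a = avail c ?W a"
      using all3[OF c' a] all3[OF c' d(1)] all3[OF c a] all3[OF c d(1)] by simp
    then show False using ct \<open>c t \<in> avail c' ?W a\<close> by simp
  qed
qed

text \<open>A 3-vertex has charge 0 and owes 1 to its 2-neighbour; these are the ones that no vertex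
  of degree at least 6 helps.\<close>

definition needy :: "'a \<Rightarrow> bool" where
  "needy u \<longleftrightarrow> deg u = 3 \<and> (\<exists>a. adj u a \<and> deg a = 2) \<and> (\<forall>w. adj u w \<longrightarrow> deg w \<le> 5)"

text \<open>A 5-vertex with charge 4 on which all five neighbours have a claim.\<close>

definition full :: "'a \<Rightarrow> bool" where
  "full y \<longleftrightarrow> deg y = 5 \<and> (\<forall>a. adj y a \<longrightarrow> deg a = 2 \<or> needy a)"

text \<open>The vertices that keep their colours while \<open>y\<close> and its neighbours are
  handled by Hall's theorem; light vertices follow last.\<close>

definition rest :: "'a \<Rightarrow> 'a set" where
  "rest y = V - (insert y (N y) \<union> light)"

section \<open>Full 5-vertices\<close>

lemma needyE:
  assumes u: "needy u" and y: "adj u y" "deg y \<noteq> 2"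
  obtains l q where "N u = {l, y, q}" "l \<noteq> y" "l \<noteq> q" "y \<noteq> q" "deg l = 2" "l \<in> light" "deg y \<le> 5"
    "deg q \<le> 5" "D + 3 \<le> deg y + deg q"
proof -
  obtain l where l: "adj u l" "deg l = 2" using u unfolding needy_def by blast
  have c: "card (N u) = 3" using u unfolding needy_def deg_def by simp
  have ly: "l \<noteq> y" using l y by auto
  have "card (N u - {l, y}) = 1" using c l y ly by (simp add: card_Diff_subset)
  then obtain q where q: "N u - {l, y} = {q}" by (auto simp: card_1_singleton_iff)
  then have "q \<in> N u - {l, y}" by simp
  then have qq: "q \<noteq> l" "q \<noteq> y" "q \<in> N u" by simp_all
  have "N u = insert l (insert y (N u - {l, y}))" using l y by auto
  then have N: "N u = {l, y, q}" using q by simp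
  have "l \<in> light" using light_of_deg3[of u l] u l unfolding needy_def by simp
  moreover have "D + 3 \<le> deg y + deg q" using deg3_sum[OF _ N l(2)] u unfolding needy_def by simp
  moreover have "deg y \<le> 5" "deg q \<le> 5" using u y qq unfolding needy_def by auto
  ultimately show ?thesis using that[OF N ly] qq l by simp
qed

lemma light_deg: "a \<in> light \<Longrightarrow> deg a = 2"
  unfolding light_def by simp

text \<open>Besides \<open>y\<close>, a 2-neighbour has one neighbour and a needy one has two, one
  of which is light.\<close>

lemma full_outer:
  assumes y: "full y" and a: "adj y a"
  shows "card (N a - {y} - light) \<le> 1"
proof -
  consider "deg a = 2" | "needy a" using y a unfolding full_def by blast
  then show ?thesis
  proof cases
    case 1
    obtain w where w: "N a = {y, w}" using deg2E[OF 1 adj_sym[OF a]] by metis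
    have "card (N a - {y} - light) \<le> card {w}" by (rule card_mono) (auto simp: w)
    then show ?thesis by simp
  next
    case 2
    obtain l q where lq: "N a = {l, y, q}" "l \<in> light"
    proof -
      have "deg y \<noteq> 2" using y unfolding full_def by simp
      then show ?thesis by (rule needyE[OF 2 adj_sym[OF a]]) (rule that)
    qed
    have "card (N a - {y} - light) \<le> card {q}" by (rule card_mono) (use lq in auto)
    then show ?thesis by simp
  qed
qed

lemma full_N2:
  assumes y: "full y"
  shows "N2 y - light \<subseteq> (N y - light) \<union> (\<Union>a\<in>N y. N a - {y} - light)"
    and "card (\<Union>a\<in>N y. N a - {y} - light) \<le> 5"
proof -
  show "N2 y - light \<subseteq> (N y - light) \<union> (\<Union>a\<in>N y. N a - {y} - light)"
    using N2_star[of y] unfolding star_def by auto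
  have "card (\<Union>a\<in>N y. N a - {y} - light) \<le> (\<Sum>a\<in>N y. card (N a - {y} - light))" by (rule card_UN_le) simp
  also have "\<dots> \<le> (\<Sum>a\<in>N y. 1)" by (rule sum_mono) (use full_outer[OF y] in auto)
  also have "\<dots> = 5" using y unfolding full_def deg_def by simp
  finally show "card (\<Union>a\<in>N y. N a - {y} - light) \<le> 5" .
qed

text \<open>With a light neighbour \<open>y\<close> would see at most 4 + 5 = 9 vertices that are
  not light, fewer than \<open>k\<close>, against \<open>light_nbr\<close>.\<close>

lemma full_not_light:
  assumes y: "full y" and a: "adj y a"
  shows "a \<notin> light"
proof
  assume aL: "a \<in> light"
  have "card (N2 y - light) \<le> card ((N y - light) \<union> (\<Union>a\<in>N y. N a - {y} - light))"
    by (rule card_mono[OF _ full_N2(1)[OF y]]) simp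
  also have "\<dots> \<le> card (N y - light) + 5" using card_Un_le full_N2(2)[OF y] by (meson add_left_mono le_trans)
  also have "card (N y - light) \<le> card (N y - {a})" by (rule card_mono) (use aL in auto)
  also have "card (N y - {a}) = 4" using y a unfolding full_def deg_def by simp
  finally show False using light_nbr[OF aL a] k_def D_ge6 by simp
qed

text \<open>Since \<open>a\<close> is not light, the degrees of its neighbours add up to at least
  \<open>D + 4\<close>, and \<open>y\<close> contributes only 5.\<close>

lemma full_outer_deg:
  assumes y: "full y" and a: "adj y a" and N: "N a = {y, w}" "w \<noteq> y"
  shows "D \<le> deg w + 1"
proof -
  have "deg a = 2" unfolding deg_def N(1) using N(2) by simp
  moreover have "a \<in> V" using a adj_V by blast
  moreover have "deg y = 5" using y unfolding full_def by simp
  ultimately show ?thesis using full_not_light[OF y a] N unfolding light_def by auto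
qed

text \<open>The vertex to remove must have all but one neighbour uncoloured: a 2-neighbour of
  \<open>y\<close>, or the light 2-neighbour of a needy neighbour.\<close>

lemma full_rest_ok:
  assumes y: "full y"
  obtains c where "valid c (rest y)"
proof -
  have "card (N y) = 5" using y unfolding full_def deg_def by simp
  then obtain a where a: "adj y a" by (metis N_iff card.empty ex_in_conv zero_neq_numeral)
  have aV: "a \<in> V" using a adj_V by blast
  consider "deg a = 2" | "needy a" using y a unfolding full_def by blast
  then show ?thesis
  proof cases
    case 1
    obtain w where w: "N a = {y, w}" using deg2E[OF 1 adj_sym[OF a]] by metis
    have ap: "adj a p \<longleftrightarrow> p = y \<or> p = w" for p using w by (metis N_iff insert_iff singletonD)
    show ?thesis unfolding rest_def
      by (rule reduce[of a "insert y (N y) \<union> light"]) (use aV a ap that in \<open>simp_all add: rest_def\<close>)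
  next
    case 2
    obtain l where l: "adj a l" "deg l = 2" "l \<in> light" using 2 light_of_deg3 unfolding needy_def by blast
    obtain w where w: "N l = {a, w}" using deg2E[OF l(2) adj_sym[OF l(1)]] by metis
    have ap: "adj l p \<longleftrightarrow> p = a \<or> p = w" for p using w by (metis N_iff insert_iff singletonD)
    have lV: "l \<in> V" using l adj_V by blast
    show ?thesis unfolding rest_def
      by (rule reduce[of l "insert y (N y) \<union> light"]) (use lV l(3) a ap that in \<open>auto simp: rest_def\<close>)
  qed
qed

lemma full_avail2:
  assumes y: "full y" and a: "adj y a" and N: "N a = {y, w}"
  shows "N2 a \<inter> rest y \<subseteq> star a w" "k - deg w \<le> card (avail c (rest y) a)"
proof -
  have aw: "adj a w" using N by (metis N_iff insertCI)
  show s: "N2 a \<inter> rest y \<subseteq> star a w"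
    using N2_star[of a] unfolding N rest_def by (auto simp: star_def)
  show "k - deg w \<le> card (avail c (rest y) a)"
    using avail_ge[OF s, of c] card_star[OF aw] by simp
qed

lemma full_avail3:
  assumes y: "full y" and a: "adj y a" and N: "N a = {l, y, q}" and l: "l \<in> light" and Nl: "N l = {a, p}"
  shows "N2 a \<inter> rest y \<subseteq> insert p (star a q)" "k - (1 + deg q) \<le> card (avail c (rest y) a)"
proof -
  have aq: "adj a q" using N by (metis N_iff insertCI)
  show s: "N2 a \<inter> rest y \<subseteq> insert p (star a q)"
    using N2_star[of a] l unfolding N rest_def by (auto simp: star_def Nl)
  have "card (insert p (star a q)) \<le> 1 + deg q" using card_star[OF aq] by (simp add: card_insert_if)
  then show "k - (1 + deg q) \<le> card (avail c (rest y) a)"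
    using avail_ge[OF s, of c] by simp
qed

text \<open>At most \<open>D\<close> colours are forbidden at a 2-neighbour, and at most 1 + 5 \<le>
  \<open>D\<close> at a needy one, whose third neighbour has degree at most 5.\<close>

lemma full_avail:
  assumes y: "full y" and a: "adj y a"
  shows "4 \<le> card (avail c (rest y) a)"
proof -
  consider "deg a = 2" | "needy a" using y a unfolding full_def by blast
  then show ?thesis
  proof cases
    case 1
    obtain w where w: "N a = {y, w}" using deg2E[OF 1 adj_sym[OF a]] by metis
    show ?thesis using full_avail2(2)[OF y a w, of c] deg_le[of w] k_def by simp
  next
    case 2
    have y2: "deg y \<noteq> 2" using y unfolding full_def by simp
    obtain l q where lq: "N a = {l, y, q}" "l \<in> light" "deg l = 2" "deg q \<le> 5"
      using needyE[OF 2 adj_sym[OF a] y2] by metis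
    have "adj l a" using lq by (metis N_iff adj_sym insertI1)
    then obtain p where p: "N l = {a, p}" using deg2E[OF lq(3)] by metis
    show ?thesis using full_avail3(2)[OF y a lq(1,2) p, of c] lq(4) k_def D_ge6 by simp
  qed
qed

lemma full_avail_y:
  assumes y: "full y"
  shows "N2 y \<inter> rest y \<subseteq> (\<Union>a\<in>N y. N a - {y} - light)" "D - 1 \<le> card (avail c (rest y) y)"
proof -
  show s: "N2 y \<inter> rest y \<subseteq> (\<Union>a\<in>N y. N a - {y} - light)"
    using full_N2(1)[OF y] unfolding rest_def by blast
  show "D - 1 \<le> card (avail c (rest y) y)"
    using avail_ge[OF s, of c] full_N2(2)[OF y] k_def by simp
qed

text \<open>Hall's condition must fail, at the five neighbours or at the whole clique. With at least
  4 colours at each neighbour and 5 at \<open>y\<close> it fails by one colour only, which leaves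
  two rigid patterns.\<close>

lemma full_stuck:
  assumes y: "full y" and c: "valid c (rest y)"
  shows "(\<exists>L. card L = 4 \<and> (\<forall>a. adj y a \<longrightarrow> avail c (rest y) a = L)) \<or>
    card (avail c (rest y) y) = 5 \<and> (\<forall>a. adj y a \<longrightarrow> avail c (rest y) a \<subseteq> avail c (rest y) y)"
proof -
  let ?L = "avail c (rest y)"
  have Ny: "finite (N y)" "card (N y) = 5" "y \<notin> N y" using y adj_irr unfolding full_def deg_def by auto
  have fin: "finite (\<Union> (?L ` N y))" "finite (\<Union> (?L ` insert y (N y)))" by auto
  have ge5: "5 \<le> card (?L y)" using full_avail_y(2)[OF y, of c] D_ge6 by simp
  have "\<not> (5 \<le> card (\<Union> (?L ` N y)) \<and> 6 \<le> card (\<Union> (?L ` insert y (N y))))"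
  proof
    assume *: "5 \<le> card (\<Union> (?L ` N y)) \<and> 6 \<le> card (\<Union> (?L ` insert y (N y)))"
    have "\<exists>g. inj_on g (insert y (N y)) \<and> (\<forall>a\<in>insert y (N y). g a \<in> ?L a)"
      by (rule hall6[OF Ny]) (use * ge5 full_avail[OF y] in auto)
    then obtain g where g: "inj_on g (insert y (N y))" "\<And>a. a \<in> insert y (N y) \<Longrightarrow> g a \<in> ?L a" by blast
    have "valid (\<lambda>v. if v \<in> insert y (N y) then g v else c v) (rest y \<union> insert y (N y))"
      by (rule extend[OF c _ g]) (auto simp: rest_def)
    then have "valid (\<lambda>v. if v \<in> insert y (N y) then g v else c v) (V - light)"
      by (rule valid_subset) (auto simp: rest_def)
    then show False using not_valid_heavy by blast
  qed
  then consider "card (\<Union> (?L ` N y)) \<le> 4" | "card (\<Union> (?L ` insert y (N y))) \<le> 5" by linarith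
  then show ?thesis
  proof cases
    case 1
    have eq: "?L a = \<Union> (?L ` N y)" if "adj y a" for a
      by (rule card_seteq[OF fin(1)]) (use full_avail[OF y that, of c] 1 that in auto)
    obtain a where a: "adj y a" using Ny by (metis N_iff card.empty ex_in_conv zero_neq_numeral)
    have "card (\<Union> (?L ` N y)) = 4" using full_avail[OF y a, of c] eq[OF a] 1 by simp
    then show ?thesis using eq by blast
  next
    case 2
    have eq: "?L y = \<Union> (?L ` insert y (N y))"
      by (rule card_seteq[OF fin(2)]) (use ge5 2 in auto)
    then have "card (?L y) = 5" using ge5 2 by simp
    moreover have "?L a \<subseteq> ?L y" if "adj y a" for a using eq that by auto
    ultimately show ?thesis by blast
  qed
qed

text \<open>The girth puts \<open>t\<close> at distance exactly 3 from \<open>y\<close>: recolouring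
  it can affect the list of \<open>a\<close> but not that of \<open>y\<close>.\<close>

lemma common_nbr_step:
  assumes y: "full y" and a: "adj y a" "N a = {y, w}" "w \<noteq> y" and t: "adj t w" "t \<noteq> a"
  shows "t \<notin> insert y (N y)" "t \<notin> N2 y" "t \<in> N2 a"
proof -
  have aw: "adj a w" using a by (metis N_iff insertCI)
  have ty: "t \<noteq> y" using no3[of y a w] a aw t adj_sym by blast
  have nt: "\<not> adj y t" using no4[of y a w t] a aw t adj_sym by blast
  show "t \<notin> insert y (N y)" using ty nt by simp
  show "t \<notin> N2 y"
  proof
    assume "t \<in> N2 y"
    then obtain p where "adj y p" "adj p t" unfolding N2_def sq_def using nt adj_sym by blast
    then show False using no5[of y p t w a] t a aw adj_sym by blast
  qed
  show "t \<in> N2 a" unfolding N2_def sq_def using aw t adj_sym by blast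
qed

text \<open>\<open>X\<close> collects what \<open>t\<close> sees neither through \<open>w\<close>
  nor through \<open>w'\<close>: nothing for a 2-vertex, and for a 3-vertex one vertex behind its
  light neighbour.\<close>

lemma recolor_common:
  assumes y: "full y" and a: "adj y a" "N a = {y, w}" "w \<noteq> y"
    and b: "adj y b" "N b = {y, w'}" "w' \<noteq> y" and ab: "a \<noteq> b"
    and t: "adj t w" "adj t w'" "t \<noteq> a" "t \<noteq> b" "t \<notin> light"
    and X: "N2 t - light \<subseteq> star t w \<union> star t w' \<union> X"
    and c: "valid c (rest y)"
    and l: "l \<in> avail c (rest y) a" "l \<in> avail c (rest y) b" "l \<notin> c ` X"
  shows "valid (c(t := l)) (rest y)" "c t \<in> avail (c(t := l)) (rest y) a"
    "avail (c(t := l)) (rest y) y = avail c (rest y) y" "c t \<notin> avail c (rest y) a" "c t \<notin> avail c (rest y) b"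
    "c t < k"
proof -
  let ?W = "rest y"
  note ta = common_nbr_step[OF y a t(1) t(3)] and tb = common_nbr_step[OF y b t(2) t(4)]
  have aw: "adj a w" "adj b w'" using a b by (metis N_iff insertCI)+
  have tW: "t \<in> ?W" using ta t adj_V unfolding rest_def by blast
  have notW: "a \<notin> ?W" "b \<notin> ?W" using a b unfolding rest_def by auto
  have sub: "N2 t \<inter> ?W \<subseteq> (N2 a \<inter> ?W) \<union> (N2 b \<inter> ?W) \<union> X"
  proof
    fix p assume p: "p \<in> N2 t \<inter> ?W"
    then have pn: "p \<noteq> a" "p \<noteq> b" "p \<notin> light" using notW unfolding rest_def by auto
    then have "p \<in> star t w \<or> p \<in> star t w' \<or> p \<in> X" using p X by blast
    then show "p \<in> (N2 a \<inter> ?W) \<union> (N2 b \<inter> ?W) \<union> X"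
      using p pn aw unfolding star_def N2_def sq_def by auto
  qed
  show c': "valid (c(t := l)) ?W"
  proof (rule recolor[OF c tW])
    show "l < k" using l unfolding avail_def by simp
    show "l \<notin> c ` (N2 t \<inter> ?W)" using sub l unfolding avail_def by blast
  qed
  show cta: "c t \<notin> avail c ?W a" using ta tW unfolding avail_def by blast
  show "c t \<notin> avail c ?W b" using tb tW unfolding avail_def by blast
  show "c t \<in> avail (c(t := l)) ?W a"
  proof (rule avail_freed[OF c tW])
    show "l \<noteq> c t" using l cta by blast
    fix p assume p: "p \<in> N2 a \<inter> ?W" "p \<noteq> t"
    \<comment> \<open>All that \<open>a\<close> sees lies in one star, a clique of the square
      containing \<open>t\<close>; so no other vertex there has the colour of
      \<open>t\<close>.\<close>
    have "p \<in> star a w" using full_avail2(1)[OF y a(1,2)] p by blast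
    moreover have "t \<in> star a w" using t adj_sym unfolding star_def by auto
    ultimately have "sq p t" using star_sq p by blast
    then show "c p \<noteq> c t" using c p tW unfolding valid_def by blast
  qed
  show "avail (c(t := l)) ?W y = avail c ?W y" using avail_unchanged ta by blast
  show "c t < k" using c tW unfolding valid_def by blast
qed

text \<open>
  Recolouring \<open>t\<close> frees its old colour at \<open>a1\<close> and \<open>a2\<close>. The clique stays uncolourable only if this colour is also
  available at \<open>y\<close>, which then has just five available colours.
\<close>

lemma full_third_step:
  assumes y: "full y"
    and a1: "adj y a1" "N a1 = {y, w1}" "w1 \<noteq> y" and a2: "adj y a2" "N a2 = {y, w2}" "w2 \<noteq> y"
    and a3: "adj y a3" "N a3 = {y, w3}" "w3 \<noteq> y" and ne: "a1 \<noteq> a2" "a1 \<noteq> a3" "a2 \<noteq> a3"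
    and t: "N t = {w1, w2}" and c: "valid c (rest y)"
  shows "c t \<in> avail c (rest y) y" "card (avail c (rest y) y) = 5" "avail c (rest y) a2 \<subseteq> avail c (rest y) y"
    "c t \<notin> avail c (rest y) a1" "c t \<notin> avail c (rest y) a2" "t \<in> rest y"
proof -
  let ?W = "rest y"
  have aw: "adj a1 w1" "adj a2 w2" "adj a3 w3" using a1 a2 a3 by (metis N_iff insertCI)+
  have w: "w1 \<noteq> w2" "w1 \<noteq> w3" "w2 \<noteq> w3"
    using no4[of y a1 w1 a2] no4[of y a1 w1 a3] no4[of y a2 w2 a3] a1 a2 a3 aw ne adj_sym by metis+
  have tw: "adj t w1" "adj t w2" using t by (metis N_iff insertCI)+
  have tp: "adj t p \<longleftrightarrow> p = w1 \<or> p = w2" for p using t by (metis N_iff insert_iff singletonD)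
  have nty: "\<not> adj t y" using tp a1 a2 by auto
  have tn: "t \<noteq> a1" "t \<noteq> a2" using nty a1 a2 adj_sym by blast+
  have "(\<Sum>w\<in>N t. deg w) = deg w1 + deg w2" using t w by simp
  then have tL: "t \<notin> light"
    using full_outer_deg[OF y a1] full_outer_deg[OF y a2] D_ge6 unfolding light_def by simp
  note ta = common_nbr_step[OF y a1 tw(1) tn(1)] and tb = common_nbr_step[OF y a2 tw(2) tn(2)]
  show tW: "t \<in> ?W" using ta tL tw adj_V unfolding rest_def by blast
  have X: "N2 t - light \<subseteq> star t w1 \<union> star t w2 \<union> {}" using N2_star[of t] unfolding t by auto
  have t3: "t \<notin> N2 a3"
  proof
    have dp: "adj a3 p \<longleftrightarrow> p = y \<or> p = w3" for p using a3(2) by (metis N_iff insert_iff singletonD)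
    assume "t \<in> N2 a3"
    then have "adj a3 t \<or> (\<exists>p. adj a3 p \<and> adj t p)" unfolding N2_def sq_def using adj_sym by blast
    then show False
    proof
      assume "adj a3 t"
      then have "a3 = w1 \<or> a3 = w2" using tp adj_sym by blast
      then show False using no3[of y a1 a3] no3[of y a2 a3] a1 a2 a3 aw adj_sym by metis
    next
      assume "\<exists>p. adj a3 p \<and> adj t p"
      then show False using dp tp nty w by auto
    qed
  qed
  \<comment> \<open>In the first pattern the two lists coincide; in the second they are sets of at
    least 4 colours within 5 colours and must meet.\<close>
  have ex: "\<exists>l. l \<in> avail c ?W a1 \<and> l \<in> avail c ?W a2"
    using full_stuck[OF y c]
  proof
    assume "\<exists>L. card L = 4 \<and> (\<forall>a. adj y a \<longrightarrow> avail c ?W a = L)"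
    then obtain L where L: "card L = 4" "avail c ?W a1 = L" "avail c ?W a2 = L" using a1 a2 by blast
    then have "L \<noteq> {}" by auto
    then show ?thesis using L by blast
  next
    assume B: "card (avail c ?W y) = 5 \<and> (\<forall>a. adj y a \<longrightarrow> avail c ?W a \<subseteq> avail c ?W y)"
    show ?thesis
    proof (rule ccontr)
      assume "\<not> ?thesis"
      then have "card (avail c ?W a1 \<union> avail c ?W a2) = card (avail c ?W a1) + card (avail c ?W a2)"
        by (intro card_Un_disjoint) auto
      moreover have "card (avail c ?W a1 \<union> avail c ?W a2) \<le> card (avail c ?W y)"
        using B a1 a2 by (intro card_mono) auto
      ultimately show False using B full_avail[OF y a1(1), of c] full_avail[OF y a2(1), of c] by simp
    qed
  qed
  then obtain l where l: "l \<in> avail c ?W a1" "l \<in> avail c ?W a2" by blast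
  define c' where "c' = c(t := l)"
  have rc: "valid c' ?W" "c t \<in> avail c' ?W a1" "avail c' ?W y = avail c ?W y"
    "c t \<notin> avail c ?W a1" "c t \<notin> avail c ?W a2"
    unfolding c'_def using recolor_common[OF y a1 a2 ne(1) tw tn tL X c l] by auto
  show "c t \<notin> avail c ?W a1" "c t \<notin> avail c ?W a2" using rc by auto
  have un: "avail c' ?W a3 = avail c ?W a3" unfolding c'_def by (rule avail_unchanged[OF t3])
  have stuck: "(\<exists>L. card L = 4 \<and> (\<forall>a. adj y a \<longrightarrow> avail c' ?W a = L)) \<or>
    card (avail c ?W y) = 5 \<and> (\<forall>a. adj y a \<longrightarrow> avail c' ?W a \<subseteq> avail c ?W y)"
    using full_stuck[OF y rc(1)] rc(3) by simp
  have "c t \<in> avail c ?W y \<and> card (avail c ?W y) = 5 \<and> avail c ?W a2 \<subseteq> avail c ?W y"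
    using full_stuck[OF y c]
  proof
    assume "\<exists>L. card L = 4 \<and> (\<forall>a. adj y a \<longrightarrow> avail c ?W a = L)"
    then have L: "avail c ?W a1 = avail c ?W a3" "avail c ?W a2 = avail c ?W a3" using a1 a2 a3 by metis+
    then have "avail c' ?W a1 \<noteq> avail c' ?W a3" using rc un by auto
    then have "card (avail c ?W y) = 5" "avail c' ?W a1 \<subseteq> avail c ?W y" "avail c' ?W a3 \<subseteq> avail c ?W y"
      using stuck a1 a3 by metis+
    then show ?thesis using rc(2) un L by auto
  next
    assume B: "card (avail c ?W y) = 5 \<and> (\<forall>a. adj y a \<longrightarrow> avail c ?W a \<subseteq> avail c ?W y)"
    have "c t \<in> avail c ?W y"
    proof (rule ccontr)
      assume n: "c t \<notin> avail c ?W y"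
      then have "\<not> avail c' ?W a1 \<subseteq> avail c ?W y" using rc by blast
      then have "avail c' ?W a1 = avail c' ?W a3" using stuck a1 a3 by metis
      then show False using rc(2) un B a3 n by auto
    qed
    then show ?thesis using B a2 by blast
  qed
  then show "c t \<in> avail c ?W y" "card (avail c ?W y) = 5" "avail c ?W a2 \<subseteq> avail c ?W y" by auto
qed

text \<open>The colours of \<open>t\<close> and \<open>t'\<close> are available at \<open>y\<close>
  but not at \<open>a2\<close>, and they differ because \<open>t\<close> and \<open>t'\<close> share
  the neighbour \<open>w2\<close>. So \<open>y\<close> would have at least 4 + 2 colours instead of
  5.\<close>

lemma full_two_common:
  assumes y: "full y"
    and a1: "adj y a1" "N a1 = {y, w1}" "w1 \<noteq> y" and a2: "adj y a2" "N a2 = {y, w2}" "w2 \<noteq> y"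
    and a3: "adj y a3" "N a3 = {y, w3}" "w3 \<noteq> y" and ne: "a1 \<noteq> a2" "a1 \<noteq> a3" "a2 \<noteq> a3"
    and t: "N t = {w1, w2}" and t': "N t' = {w2, w3}"
  shows False
proof -
  let ?W = "rest y"
  obtain c where c: "valid c ?W" using full_rest_ok[OF y] .
  note s1 = full_third_step[OF y a1 a2 a3 ne t c]
  have t'': "N t' = {w3, w2}" using t' by auto
  have ne': "a3 \<noteq> a2" "a3 \<noteq> a1" "a2 \<noteq> a1" using ne by auto
  note s2 = full_third_step[OF y a3 a2 a1 ne' t'' c]
  have aw: "adj a1 w1" "adj a2 w2" "adj a3 w3" using a1 a2 a3 by (metis N_iff insertCI)+
  have w: "w1 \<noteq> w3" using no4[of y a1 w1 a3] a1 a3 aw ne adj_sym by metis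
  have tt: "t \<noteq> t'" using t t' w by (metis doubleton_eq_iff)
  have "adj t w2" "adj t' w2" using t t' by (metis N_iff insertCI)+
  then have "sq t t'" unfolding sq_def using tt adj_sym by blast
  then have "c t \<noteq> c t'" using c s1(6) s2(6) unfolding valid_def by blast
  then have "card (insert (c t) (insert (c t') (avail c ?W a2))) = card (avail c ?W a2) + 2"
    using s1(5) s2(5) by simp
  moreover have "card (insert (c t) (insert (c t') (avail c ?W a2))) \<le> card (avail c ?W y)"
    using s1 s2 by (intro card_mono) auto
  ultimately show False using s1(2) full_avail[OF y a2(1), of c] by simp
qed

text \<open>As \<open>deg w1 \<le> 5\<close>, the list of \<open>a1\<close> has at least 5 colours
  and must equal the list of \<open>y\<close>. Recolouring \<open>t\<close> adds a colour to the
  former and leaves the latter unchanged.\<close>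

lemma full_common_small:
  assumes y: "full y"
    and a1: "adj y a1" "N a1 = {y, w1}" "w1 \<noteq> y" and a2: "adj y a2" "N a2 = {y, w2}" "w2 \<noteq> y"
    and ne: "a1 \<noteq> a2" and w5: "deg w1 \<le> 5" and t: "adj t w1" "adj t w2"
    and td: "deg t = 2 \<or> deg t = 3 \<and> (\<exists>l. adj t l \<and> deg l = 2)"
  shows False
proof -
  let ?W = "rest y"
  obtain c where c: "valid c ?W" using full_rest_ok[OF y] .
  have aw: "adj a1 w1" "adj a2 w2" using a1 a2 by (metis N_iff insertCI)+
  have w: "w1 \<noteq> w2" using no4[of y a1 w1 a2] a1 a2 aw ne adj_sym by metis
  have nadj: "\<not> adj y p" if "adj p w1" "adj p w2" for p
  proof
    assume yp: "adj y p"
    have "p = a1" using no4[of y a1 w1 p] yp that a1 aw adj_sym by blast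
    moreover have "p = a2" using no4[of y a2 w2 p] yp that a2 aw adj_sym by blast
    ultimately show False using ne by simp
  qed
  have tn: "t \<noteq> a1" "t \<noteq> a2" using nadj[OF t] a1 a2 by blast+
  have Dw: "D \<le> deg w1 + 1" "D \<le> deg w2 + 1" using full_outer_deg[OF y a1] full_outer_deg[OF y a2] by auto
  have "\<exists>X. finite X \<and> card X \<le> 1 \<and> N2 t - light \<subseteq> star t w1 \<union> star t w2 \<union> X \<and> t \<notin> light"
    using td
  proof
    assume t2: "deg t = 2"
    then have Nt: "N t = {w1, w2}" using deg2E[OF t2 t(1)] t w by (metis N_iff insertE singletonD)
    have "(\<Sum>w\<in>N t. deg w) = deg w1 + deg w2" using Nt w by simp
    then have "t \<notin> light" using Dw D_ge6 unfolding light_def by simp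
    moreover have "N2 t - light \<subseteq> star t w1 \<union> star t w2 \<union> {}" using N2_star[of t] unfolding Nt by auto
    ultimately show ?thesis by (intro exI[of _ "{}"]) simp
  next
    assume "deg t = 3 \<and> (\<exists>l. adj t l \<and> deg l = 2)"
    then obtain l where l: "deg t = 3" "adj t l" "deg l = 2" by blast
    have lL: "l \<in> light" using light_of_deg3[OF l(1,3,2)] .
    obtain p where p: "N l = {t, p}" using deg2E[OF l(3) adj_sym[OF l(2)]] by metis
    have "l \<noteq> w1" "l \<noteq> w2" using Dw l D_ge6 by auto
    then have "card {l, w1, w2} = 3" "{l, w1, w2} \<subseteq> N t" using l t w by auto
    then have Nt: "N t = {l, w1, w2}" using l(1) card_subset_eq[of "N t" "{l, w1, w2}"] unfolding deg_def by simp
    have "N2 t - light \<subseteq> star t w1 \<union> star t w2 \<union> {p}"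
      using N2_star[of t] lL unfolding Nt by (auto simp: star_def p)
    moreover have "t \<notin> light" using l light_deg by force
    ultimately show ?thesis by (intro exI[of _ "{p}"]) auto
  qed
  then obtain X where X: "finite X" "card X \<le> 1" "N2 t - light \<subseteq> star t w1 \<union> star t w2 \<union> X" "t \<notin> light" by blast
  have five: "5 \<le> card (avail c' ?W a1)" for c' using full_avail2(2)[OF y a1(1,2), of c'] w5 k_def D_ge6 by simp
  have notA: "\<not> (\<exists>L. card L = 4 \<and> (\<forall>a. adj y a \<longrightarrow> avail c' ?W a = L))" for c'
    using five[of c'] a1 by fastforce
  have B: "card (avail c' ?W y) = 5 \<and> (\<forall>a. adj y a \<longrightarrow> avail c' ?W a \<subseteq> avail c' ?W y)" if "valid c' ?W" for c'
    using full_stuck[OF y that] notA by blast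
  have eq: "avail c ?W a1 = avail c ?W y"
    by (rule card_seteq) (use B[OF c] five[of c] a1 in auto)
  have "\<not> avail c ?W a2 \<subseteq> c ` X"
  proof
    assume "avail c ?W a2 \<subseteq> c ` X"
    then have "card (avail c ?W a2) \<le> card (c ` X)" using X by (intro card_mono) auto
    also have "\<dots> \<le> 1" using card_image_le[of X c] X by simp
    finally show False using full_avail[OF y a2(1), of c] by simp
  qed
  then obtain l where l: "l \<in> avail c ?W a2" "l \<notin> c ` X" by blast
  have l1: "l \<in> avail c ?W a1" using l B[OF c] a2 unfolding eq by blast
  note rc = recolor_common[OF y a1 a2 ne t tn X(4,3) c l1 l]
  have "c t \<in> avail (c(t := l)) ?W y" using B[OF rc(1)] rc(2) a1 by blast
  then show False using rc(3,4) eq by simp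
qed

text \<open>\<open>u\<close> has at least 5 colours, so its list always equals that of
  \<open>y\<close>. Hence \<open>u\<close> and \<open>y\<close> see the same colours, also after
  dropping \<open>x\<close>, which both see. Changing the colour of \<open>b\<close>, which only
  \<open>u\<close> sees, and then that of \<open>x\<close>, contradicts this.\<close>

lemma needy_shared:
  assumes y: "full y" and yu: "adj y u" and u: "needy u" and ux: "adj u x" "deg x = 4"
    and Nx: "N x = {u, b, z1, z2}" "distinct [u, b, z1, z2]" and b: "deg b = 2"
    and z: "card (star x z1 - light) + card (star x z2 - light) \<le> 7"
  shows False
proof -
  let ?W = "rest y"
  have y5: "deg y = 5" using y unfolding full_def by simp
  have y2: "deg y \<noteq> 2" using y5 by simp
  obtain l q where lq: "N u = {l, y, q}" "l \<noteq> y" "l \<noteq> q" "y \<noteq> q" "deg l = 2" "l \<in> light" "D + 3 \<le> deg y + deg q"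
    using needyE[OF u adj_sym[OF yu] y2] by metis
  have up: "adj u p \<longleftrightarrow> p = l \<or> p = y \<or> p = q" for p using lq(1) by (metis N_iff insert_iff singletonD)
  have xq: "x = q" using ux up[of x] lq y5 by auto
  have Nu: "N u = {l, y, x}" using lq xq by simp
  \<comment> \<open>The degrees of \<open>y\<close> and \<open>x\<close> are 5 and 4, so
    \<open>D + 3 \<le> 9\<close>.\<close>
  have D: "D = 6" using lq xq ux y5 D_ge6 by simp
  have k10: "k = 10" using D k_def by simp
  have adjx: "adj x u" "adj x b" "adj x z1" "adj x z2" using Nx by (metis N_iff insertCI)+
  have ul: "adj u l" using up by blast
  obtain p where p: "N l = {u, p}" "p \<noteq> u" "adj l p" using deg2E[OF lq(5) adj_sym[OF ul]] by metis
  obtain w where w: "N b = {x, w}" "w \<noteq> x" "adj b w" using deg2E[OF b adj_sym[OF adjx(2)]] by metis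
  have yb: "y \<noteq> b" using y5 b by auto
  have xy: "x \<noteq> y" using y5 ux by auto
  have b_nadj: "\<not> adj y b" using no4[of y b x u] adjx ux yu Nx(2) xy adj_sym by auto
  have x_nadj: "\<not> adj y x" using no3[of y x u] ux yu adj_sym by blast
  have b_N2: "b \<notin> N2 y"
  proof
    assume "b \<in> N2 y"
    then obtain v where "adj y v" "adj v b" unfolding N2_def sq_def using b_nadj adj_sym by blast
    then show False using no5[of y v b x u] adjx ux yu adj_sym by blast
  qed
  have xW: "x \<in> ?W" using x_nadj xy ux adj_V light_deg[of x] unfolding rest_def by auto
  have p_ne: "p \<noteq> x" "p \<noteq> b" using no3[of u l x] no4[of u l b x] ul p ux adjx adj_sym Nx(2) lq(3) xq by auto
  have sub_u: "N2 u \<inter> ?W \<subseteq> {x, b, z1, z2, p}"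
    using full_avail3(1)[OF y yu Nu lq(6) p(1)] Nx(2) unfolding star_def Nx by auto
  have five: "5 \<le> card (avail c ?W u)" for c
    using avail_ge[OF sub_u, of c] k10 card_insert_le_m1[of 5 "{b, z1, z2, p}" x]
    by (simp add: card_insert_if split: if_splits)
  have notA: "\<not> (\<exists>L. card L = 4 \<and> (\<forall>a. adj y a \<longrightarrow> avail c ?W a = L))" for c
    using five[of c] yu by fastforce
  have eq: "avail c ?W u = avail c ?W y \<and> card (avail c ?W u) = 5" if c: "valid c ?W" for c
  proof -
    have B: "card (avail c ?W y) = 5 \<and> (\<forall>a. adj y a \<longrightarrow> avail c ?W a \<subseteq> avail c ?W y)"
      using full_stuck[OF y c] notA by blast
    have "avail c ?W u = avail c ?W y" by (rule card_seteq) (use B five[of c] yu in auto)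
    then show ?thesis using B by simp
  qed
  have img: "c ` (N2 u \<inter> ?W) = c ` (N2 y \<inter> ?W) \<and> card (c ` (N2 u \<inter> ?W)) = 5" if c: "valid c ?W" for c
  proof -
    have s: "c ` (N2 v \<inter> ?W) \<subseteq> {..<k}" for v using c unfolding valid_def by auto
    have e: "avail c ?W u = avail c ?W y" "card (avail c ?W u) = 5" using eq[OF c] by auto
    have "c ` (N2 u \<inter> ?W) = c ` (N2 y \<inter> ?W)" using s[of u] s[of y] e(1) unfolding avail_def by blast
    moreover have "card (avail c ?W u) = card {..<k} - card (c ` (N2 u \<inter> ?W))"
      unfolding avail_def by (rule card_Diff_subset) (use s in auto)
    moreover have "card (c ` (N2 u \<inter> ?W)) \<le> k" using card_mono[OF _ s[of u]] by simp
    ultimately show ?thesis using e(2) k10 by simp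
  qed
  have card5: "card {x, b, z1, z2, p} \<le> 5" by (simp add: card_insert_if)
  have inju: "inj_on c (N2 u \<inter> ?W) \<and> N2 u \<inter> ?W = {x, b, z1, z2, p} \<and> inj_on c (N2 y \<inter> ?W)" if c: "valid c ?W" for c
  proof -
    have 5: "card (c ` (N2 u \<inter> ?W)) = 5" "card (c ` (N2 y \<inter> ?W)) = 5" using img[OF c] by auto
    have "card (c ` (N2 u \<inter> ?W)) \<le> card (N2 u \<inter> ?W)" by (rule card_image_le) simp
    moreover have "card (N2 u \<inter> ?W) \<le> card {x, b, z1, z2, p}" by (rule card_mono[OF _ sub_u]) simp
    ultimately have cu: "card (N2 u \<inter> ?W) = 5" "card {x, b, z1, z2, p} = 5" using 5 card5 by linarith+
    have "card (N2 y \<inter> ?W) \<le> 5"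
      using card_mono[OF _ full_avail_y(1)[OF y]] full_N2(2)[OF y] by simp
    moreover have "card (c ` (N2 y \<inter> ?W)) \<le> card (N2 y \<inter> ?W)" by (rule card_image_le) simp
    ultimately have cy: "card (N2 y \<inter> ?W) = 5" using 5 by linarith
    have "N2 u \<inter> ?W = {x, b, z1, z2, p}" by (rule card_subset_eq[OF _ sub_u]) (use cu in auto)
    moreover have "inj_on c (N2 u \<inter> ?W)" by (rule eq_card_imp_inj_on) (use cu 5 in auto)
    moreover have "inj_on c (N2 y \<inter> ?W)" by (rule eq_card_imp_inj_on) (use cy 5 in auto)
    ultimately show ?thesis by blast
  qed
  have xN2: "x \<in> N2 y" unfolding N2_def sq_def using yu ux adj_sym xy by auto
  have key: "c ` ((N2 y \<inter> ?W) - {x}) = c ` {b, z1, z2, p}" if c: "valid c ?W" for c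
  proof -
    have i: "inj_on c (N2 u \<inter> ?W)" "N2 u \<inter> ?W = {x, b, z1, z2, p}" "inj_on c (N2 y \<inter> ?W)" using inju[OF c] by auto
    have "c ` ((N2 y \<inter> ?W) - {x}) = c ` (N2 y \<inter> ?W) - c ` {x}"
      by (rule inj_on_image_set_diff[OF i(3)]) (use xN2 xW in auto)
    also have "\<dots> = c ` (N2 u \<inter> ?W) - c ` {x}" using img[OF c] by simp
    also have "\<dots> = c ` ((N2 u \<inter> ?W) - {x})"
      by (rule inj_on_image_set_diff[OF i(1), symmetric]) (use i in auto)
    also have "(N2 u \<inter> ?W) - {x} = {b, z1, z2, p}"
      unfolding i(2) using adjx adj_irr p_ne by auto
    finally show ?thesis .
  qed
  obtain c where c: "valid c ?W" using full_rest_ok[OF y] .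
  have bW: "b \<in> ?W" using inju[OF c] by blast
  have xb: "x \<noteq> b" using adjx adj_irr by auto
  \<comment> \<open>With \<open>x\<close> uncoloured too, at most 8 of the 10 colours are forbidden
    at \<open>b\<close>, so one different from its old colour is free.\<close>
  define W0 where "W0 = ?W - {x, b}"
  have c0: "valid c W0" by (rule valid_subset[OF c]) (auto simp: W0_def)
  have "N2 b \<inter> W0 \<subseteq> {z1, z2} \<union> star b w"
    using N2_star[of b] yu unfolding w(1) W0_def rest_def by (auto simp: star_def Nx)
  moreover have "card ({z1, z2} \<union> star b w) \<le> 8"
    using card_Un_le[of "{z1, z2}" "star b w"] card_star[OF w(3)] deg_le[of w] D
    by (simp add: card_insert_if split: if_splits)
  ultimately have "2 \<le> card (avail c W0 b)"
    using avail_ge[of b W0 "{z1, z2} \<union> star b w" c] k10 by simp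
  then have "\<not> avail c W0 b \<subseteq> {c b}" using card_mono[of "{c b}" "avail c W0 b"] by auto
  then obtain \<beta> where \<beta>: "\<beta> \<in> avail c W0 b" "\<beta> \<noteq> c b" by blast
  have c1: "valid (c(b := \<beta>)) (insert b W0)" by (rule extend1[OF c0 _ \<beta>(1)]) (auto simp: W0_def)
  \<comment> \<open>Here the bound 7 enters: at most 2 + 7 = 9 of the 10 colours are forbidden at
    \<open>x\<close>.\<close>
  have "N2 x \<inter> insert b W0 \<subseteq> {b, w} \<union> ((star x z1 - light) \<union> (star x z2 - light))"
  proof
    fix v assume v: "v \<in> N2 x \<inter> insert b W0"
    have "v \<in> insert b ?W" using v unfolding W0_def by auto
    then have vL: "v = b \<or> v \<notin> light" "v \<noteq> u" "v \<noteq> y" "v \<noteq> l"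
      using yu lq(6) bW yb b_nadj Nx(2) unfolding rest_def by auto
    have "v \<in> star x u \<or> v \<in> star x b \<or> v \<in> star x z1 \<or> v \<in> star x z2"
      using v N2_star[of x] unfolding Nx by auto
    then show "v \<in> {b, w} \<union> ((star x z1 - light) \<union> (star x z2 - light))"
      using vL by (auto simp: star_def Nu w(1))
  qed
  moreover have "card ({b, w} \<union> ((star x z1 - light) \<union> (star x z2 - light))) \<le> 9"
    using card_Un_le[of "{b, w}" "(star x z1 - light) \<union> (star x z2 - light)"] card_Un_le[of "star x z1 - light" "star x z2 - light"] z
    by (simp add: card_insert_if split: if_splits)
  ultimately have "\<exists>\<xi>. valid (c(b := \<beta>, x := \<xi>)) (insert x (insert b W0))"
    by (intro greedy[OF c1]) (use xb k10 in \<open>auto simp: W0_def\<close>)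
  moreover have "insert x (insert b W0) = ?W" using xW bW unfolding W0_def by auto
  ultimately obtain \<xi> where c2: "valid (c(b := \<beta>, x := \<xi>)) ?W" by auto
  let ?c2 = "c(b := \<beta>, x := \<xi>)"
  have zs: "b \<notin> {z1, z2, p}" "x \<notin> {z1, z2, p}" using Nx(2) p_ne adjx adj_irr by auto
  have i: "inj_on c (N2 u \<inter> ?W)" "N2 u \<inter> ?W = {x, b, z1, z2, p}" using inju[OF c] by auto
  have cb: "c b \<notin> c ` {z1, z2, p}" using i(1) zs unfolding i(2) inj_on_def by blast
  have "c ` ((N2 y \<inter> ?W) - {x}) = ?c2 ` ((N2 y \<inter> ?W) - {x})"
    by (rule image_cong) (use b_N2 in auto)
  then have "c ` {b, z1, z2, p} = ?c2 ` {b, z1, z2, p}" using key[OF c] key[OF c2] by simp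
  moreover have "?c2 ` {b, z1, z2, p} = insert \<beta> (c ` {z1, z2, p})" using zs xb by auto
  ultimately have "c b \<in> insert \<beta> (c ` {z1, z2, p})" by blast
  then show False using cb \<beta>(2) by auto
qed

section \<open>Discharging\<close>

text \<open>Halves occur only for needy vertices: a full vertex cannot afford 1 for each claim, so
  it gives them 1/2, and a 4-vertex on their other side makes up for the missing half.\<close>

definition give :: "'a \<Rightarrow> 'a \<Rightarrow> real" where
  "give v w = (if 6 \<le> deg v \<or> deg w = 2 then 1
     else if needy w \<and> deg v = 5 then (if full v then 1/2 else 1)
     else if needy w \<and> deg v = 4 \<and> (\<exists>y. adj w y \<and> full y) then 1/2 else 0)"

definition charge :: "'a \<Rightarrow> real" where
  "charge v = 2 * real (deg v) - 6 + (\<Sum>w\<in>N v. give w v) - (\<Sum>w\<in>N v. give v w)"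

definition two_nbrs :: "'a \<Rightarrow> 'a set" where "two_nbrs v = {w. adj v w \<and> deg w = 2}"
definition big_nbrs :: "'a \<Rightarrow> 'a set" where "big_nbrs v = {w. adj v w \<and> 6 \<le> deg w}"
definition poor_nbrs :: "'a \<Rightarrow> 'a set" where "poor_nbrs v = {w. adj v w \<and> (deg w = 2 \<or> needy w)}"

definition bad4 :: "'a \<Rightarrow> bool" where
  "bad4 x \<longleftrightarrow> deg x = 4 \<and> card (two_nbrs x) = 3 \<and> big_nbrs x = {}"

definition bad5 :: "'a \<Rightarrow> bool" where
  "bad5 y \<longleftrightarrow> full y \<and> 4 \<le> card (two_nbrs y)"

text \<open>The deficits: 3 - 2 = 1 at a 4-vertex. A full vertex with \<open>p\<close> 2-neighbours
  is left with 4 - p - (5 - p)/2 = (3 - p)/2, which is negative for \<open>p\<close> = 4 and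
  5.\<close>

definition need :: "'a \<Rightarrow> real" where
  "need x = (if bad4 x then 1 else if bad5 x then (real (card (two_nbrs x)) - 3) / 2 else 0)"

text \<open>Vertices with a surplus of 1/2 for each neighbour of degree at least 6. A 3-vertex with
  a 2-neighbour passes one received unit on, so it needs two such neighbours.\<close>

definition donor :: "'a \<Rightarrow> bool" where
  "donor t \<longleftrightarrow> 3 \<le> deg t \<and> (\<exists>w w'. w \<noteq> w' \<and> adj t w \<and> adj t w' \<and> 6 \<le> deg w \<and> 5 \<le> deg w' \<and>
     (deg t = 3 \<and> two_nbrs t \<noteq> {} \<longrightarrow> 6 \<le> deg w'))"

lemma donorE:
  assumes "donor t"
  obtains w w' where "w \<noteq> w'" "adj t w" "adj t w'" "6 \<le> deg w" "5 \<le> deg w'"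
  using assms unfolding donor_def by blast

section \<open>Charges of the vertices after giving\<close>

lemma sum_charge: "(\<Sum>v\<in>V. charge v) = (\<Sum>v\<in>V. 2 * real (deg v) - 6)"
proof -
  have "(\<Sum>v\<in>V. \<Sum>w\<in>N v. give w v) = (\<Sum>v\<in>V. \<Sum>w\<in>V. if adj v w then give w v else 0)"
    by (rule sum.cong[OF refl], rule sum.mono_neutral_cong_left) (use finV N_sub in auto)
  also have "\<dots> = (\<Sum>w\<in>V. \<Sum>v\<in>V. if adj v w then give w v else 0)" by (rule sum.swap)
  also have "\<dots> = (\<Sum>w\<in>V. \<Sum>v\<in>V. if adj w v then give w v else 0)" using adj_comm by simp
  also have "\<dots> = (\<Sum>w\<in>V. \<Sum>v\<in>N w. give w v)"
    by (rule sum.cong[OF refl], rule sum.mono_neutral_cong_right) (use finV N_sub in auto)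
  finally have "(\<Sum>v\<in>V. \<Sum>w\<in>N v. give w v) = (\<Sum>v\<in>V. \<Sum>w\<in>N v. give v w)" .
  then show ?thesis unfolding charge_def by (simp add: sum.distrib sum_subtractf)
qed

lemma sets_fin[simp]: "finite (two_nbrs v)" "finite (big_nbrs v)" "finite (poor_nbrs v)"
  and sets_sub: "two_nbrs v \<subseteq> N v" "big_nbrs v \<subseteq> N v" "poor_nbrs v \<subseteq> N v"
proof -
  show "two_nbrs v \<subseteq> N v" "big_nbrs v \<subseteq> N v" "poor_nbrs v \<subseteq> N v" unfolding two_nbrs_def big_nbrs_def poor_nbrs_def by auto
  then show "finite (two_nbrs v)" "finite (big_nbrs v)" "finite (poor_nbrs v)" using finite_subset fin_N by metis+
qed

lemma needy_deg: "needy w \<Longrightarrow> deg w = 3" unfolding needy_def by simp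

lemma give_nonneg: "0 \<le> give v w" unfolding give_def by simp

lemma inflow_big: "real (card (big_nbrs v)) \<le> (\<Sum>w\<in>N v. give w v)"
proof -
  have "real (card (big_nbrs v)) = (\<Sum>w\<in>big_nbrs v. give w v)"
    by (simp add: big_nbrs_def give_def)
  also have "\<dots> \<le> (\<Sum>w\<in>N v. give w v)" by (rule sum_mono2) (use sets_sub give_nonneg in auto)
  finally show ?thesis .
qed

lemma card_sub_N: "X \<subseteq> N v \<Longrightarrow> card X \<le> deg v"
  unfolding deg_def by (rule card_mono) auto

lemma card_disj_N: "X \<subseteq> N v \<Longrightarrow> Y \<subseteq> N v \<Longrightarrow> X \<inter> Y = {} \<Longrightarrow> card X + card Y \<le> deg v"
  using card_sub_N[of "X \<union> Y" v] by (metis Un_least card_Un_disjoint fin_N finite_subset)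

lemma out_sum: "(\<Sum>w\<in>N v. give v w) = real (card (two_nbrs v)) + (\<Sum>w\<in>N v - two_nbrs v. give v w)"
proof -
  have "(\<Sum>w\<in>N v. give v w) = (\<Sum>w\<in>N v - two_nbrs v. give v w) + (\<Sum>w\<in>two_nbrs v. give v w)"
    by (rule sum.subset_diff) (use sets_sub in auto)
  moreover have "(\<Sum>w\<in>two_nbrs v. give v w) = real (card (two_nbrs v))"
    by (simp add: two_nbrs_def give_def)
  ultimately show ?thesis by simp
qed

lemma charge_big: "6 \<le> deg v \<Longrightarrow> real (card (big_nbrs v)) \<le> charge v"
proof -
  assume v: "6 \<le> deg v"
  then have "(\<Sum>w\<in>N v. give v w) = real (deg v)" unfolding deg_def by (simp add: give_def deg_def)
  then show ?thesis unfolding charge_def using inflow_big[of v] v by simp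
qed

lemma charge_two: "deg v = 2 \<Longrightarrow> 0 \<le> charge v"
proof -
  assume v: "deg v = 2"
  have "(\<Sum>w\<in>N v. give w v) = real (deg v)" unfolding deg_def using v by (simp add: give_def)
  moreover have "(\<Sum>w\<in>N v. give v w) = 0"
    by (rule sum.neutral) (use v no_adj_2 in \<open>auto simp: give_def\<close>)
  ultimately show ?thesis unfolding charge_def using v by simp
qed

lemma split3:
  assumes "deg v = 3" "adj v a" "adj v b" "a \<noteq> b"
  obtains c where "N v = {a, b, c}" "c \<noteq> a" "c \<noteq> b" "adj v c"
proof -
  have "card (N v - {a, b}) = 1" using assms unfolding deg_def by (simp add: card_Diff_subset)
  then obtain c where c: "N v - {a, b} = {c}" by (auto simp: card_1_singleton_iff)
  have "N v = insert a (insert b (N v - {a, b}))" using assms by auto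
  then have N: "N v = {a, b, c}" using c by simp
  have "c \<in> N v - {a, b}" unfolding c by simp
  then have "c \<noteq> a" "c \<noteq> b" "adj v c" by auto
  with N show ?thesis by (rule that)
qed

text \<open>Two of them would turn \<open>deg3_sum\<close> into
  \<open>D + 3 \<le> 2 + D\<close>.\<close>

lemma three_two_nbrs: "deg v = 3 \<Longrightarrow> card (two_nbrs v) \<le> 1"
proof (rule ccontr)
  assume v: "deg v = 3" and "\<not> card (two_nbrs v) \<le> 1"
  then obtain a b where ab: "a \<in> two_nbrs v" "b \<in> two_nbrs v" "a \<noteq> b"
    using card_le_Suc0_iff_eq[of "two_nbrs v"] by auto
  then obtain c where "N v = {a, b, c}" using split3[OF v, of a b] unfolding two_nbrs_def by auto
  then show False using deg3_sum[OF v, of a b c] ab deg_le[of c] unfolding two_nbrs_def by simp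
qed

text \<open>A 3-vertex spends at most 1, on its 2-neighbour. If it is needy, \<open>deg3_sum\<close>
  leaves the degrees 5, 5 or 4, 5 for the other two neighbours, and these give at least 1
  together.\<close>

lemma charge_three:
  assumes v: "deg v = 3"
  shows "(if donor v then real (card (big_nbrs v)) / 2 else 0) \<le> charge v"
proof -
  have out: "(\<Sum>w\<in>N v. give v w) = real (card (two_nbrs v))"
    unfolding out_sum by (simp, rule sum.neutral) (use v in \<open>auto simp: give_def two_nbrs_def\<close>)
  have chv: "charge v = (\<Sum>w\<in>N v. give w v) - real (card (two_nbrs v))" unfolding charge_def out using v by simp
  show ?thesis
  proof (cases "two_nbrs v = {}")
    case True
    then show ?thesis using chv inflow_big[of v] by simp
  next
    case False
    then have one: "card (two_nbrs v) = 1" using three_two_nbrs[OF v]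
      by (metis One_nat_def card_gt_0_iff le_antisym less_eq_Suc_le sets_fin(1))
    obtain a where a: "adj v a" "deg a = 2" using False unfolding two_nbrs_def by auto
    show ?thesis
    proof (cases "needy v")
      case False
      then obtain w where w: "adj v w" "6 \<le> deg w" using a v unfolding needy_def by fastforce
      have "big_nbrs v \<noteq> {}" using w unfolding big_nbrs_def by blast
      then have s1: "1 \<le> card (big_nbrs v)" by (simp add: Suc_le_eq card_gt_0_iff)
      have "2 \<le> card (big_nbrs v)" if cl: "donor v"
      proof -
        obtain w w' where "w \<noteq> w'" "{w, w'} \<subseteq> big_nbrs v"
          using cl v \<open>two_nbrs v \<noteq> {}\<close> unfolding donor_def big_nbrs_def by blast
        then show ?thesis using card_mono[of "big_nbrs v" "{w, w'}"] by simp
      qed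
      then show ?thesis using chv one inflow_big[of v] s1 by (cases "donor v") auto
    next
      case nd: True
      have ncl: "\<not> donor v"
      proof
        assume "donor v"
        then obtain w where "adj v w" "6 \<le> deg w" using donorE by blast
        then show False using nd unfolding needy_def by force
      qed
      obtain y where y: "adj v y" "y \<noteq> a"
      proof -
        have "card (N v - {a}) = 2" using v a unfolding deg_def by simp
        then have "N v - {a} \<noteq> {}" by (metis card.empty zero_neq_numeral)
        then obtain y where "y \<in> N v - {a}" by blast
        then show ?thesis using that[of y] by simp
      qed
      obtain z where Nv: "N v = {a, y, z}" "z \<noteq> a" "z \<noteq> y" "adj v z"
        using split3[OF v a(1) y(1)] y(2) by metis
      have s: "D + 3 \<le> deg y + deg z" using deg3_sum[OF v Nv(1) a(2)] .
      have le: "deg y \<le> 5" "deg z \<le> 5" using nd y Nv unfolding needy_def by auto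
      have in_eq: "(\<Sum>w\<in>N v. give w v) = give a v + give y v + give z v"
        unfolding Nv(1) using Nv y by simp
      have five: "1/2 \<le> give p v" "\<not> full p \<Longrightarrow> give p v = 1" if "deg p = 5" for p
        using nd v that unfolding give_def by auto
      have four: "1/2 \<le> give p v" if "deg p = 4" "adj v q" "full q" for p q
        using nd v that unfolding give_def by auto
      have "1 \<le> give y v + give z v"
      proof -
        consider "deg y = 5" "deg z = 5" | "deg y = 4" "deg z = 5" | "deg y = 5" "deg z = 4"
          using s le D_ge6 by linarith
        then show ?thesis
        proof cases
          case 1 then show ?thesis using five[of y] five[of z] by linarith
        next
          case 2 then show ?thesis using five[of z] four[of y z] Nv(4) give_nonneg[of y v] by (cases "full z") auto
        next
          case 3 then show ?thesis using five[of y] four[of z y] y(1) give_nonneg[of z v] by (cases "full y") auto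
        qed
      qed
      then show ?thesis using ncl chv one in_eq give_nonneg[of a v] by simp
    qed
  qed
qed

lemma star_needy:
  assumes z: "needy z" and x: "adj x z" "deg x \<noteq> 2"
  shows "card (star x z - light) \<le> 2"
proof -
  obtain l q where lq: "N z = {l, x, q}" "l \<in> light" by (rule needyE[OF z adj_sym[OF x(1)] x(2)])
  have "card (star x z - light) \<le> card {z, q}" by (rule card_mono) (use lq in \<open>auto simp: star_def\<close>)
  also have "\<dots> \<le> 2" by (simp add: card_insert_if)
  finally show ?thesis .
qed

lemma star_le: "adj x z \<Longrightarrow> card (star x z - light) \<le> deg z"
  using card_mono[of "star x z" "star x z - light"] card_star[of x z] by auto

text \<open>The needy neighbours to which a 4-vertex gives 1/2.\<close>

definition owed :: "'a \<Rightarrow> 'a set" where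
  "owed x = {u. adj x u \<and> needy u \<and> (\<exists>y. adj u y \<and> full y)}"

lemma owed_conflict:
  assumes x: "deg x = 4" and Nx: "N x = {u, b, z1, z2}" and d: "distinct [u, b, z1, z2]"
    and u: "u \<in> owed x" and b: "b \<in> two_nbrs x"
    and z: "card (star x z1 - light) + card (star x z2 - light) \<le> 7"
  shows False
proof -
  obtain y where y: "adj u y" "full y" "needy u" "adj x u" using u unfolding owed_def by auto
  show False
    by (rule needy_shared[OF y(2) adj_sym[OF y(1)] y(3) adj_sym[OF y(4)] x Nx d _ z])
       (use b in \<open>auto simp: two_nbrs_def\<close>)
qed

lemma split4:
  assumes "deg v = 4" "adj v a" "adj v b" "adj v c" "distinct [a, b, c]"
  obtains e where "N v = {a, b, c, e}" "distinct [a, b, c, e]" "adj v e"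
proof -
  have "card (N v - {a, b, c}) = 1" using assms unfolding deg_def by (simp add: card_Diff_subset)
  then obtain e where e: "N v - {a, b, c} = {e}" by (auto simp: card_1_singleton_iff)
  have "N v = insert a (insert b (insert c (N v - {a, b, c})))" using assms by auto
  then have N: "N v = {a, b, c, e}" using e by simp
  have "e \<in> N v - {a, b, c}" unfolding e by simp
  then have "distinct [a, b, c, e]" "adj v e" using assms(5) by auto
  with N show ?thesis by (rule that)
qed

lemma four_three_two_nbrs:
  assumes v: "deg v = 4" and p: "3 \<le> card (two_nbrs v)"
  obtains z where "card (two_nbrs v) = 3" "N v = insert z (two_nbrs v)" "z \<notin> two_nbrs v" "4 \<le> deg z" "adj v z"
proof -
  obtain A where A: "A \<subseteq> two_nbrs v" "card A = 3" using p by (meson obtain_subset_with_card_n)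
  have AN: "A \<subseteq> N v" using A sets_sub by blast
  have "card (N v - A) = 1" using v A AN unfolding deg_def by (simp add: card_Diff_subset finite_subset[OF AN])
  then obtain z where z: "N v - A = {z}" by (auto simp: card_1_singleton_iff)
  then have Nv: "N v = insert z A" "z \<notin> A" using AN by auto
  have "4 \<le> deg z" using four_vertex(1)[OF v A(2) _ Nv] A unfolding two_nbrs_def by auto
  moreover from this have "two_nbrs v = A" using A Nv sets_sub[of v] unfolding two_nbrs_def by auto
  moreover have "adj v z" using Nv by (metis N_iff insertI1)
  ultimately show ?thesis using that A Nv by auto
qed

text \<open>From its charge 2 the vertex pays 1 per 2-neighbour and 1/2 per element of
  \<open>owed\<close>. By \<open>needy_shared\<close>, next to two 2-neighbours such an element only
  occurs together with a neighbour of degree at least 6, and next to one 2-neighbour there are at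
  most two.\<close>

lemma charge_four:
  assumes v: "deg v = 4"
  shows "(if donor v then real (card (big_nbrs v)) / 2 else 0) \<le> charge v + need v"
proof -
  have owedN: "owed v \<subseteq> N v - two_nbrs v" unfolding owed_def two_nbrs_def needy_def by auto
  have fo: "finite (owed v)" using owedN finite_subset by (metis finite_Diff fin_N)
  have "(\<Sum>w\<in>N v - two_nbrs v. give v w) = (\<Sum>w\<in>owed v. 1/2)"
    by (rule sum.mono_neutral_cong_right) (use owedN v in \<open>auto simp: owed_def give_def two_nbrs_def needy_def\<close>)
  then have out: "(\<Sum>w\<in>N v. give v w) = real (card (two_nbrs v)) + real (card (owed v)) / 2"
    unfolding out_sum by simp
  have chv: "2 + real (card (big_nbrs v)) - real (card (two_nbrs v)) - real (card (owed v)) / 2 \<le> charge v"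
    unfolding charge_def out using v inflow_big[of v] by simp
  have need0: "0 \<le> need v" unfolding need_def bad5_def by simp
  have disj: "card (owed v) + card (two_nbrs v) \<le> 4"
    using card_disj_N[of "owed v" v "two_nbrs v"] owedN sets_sub v by auto
  have disj3: "card (owed v) + card (two_nbrs v) + card (big_nbrs v) \<le> 4"
  proof -
    have "card (owed v \<union> two_nbrs v) = card (owed v) + card (two_nbrs v)"
      using owedN fo by (intro card_Un_disjoint) auto
    moreover have "(owed v \<union> two_nbrs v) \<inter> big_nbrs v = {}" unfolding owed_def two_nbrs_def big_nbrs_def needy_def by auto
    ultimately show ?thesis using card_disj_N[of "owed v \<union> two_nbrs v" v "big_nbrs v"] owedN sets_sub v by auto
  qed
  have fin: ?thesis if "real (card (big_nbrs v)) / 2 \<le> charge v + need v"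
    using that order_trans[OF _ that, of 0] by simp
  consider "3 \<le> card (two_nbrs v)" | "card (two_nbrs v) = 2" | "card (two_nbrs v) = 1" | "card (two_nbrs v) = 0" by linarith
  then show ?thesis
  proof cases
    case 1
    obtain z where z: "card (two_nbrs v) = 3" "N v = insert z (two_nbrs v)" "z \<notin> two_nbrs v" "4 \<le> deg z"
      using four_three_two_nbrs[OF v 1] .
    have "owed v = {}" using owedN z unfolding owed_def needy_def by auto
    moreover have "\<not> donor v"
    proof
      assume "donor v"
      then obtain w w' where w: "w \<noteq> w'" "adj v w" "adj v w'" "6 \<le> deg w" "5 \<le> deg w'" by (rule donorE)
      have "w \<in> insert z (two_nbrs v)" "w' \<in> insert z (two_nbrs v)" using w(2,3) unfolding z(2)[symmetric] by auto
      moreover have "w \<notin> two_nbrs v" "w' \<notin> two_nbrs v" using w(4,5) unfolding two_nbrs_def by auto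
      ultimately show False using w(1) by blast
    qed
    moreover have "1 \<le> real (card (big_nbrs v)) + need v"
    proof (cases "big_nbrs v = {}")
      case True then show ?thesis using v z unfolding need_def bad4_def by simp
    next
      case False
      then have "1 \<le> card (big_nbrs v)" by (simp add: Suc_le_eq card_gt_0_iff)
      then show ?thesis using need0 by linarith
    qed
    ultimately show ?thesis using chv z(1) by simp
  next
    case 2
    obtain b b' where b: "two_nbrs v = {b, b'}" "b \<noteq> b'" using 2 by (auto simp: card_2_iff)
    have "card (owed v) = 0 \<or> 1 \<le> card (big_nbrs v)"
    proof (rule ccontr)
      assume "\<not> ?thesis"
      then have n: "owed v \<noteq> {}" "big_nbrs v = {}" by (auto simp: Suc_le_eq card_gt_0_iff)
      then obtain u where u: "u \<in> owed v" by blast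
      have uu: "adj v u" "u \<noteq> b" "u \<noteq> b'" using u b owedN by auto
      have bb: "adj v b" "adj v b'" "deg b' = 2" using b unfolding two_nbrs_def by auto
      have "distinct [u, b, b']" using uu b(2) by simp
      then obtain z where z: "N v = {u, b, b', z}" "distinct [u, b, b', z]" "adj v z"
        by (rule split4[OF v uu(1) bb(1,2)])
      have "deg z \<le> 5" using n(2) z(3) unfolding big_nbrs_def by fastforce
      \<comment> \<open>The 2-neighbour \<open>b'\<close> contributes at most 2 and \<open>z\<close>
        at most 5.\<close>
      then have "card (star v b' - light) + card (star v z - light) \<le> 7"
        using star_le[OF bb(2)] star_le[OF z(3)] bb by simp
      then show False using owed_conflict[OF v z(1,2) u] b by auto
    qed
    then have "real (card (owed v)) \<le> real (card (big_nbrs v))" using disj3 2 by linarith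
    then show ?thesis using chv 2 need0 by (intro fin) (simp add: field_simps)
  next
    case 3
    have "card (owed v) \<le> 2"
    proof (rule ccontr)
      assume "\<not> ?thesis"
      then have "3 \<le> card (owed v)" by simp
      then obtain A where A: "A \<subseteq> owed v" "card A = 3" by (meson obtain_subset_with_card_n)
      then obtain u z1 z2 where A3: "A = {u, z1, z2}" "u \<noteq> z1" "u \<noteq> z2" "z1 \<noteq> z2"
        unfolding card_3_iff by blast
      have "two_nbrs v \<noteq> {}" using 3 by auto
      then obtain b where b: "b \<in> two_nbrs v" by blast
      have in_o: "u \<in> owed v" "z1 \<in> owed v" "z2 \<in> owed v" using A(1) unfolding A3(1) by simp_all
      then have adjs: "adj v u" "adj v z1" "adj v z2" "needy z1" "needy z2" unfolding owed_def by auto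
      have sides: "b \<notin> owed v" using b owedN by blast
      have dist: "distinct [u, b, z1, z2]" using A3(2-4) sides in_o by auto
      have ub: "adj v b" "distinct [u, b, z1]" using b dist unfolding two_nbrs_def by simp_all
      obtain e where e: "N v = {u, b, z1, e}" "distinct [u, b, z1, e]"
        by (rule split4[OF v adjs(1) ub(1) adjs(2) ub(2)])
      have "z2 \<in> {u, b, z1, e}" unfolding e(1)[symmetric] using adjs by simp
      then have "e = z2" using dist by auto
      then have Nv: "N v = {u, b, z1, z2}" using e by simp
      have "card (star v z1 - light) + card (star v z2 - light) \<le> 7"
        using star_needy[OF adjs(4,2)] star_needy[OF adjs(5,3)] v by simp
      then show False using owed_conflict[OF v Nv dist in_o(1) b] by simp
    qed
    then have "real (card (owed v)) \<le> 2" by simp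
    then show ?thesis using chv 3 need0 by (intro fin) (simp add: field_simps)
  next
    case 4
    then have "real (card (owed v)) \<le> 4" using disj by simp
    then show ?thesis using chv 4 need0 by (intro fin) (simp add: field_simps)
  qed
qed

lemma full_iff_poor_nbrs: "deg v = 5 \<Longrightarrow> full v \<longleftrightarrow> card (poor_nbrs v) = 5"
proof
  assume v: "deg v = 5"
  show "full v \<Longrightarrow> card (poor_nbrs v) = 5"
  proof -
    assume "full v"
    then have "poor_nbrs v = N v" unfolding full_def poor_nbrs_def by auto
    then show ?thesis using v unfolding deg_def by simp
  qed
  assume "card (poor_nbrs v) = 5"
  then have "card (poor_nbrs v) = card (N v)" using v unfolding deg_def by simp
  then have "poor_nbrs v = N v" by (rule card_subset_eq[OF fin_N sets_sub(3)])
  then have "a \<in> poor_nbrs v" if "adj v a" for a using that by simp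
  then show "full v" using v unfolding full_def poor_nbrs_def by simp
qed

text \<open>A vertex that is not full pays 1 to each of at most 4 poor neighbours. With at most 3 of
  them, at least 1 plus its income from big neighbours is left, enough for both terms; a donor is in
  this case, as it has two neighbours that are not poor.\<close>

lemma charge_five:
  assumes v: "deg v = 5"
  shows "(if donor v then real (card (big_nbrs v)) / 2 else 0) + (if card (poor_nbrs v) \<le> 3 then 3/4 else 0) \<le> charge v + need v"
proof (cases "full v")
  case True
  have pN: "poor_nbrs v = N v" using True unfolding full_def poor_nbrs_def by auto
  have c5: "card (N v) = 5" using v unfolding deg_def .
  have ncl: "\<not> donor v"
  proof
    assume "donor v"
    then obtain w where w: "adj v w" "6 \<le> deg w" using donorE by blast
    then have "deg w = 2 \<or> needy w" using True unfolding full_def by blast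
    then show False using w(2) needy_deg[of w] by auto
  qed
  have "(\<Sum>w\<in>N v - two_nbrs v. give v w) = (\<Sum>w\<in>N v - two_nbrs v. 1/2)"
    by (rule sum.cong) (use True v in \<open>auto simp: full_def give_def two_nbrs_def\<close>)
  also have "\<dots> = real (card (N v - two_nbrs v)) / 2" by simp
  also have "card (N v - two_nbrs v) = 5 - card (two_nbrs v)" using c5 card_Diff_subset[OF sets_fin(1) sets_sub(1)] by simp
  finally have out: "(\<Sum>w\<in>N v. give v w) = real (card (two_nbrs v)) + real (5 - card (two_nbrs v)) / 2"
    unfolding out_sum by simp
  have p5: "card (two_nbrs v) \<le> 5" using card_sub_N[OF sets_sub(1), of v] v by simp
  have in0: "0 \<le> (\<Sum>w\<in>N v. give w v)" by (simp add: give_nonneg sum_nonneg)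
  have "need v = (if 4 \<le> card (two_nbrs v) then (real (card (two_nbrs v)) - 3) / 2 else 0)"
    unfolding need_def bad4_def bad5_def using v True by simp
  moreover have "charge v = 4 + (\<Sum>w\<in>N v. give w v) - real (card (two_nbrs v)) - (5 - real (card (two_nbrs v))) / 2"
    unfolding charge_def out using v p5 by (simp add: of_nat_diff)
  moreover have "\<not> card (poor_nbrs v) \<le> 3" using pN c5 by simp
  moreover have "real (card (two_nbrs v)) \<le> 5" using p5 by simp
  ultimately show ?thesis using ncl in0 by (cases "4 \<le> card (two_nbrs v)") (simp_all add: field_simps)
next
  case False
  have "(\<Sum>w\<in>N v. give v w) = (\<Sum>w\<in>poor_nbrs v. 1)"
    by (rule sum.mono_neutral_cong_right) (use sets_sub False v in \<open>auto simp: poor_nbrs_def give_def\<close>)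
  then have out: "(\<Sum>w\<in>N v. give v w) = real (card (poor_nbrs v))" by simp
  have chv: "4 + real (card (big_nbrs v)) - real (card (poor_nbrs v)) \<le> charge v"
    unfolding charge_def out using v inflow_big[of v] by simp
  have need0: "0 \<le> need v" unfolding need_def bad5_def by simp
  have p4: "card (poor_nbrs v) \<le> 4" using False full_iff_poor_nbrs[OF v] card_sub_N[OF sets_sub(3), of v] v by linarith
  have "card (poor_nbrs v) \<le> 3" if cl: "donor v"
  proof -
    obtain w w' where w: "w \<noteq> w'" "adj v w" "adj v w'" "6 \<le> deg w" "5 \<le> deg w'"
      by (rule donorE[OF cl])
    have "poor_nbrs v \<inter> {w, w'} = {}" using w needy_deg unfolding poor_nbrs_def by auto
    then show ?thesis using card_disj_N[OF sets_sub(3), of "{w, w'}" v] w v by simp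
  qed
  moreover have "real (card (poor_nbrs v)) \<le> 3" if "card (poor_nbrs v) \<le> 3" using that by simp
  moreover have "real (card (poor_nbrs v)) \<le> 4" using p4 by simp
  ultimately show ?thesis using chv need0
    by (cases "donor v"; cases "card (poor_nbrs v) \<le> 3") (simp_all add: field_simps)
qed

lemma charge_bound:
  assumes v: "v \<in> V"
  shows "(if donor v then real (card (big_nbrs v)) / 2 else 0) + (if deg v = 5 \<and> card (poor_nbrs v) \<le> 3 then 3/4 else 0)
    \<le> charge v + need v"
proof -
  have need0: "0 \<le> need v" unfolding need_def bad5_def by simp
  consider "deg v = 2" | "deg v = 3" | "deg v = 4" | "deg v = 5" | "6 \<le> deg v"
    using deg_ge2[OF v] by linarith
  then show ?thesis
  proof cases
    case 1 then show ?thesis using charge_two[OF 1] need0 unfolding donor_def by simp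
  next
    case 2 then show ?thesis using charge_three[OF 2] need0 by simp
  next
    case 3 then show ?thesis using charge_four[OF 3] by simp
  next
    case 4 then show ?thesis using charge_five[OF 4] by simp
  next
    case 5 then show ?thesis using charge_big[OF 5] need0 by simp
  qed
qed

end

section \<open>Charge from faces\<close>

text \<open>Starting point and direction are a choice, hence the lemmas on rotation and
  reflection.\<close>

definition hexagon :: "'a set set \<Rightarrow> 'a \<Rightarrow> 'a \<Rightarrow> 'a \<Rightarrow> 'a \<Rightarrow> 'a \<Rightarrow> 'a \<Rightarrow> bool" where
  "hexagon X a b c d e g \<longleftrightarrow> distinct [a, b, c, d, e, g] \<and>
     X = {{a, b}, {b, c}, {c, d}, {d, e}, {e, g}, {g, a}}"

lemma hexagon_rot: "hexagon X a b c d e g \<Longrightarrow> hexagon X b c d e g a"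
  unfolding hexagon_def by auto

lemma hexagon_rev: "hexagon X a b c d e g \<Longrightarrow> hexagon X a g e d c b"
  unfolding hexagon_def by (auto simp: insert_commute)

lemma hexagon_at: "hexagon X a b c d e g \<Longrightarrow> {a, p} \<in> X \<longleftrightarrow> p = b \<or> p = g"
  unfolding hexagon_def by (auto simp: doubleton_eq_iff)

lemma hexagon_from:
  assumes h: "hexagon X p1 p2 p3 p4 p5 p6" and e: "{x, a} \<in> X"
  obtains b c d g where "hexagon X x a b c d g"
proof -
  note found = that
  note h2 = hexagon_rot[OF h] note h3 = hexagon_rot[OF h2] note h4 = hexagon_rot[OF h3]
  note h5 = hexagon_rot[OF h4] note h6 = hexagon_rot[OF h5]
  have key: thesis if hh: "hexagon X q1 q2 q3 q4 q5 q6" and eq: "x = q1" for q1 q2 q3 q4 q5 q6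
  proof -
    have "{q1, a} \<in> X" using e eq by simp
    then consider "a = q2" | "a = q6" using hexagon_at[OF hh] by blast
    then show thesis
    proof cases
      case 1 then show thesis using found[of q3 q4 q5 q6] hh eq by simp
    next
      case 2 then show thesis using found[of q5 q4 q3 q2] hexagon_rev[OF hh] eq by simp
    qed
  qed
  have "x \<in> \<Union> X" using e by blast
  also have "\<Union> X = {p1, p2, p3, p4, p5, p6}" using h unfolding hexagon_def by auto
  finally consider "x = p1" | "x = p2" | "x = p3" | "x = p4" | "x = p5" | "x = p6" by blast
  then show thesis
    by cases (rule key[OF h] key[OF h2] key[OF h3] key[OF h4] key[OF h5] key[OF h6], assumption)+
qed

section \<open>Undirected edges and the handshake identity\<close>

context sgraph begin

definition edges :: "'a set set" where "edges = {{u, v} | u v. adj u v}"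

lemma edge_iff[simp]: "{u, v} \<in> edges \<longleftrightarrow> adj u v"
  unfolding edges_def using adj_sym by (auto simp: doubleton_eq_iff)

lemma fin_edges[simp]: "finite edges"
  by (rule finite_subset[of _ "Pow V"]) (use finV adj_V in \<open>auto simp: edges_def\<close>)

lemma edgeD: "e \<in> edges \<Longrightarrow> v \<in> e \<Longrightarrow> \<exists>w. e = {v, w} \<and> adj v w"
  unfolding edges_def using adj_sym by auto

lemma handshake: "(\<Sum>v\<in>V. deg v) = 2 * card edges"
proof -
  have d: "deg v = card {e \<in> edges. v \<in> e}" for v
  proof -
    have "e \<in> (\<lambda>w. {v, w}) ` N v" if e: "e \<in> edges" "v \<in> e" for e
    proof -
      obtain w where "e = {v, w}" "adj v w" using edgeD[OF e] by blast
      then show ?thesis by (intro image_eqI[of _ _ w]) auto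
    qed
    then have "(\<lambda>w. {v, w}) ` N v = {e \<in> edges. v \<in> e}" by auto
    then have "bij_betw (\<lambda>w. {v, w}) (N v) {e \<in> edges. v \<in> e}"
      unfolding bij_betw_def by (auto simp: inj_on_def doubleton_eq_iff)
    then show ?thesis unfolding deg_def by (rule bij_betw_same_card)
  qed
  have c2: "card {v \<in> V. v \<in> e} = 2" if e: "e \<in> edges" for e
  proof -
    obtain u v where uv: "e = {u, v}" "adj u v" using e unfolding edges_def by blast
    have "{x \<in> V. x \<in> e} = {u, v}" using uv adj_V by auto
    then show ?thesis using uv adj_irr by (auto simp: card_insert_if)
  qed
  have "(\<Sum>v\<in>V. deg v) = (\<Sum>v\<in>V. \<Sum>e\<in>edges. if v \<in> e then 1 else 0)"
    unfolding d by (rule sum.cong[OF refl]) (simp add: sum.If_cases Int_def)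
  also have "\<dots> = (\<Sum>e\<in>edges. \<Sum>v\<in>V. if v \<in> e then 1 else 0)" by (rule sum.swap)
  also have "\<dots> = (\<Sum>e\<in>edges. 2)"
    by (rule sum.cong[OF refl]) (use finV c2 in \<open>simp add: sum.If_cases Int_def\<close>)
  finally show ?thesis by simp
qed

end

text \<open>All that discharging has to know of the plane. \<open>F\<close> may be an incomplete
  list of faces, \<open>B\<close> gives their borders, and \<open>cy\<close> marks the edges on
  cycles. By \<open>B_shared\<close>, hexagons share consecutive edges only at 2-vertices.\<close>

locale critical_faces = critical +
  fixes F :: "'f set" and B :: "'f \<Rightarrow> 'a set set" and cy :: "'a set \<Rightarrow> bool"
  assumes finF: "finite F"
    and euler: "card edges + 2 \<le> card V + card F"
    and B_sub: "f \<in> F \<Longrightarrow> B f \<subseteq> edges"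
    and B_two: "e \<in> edges \<Longrightarrow> card {f \<in> F. e \<in> B f} \<le> 2"
    and B_one: "e \<in> edges \<Longrightarrow> \<not> cy e \<Longrightarrow> card {f \<in> F. e \<in> B f} \<le> 1"
    and B_thread: "N v = {u, w} \<Longrightarrow> u \<noteq> w \<Longrightarrow> cy {u, v} \<Longrightarrow> f \<in> F \<Longrightarrow> {u, v} \<in> B f \<Longrightarrow> {v, w} \<in> B f"
    and B_six: "f \<in> F \<Longrightarrow> 6 \<le> card (B f)"
    and B_hex: "f \<in> F \<Longrightarrow> card (B f) = 6 \<Longrightarrow> \<exists>a b c d e g. hexagon (B f) a b c d e g"
    and B_shared: "f \<in> F \<Longrightarrow> f' \<in> F \<Longrightarrow> f \<noteq> f' \<Longrightarrow> card (B f) = 6 \<Longrightarrow> card (B f') = 6 \<Longrightarrow> u \<noteq> w \<Longrightarrow>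
        {u, v} \<in> B f \<Longrightarrow> {v, w} \<in> B f \<Longrightarrow> {u, v} \<in> B f' \<Longrightarrow> {v, w} \<in> B f' \<Longrightarrow> N v = {u, w}"
begin

abbreviation hexa :: "'f \<Rightarrow> 'a \<Rightarrow> 'a \<Rightarrow> 'a \<Rightarrow> 'a \<Rightarrow> 'a \<Rightarrow> 'a \<Rightarrow> bool" where
  "hexa f \<equiv> hexagon (B f)"

lemma hexa_adj:
  assumes "f \<in> F" "hexa f a b c d e g"
  shows "adj a b" "adj b c" "adj c d" "adj d e" "adj e g" "adj g a"
  using assms B_sub[OF assms(1)] unfolding hexagon_def by auto

lemma hexa_from:
  assumes f: "f \<in> F" "card (B f) = 6" and e: "{x, a} \<in> B f"
  obtains b c d g where "hexa f x a b c d g"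
proof -
  obtain p1 p2 p3 p4 p5 p6 where "hexa f p1 p2 p3 p4 p5 p6" using B_hex[OF f] by blast
  from hexagon_from[OF this e] show ?thesis using that by blast
qed

definition sides :: "'a set \<Rightarrow> nat" where "sides e = card {f \<in> F. e \<in> B f}"

lemma fin_faces[simp]: "finite {f \<in> F. P f}" using finF by simp

lemma fin_B: "f \<in> F \<Longrightarrow> finite (B f)" using B_sub finite_subset fin_edges by blast

text \<open>Border lengths need not add up to twice the number of edges, since bridges and unlisted
  faces leave sides open; the term \<open>2 - real (sides e)\<close> restores the balance. The sum
  then is 6 times |E| - |V| - |F|, and \<open>euler\<close> bounds it.\<close>

lemma total_charge:
  "(\<Sum>v\<in>V. charge v) + (\<Sum>e\<in>edges. 2 - real (sides e)) + (\<Sum>f\<in>F. real (card (B f)) - 6) \<le> -12"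
proof -
  have "(\<Sum>e\<in>edges. sides e) = (\<Sum>e\<in>edges. \<Sum>f\<in>F. if e \<in> B f then 1 else 0)"
    unfolding sides_def by (rule sum.cong[OF refl]) (use finF in \<open>simp add: sum.If_cases Int_def\<close>)
  also have "\<dots> = (\<Sum>f\<in>F. \<Sum>e\<in>edges. if e \<in> B f then 1 else 0)" by (rule sum.swap)
  also have "\<dots> = (\<Sum>f\<in>F. card (B f))"
  proof (rule sum.cong[OF refl])
    fix f assume "f \<in> F"
    then have "{e \<in> edges. e \<in> B f} = B f" using B_sub by blast
    then show "(\<Sum>e\<in>edges. if e \<in> B f then 1 else 0) = card (B f)" by (simp add: sum.If_cases Int_def)
  qed
  finally have b: "(\<Sum>e\<in>edges. real (sides e)) = (\<Sum>f\<in>F. real (card (B f)))"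
    by (metis of_nat_sum)
  have "(\<Sum>v\<in>V. charge v) = 2 * real (\<Sum>v\<in>V. deg v) - 6 * real (card V)"
    unfolding sum_charge by (simp add: sum_subtractf sum_distrib_left)
  then have 1: "(\<Sum>v\<in>V. charge v) = 4 * real (card edges) - 6 * real (card V)" using handshake by simp
  have 2: "(\<Sum>e\<in>edges. 2 - real (sides e)) = 2 * real (card edges) - (\<Sum>f\<in>F. real (card (B f)))"
    using b by (simp add: sum_subtractf)
  have 3: "(\<Sum>f\<in>F. real (card (B f)) - 6) = (\<Sum>f\<in>F. real (card (B f))) - 6 * real (card F)"
    by (simp add: sum_subtractf)
  have "real (card edges) + 2 \<le> real (card V) + real (card F)" using euler by linarith
  then show ?thesis unfolding 1 2 3 by linarith
qed

definition bad :: "'a \<Rightarrow> bool" where "bad x \<longleftrightarrow> bad4 x \<or> bad5 x"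

definition other_end :: "'a \<Rightarrow> 'a \<Rightarrow> 'a" where "other_end x a = (THE w. w \<noteq> x \<and> adj a w)"

text \<open>The units in which deficits are settled.\<close>

definition claims :: "('a \<times> 'a) set" where "claims = {(x, a). bad x \<and> a \<in> two_nbrs x}"

text \<open>
  What a deficient vertex \<open>x\<close> gains through its neighbour \<open>a\<close> of degree 2: from the edge itself if it lies on fewer than
  two faces, from faces of length at least 7, from the vertex \<open>t\<close> opposite to \<open>x\<close> on a face of length 6, and from the
  other neighbour of \<open>a\<close>. A long face pays 1/4 per vertex \<open>a\<close>, split if both neighbours of \<open>a\<close> are deficient.
\<close>

definition edge_pay :: "'a \<Rightarrow> 'a \<Rightarrow> real" where
  "edge_pay x a = (if cy {x, a} then (2 - real (sides {x, a})) / 4 else 1/2)"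

definition face_pay :: "'a \<Rightarrow> 'a \<Rightarrow> 'f \<Rightarrow> real" where
  "face_pay x a f = (if cy {x, a} \<and> {x, a} \<in> B f \<and> 7 \<le> card (B f) then (if bad (other_end x a) then 1/8 else 1/4) else 0)"

definition donates :: "'a \<Rightarrow> 'a \<Rightarrow> 'f \<Rightarrow> 'a \<Rightarrow> 'a \<Rightarrow> bool" where
  "donates x a f t w \<longleftrightarrow> donor t \<and> 6 \<le> deg w \<and> (\<exists>w' a'. hexa f x a w t w' a')"

definition donor_pay :: "'a \<Rightarrow> 'a \<Rightarrow> 'f \<Rightarrow> real" where
  "donor_pay x a f = (if \<exists>t w. donates x a f t w then 1/4 else 0)"

definition nbr_pay :: "'a \<Rightarrow> 'a \<Rightarrow> real" where
  "nbr_pay x a = (if deg (other_end x a) = 5 \<and> card (poor_nbrs (other_end x a)) \<le> 3 then 1/4 else 0)"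

definition gained :: "'a \<Rightarrow> 'a \<Rightarrow> real" where
  "gained x a = edge_pay x a + (\<Sum>f\<in>F. face_pay x a f + donor_pay x a f) + nbr_pay x a"

section \<open>Payments and the sources that cover them\<close>

lemma bad_deg: "bad x \<Longrightarrow> deg x = 4 \<or> deg x = 5"
  unfolding bad_def bad4_def bad5_def full_def by auto

lemma other_end_eq: "N a = {x, w} \<Longrightarrow> w \<noteq> x \<Longrightarrow> other_end x a = w"
  unfolding other_end_def by (rule the_equality) (metis N_iff insertCI, metis N_iff insert_iff singletonD)

lemma two_nbrsE:
  assumes "a \<in> two_nbrs x"
  obtains w where "N a = {x, w}" "w \<noteq> x" "other_end x a = w" "adj a w" "adj x a" "deg a = 2"
proof -
  have a: "deg a = 2" "adj x a" using assms unfolding two_nbrs_def by auto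
  obtain w where "w \<noteq> x" "N a = {x, w}" "adj a w" using deg2E[OF a(1) adj_sym[OF a(2)]] by blast
  then show ?thesis using that other_end_eq a by blast
qed

lemma sides_le2: "adj x a \<Longrightarrow> sides {x, a} \<le> 2"
  unfolding sides_def using B_two by simp

lemma fin_claims: "finite claims"
  by (rule finite_subset[of _ "V \<times> V"]) (use adj_V finV in \<open>auto simp: claims_def two_nbrs_def\<close>)

lemma pay_nonneg: "adj x a \<Longrightarrow> 0 \<le> edge_pay x a" "0 \<le> face_pay x a f" "0 \<le> donor_pay x a f" "0 \<le> nbr_pay x a"
  using sides_le2[of x a] unfolding edge_pay_def face_pay_def donor_pay_def nbr_pay_def by auto

text \<open>An edge on no cycle has at most one side, which covers its 1/2. No edge pays twice,
  since exactly one end of a claiming edge has degree 2.\<close>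

lemma sum_edge_pay: "(\<Sum>(x, a)\<in>claims. edge_pay x a) \<le> (\<Sum>e\<in>edges. 2 - real (sides e))"
proof -
  have le: "edge_pay x a \<le> 2 - real (sides {x, a})" if "adj x a" for x a
  proof (cases "cy {x, a}")
    case True
    then show ?thesis using sides_le2[OF that] unfolding edge_pay_def by simp
  next
    case False
    have "sides {x, a} \<le> 1" unfolding sides_def using B_one[OF _ False] that by simp
    then show ?thesis using False unfolding edge_pay_def by simp
  qed
  have inj: "inj_on (\<lambda>(x, a). {x, a}) claims"
  proof (rule inj_onI, clarify)
    fix x a x' a' assume h: "(x, a) \<in> claims" "(x', a') \<in> claims" "{x, a} = {x', a'}"
    then have "deg x \<noteq> 2" "deg a = 2" "deg x' \<noteq> 2" "deg a' = 2"
      using bad_deg[of x] bad_deg[of x'] unfolding claims_def two_nbrs_def by auto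
    then show "x = x' \<and> a = a'" using h(3) by (auto simp: doubleton_eq_iff)
  qed
  have "(\<Sum>(x, a)\<in>claims. edge_pay x a) \<le> (\<Sum>(x, a)\<in>claims. 2 - real (sides {x, a}))"
    by (rule sum_mono) (use le in \<open>auto simp: claims_def two_nbrs_def\<close>)
  also have "\<dots> = (\<Sum>e\<in>(\<lambda>(x, a). {x, a}) ` claims. 2 - real (sides e))"
    by (subst sum.reindex[OF inj]) (simp add: case_prod_beta)
  also have "\<dots> \<le> (\<Sum>e\<in>edges. 2 - real (sides e))"
  proof (rule sum_mono2)
    show "(\<lambda>(x, a). {x, a}) ` claims \<subseteq> edges" by (auto simp: claims_def two_nbrs_def)
    fix e assume "e \<in> edges - (\<lambda>(x, a). {x, a}) ` claims"
    then show "0 \<le> 2 - real (sides e)" using B_two[of e] unfolding sides_def by simp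
  qed simp
  finally show ?thesis .
qed

text \<open>2-vertices are pairwise non-adjacent and those that are paid for use two border edges
  each. So a face of length l has at most l/2 of them and pays at most l/8, which is at most l - 6
  from l = 7 on.\<close>

lemma sum_face_pay:
  assumes f: "f \<in> F"
  shows "(\<Sum>(x, a)\<in>claims. face_pay x a f) \<le> real (card (B f)) - 6"
proof (cases "7 \<le> card (B f)")
  case False
  then have "(\<Sum>(x, a)\<in>claims. face_pay x a f) = 0" unfolding face_pay_def by (intro sum.neutral) auto
  then show ?thesis using B_six[OF f] by simp
next
  case seven: True
  define A where "A = {a \<in> V. deg a = 2 \<and> 2 \<le> card {e \<in> B f. a \<in> e}}"
  define v where "v x a = (if bad x then if bad (other_end x a) then 1/8 else 1/4 else (0::real))" for x a
  define Cf where "Cf = {(x, a) \<in> claims. cy {x, a} \<and> {x, a} \<in> B f}"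
  have finA: "finite A" unfolding A_def using finV by simp
  have CfA: "a \<in> A \<and> x \<in> N a" if "(x, a) \<in> Cf" for x a
  proof -
    have xa: "a \<in> two_nbrs x" "cy {x, a}" "{x, a} \<in> B f" using that unfolding Cf_def claims_def by auto
    obtain w where w: "N a = {x, w}" "w \<noteq> x" "adj a w" "adj x a" "deg a = 2" using two_nbrsE[OF xa(1)] .
    have "{a, w} \<in> B f" using B_thread[OF w(1) _ xa(2) f xa(3)] w(2) by simp
    then have "{{x, a}, {a, w}} \<subseteq> {e \<in> B f. a \<in> e}" using xa by simp
    then have "card {{x, a}, {a, w}} \<le> card {e \<in> B f. a \<in> e}" using fin_B[OF f] by (intro card_mono) auto
    moreover have "{x, a} \<noteq> {a, w}" using w(2) by (auto simp: doubleton_eq_iff)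
    ultimately show ?thesis using w adj_V adj_sym unfolding A_def by auto
  qed
  have "(\<Sum>(x, a)\<in>claims. face_pay x a f) = (\<Sum>(x, a)\<in>Cf. v x a)"
    by (rule sum.mono_neutral_cong_right) (use fin_claims seven in \<open>auto simp: Cf_def claims_def face_pay_def v_def split: if_splits\<close>)
  also have "\<dots> = (\<Sum>(a, x)\<in>prod.swap ` Cf. v x a)"
    by (subst sum.reindex) (auto simp: inj_on_def case_prod_beta)
  also have "\<dots> \<le> (\<Sum>(a, x)\<in>Sigma A N. v x a)"
    by (rule sum_mono2) (use finA CfA in \<open>auto simp: v_def\<close>)
  also have "\<dots> = (\<Sum>a\<in>A. \<Sum>x\<in>N a. v x a)" using finA by (subst sum.Sigma) auto
  also have "\<dots> \<le> (\<Sum>a\<in>A. 1/4)"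
  proof (rule sum_mono)
    fix a assume "a \<in> A"
    then have "card (N a) = 2" unfolding A_def deg_def by simp
    then obtain p q where pq: "N a = {p, q}" "p \<noteq> q" by (auto simp: card_2_iff)
    have "other_end p a = q" "other_end q a = p" using other_end_eq[of a p q] other_end_eq[of a q p] pq by (auto simp: insert_commute)
    then show "(\<Sum>x\<in>N a. v x a) \<le> 1/4" unfolding pq(1) using pq(2) by (simp add: v_def)
  qed
  also have "\<dots> = real (card A) / 4" by simp
  finally have 1: "(\<Sum>(x, a)\<in>claims. face_pay x a f) \<le> real (card A) / 4" .
  have "(\<Sum>a\<in>A. 2) \<le> (\<Sum>a\<in>A. card {e \<in> B f. a \<in> e})" by (rule sum_mono) (auto simp: A_def)
  also have "\<dots> = card (\<Union>a\<in>A. {e \<in> B f. a \<in> e})"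
  proof (rule card_UN_disjoint[symmetric, OF finA])
    show "\<forall>a\<in>A. finite {e \<in> B f. a \<in> e}" using fin_B[OF f] by simp
    show "\<forall>a\<in>A. \<forall>b\<in>A. a \<noteq> b \<longrightarrow> {e \<in> B f. a \<in> e} \<inter> {e \<in> B f. b \<in> e} = {}"
    proof (intro ballI impI, rule ccontr)
      fix a b assume ab: "a \<in> A" "b \<in> A" "a \<noteq> b" "{e \<in> B f. a \<in> e} \<inter> {e \<in> B f. b \<in> e} \<noteq> {}"
      then obtain e where e: "e \<in> B f" "a \<in> e" "b \<in> e" by blast
      then obtain w where "e = {a, w}" "adj a w" using edgeD B_sub[OF f] by blast
      then have "adj a b" using e ab by auto
      then show False using no_adj_2 ab unfolding A_def by blast
    qed
  qed
  also have "\<dots> \<le> card (B f)" using fin_B[OF f] by (intro card_mono) auto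
  finally have "2 * card A \<le> card (B f)" by simp
  then show ?thesis using 1 seven by linarith
qed

text \<open>On a given hexagon the pair \<open>t\<close>, \<open>w\<close> determines
  \<open>a\<close> and \<open>x\<close>, by walking on. As \<open>{t, w}\<close> has at most two
  sides, \<open>t\<close> pays at most twice 1/4 for each big neighbour.\<close>

lemma sum_donor_pay:
  "(\<Sum>(x, a)\<in>claims. \<Sum>f\<in>F. donor_pay x a f) \<le> (\<Sum>t\<in>V. if donor t then real (card (big_nbrs t)) / 2 else 0)"
proof -
  define hit where "hit x a f \<longleftrightarrow> (\<exists>t w. donates x a f t w)" for x a f
  have tp: "donor_pay x a f = (if hit x a f then 1/4 else 0)" for x a f unfolding donor_pay_def hit_def ..
  define TC where "TC = {(xa, f) \<in> claims \<times> F. hit (fst xa) (snd xa) f}"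
  define Tc where "Tc = {t \<in> V. donor t}"
  define TW where "TW = Sigma Tc (\<lambda>t. Sigma (big_nbrs t) (\<lambda>w. {f \<in> F. {t, w} \<in> B f}))"
  have finT: "finite Tc" unfolding Tc_def using finV by simp
  have finTW: "finite TW" unfolding TW_def using finT by (intro finite_SigmaI) auto
  have "(\<Sum>(x, a)\<in>claims. \<Sum>f\<in>F. donor_pay x a f) = (\<Sum>(xa, f)\<in>claims \<times> F. donor_pay (fst xa) (snd xa) f)"
    unfolding case_prod_beta by (subst sum.cartesian_product) (simp add: case_prod_beta)
  also have "\<dots> = (\<Sum>(xa, f)\<in>TC. 1/4)"
    by (rule sum.mono_neutral_cong_right) (use fin_claims finF in \<open>auto simp: TC_def tp split: if_splits\<close>)
  also have "\<dots> = real (card TC) / 4" by (simp add: case_prod_beta)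
  finally have 1: "(\<Sum>(x, a)\<in>claims. \<Sum>f\<in>F. donor_pay x a f) = real (card TC) / 4" .
  have "card TC \<le> card TW"
  proof (rule card_le_if_inj_on_rel[where r = "\<lambda>(xa, f) (t, w, f'). f = f' \<and> donates (fst xa) (snd xa) f t w", OF finTW])
    fix p assume p: "p \<in> TC"
    obtain x a f where pp: "p = ((x, a), f)" by (metis prod.collapse)
    obtain t w where tw: "donates x a f t w" and fF: "f \<in> F" using p unfolding pp TC_def hit_def by auto
    obtain w' a' where h: "hexa f x a w t w' a'" using tw unfolding donates_def by blast
    have "adj w t" using hexa_adj[OF fF h] by blast
    moreover have "{t, w} \<in> B f" using h unfolding hexagon_def by (auto simp: insert_commute)
    ultimately have "(t, w, f) \<in> TW"
      using tw fF adj_V adj_sym unfolding TW_def Tc_def big_nbrs_def donates_def by auto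
    then show "\<exists>b. b \<in> TW \<and> (\<lambda>(xa, f) (t, w, f'). f = f' \<and> donates (fst xa) (snd xa) f t w) p b"
      using tw unfolding pp by (intro exI[of _ "(t, w, f)"]) auto
  next
    fix p1 p2 b
    assume r: "(\<lambda>(xa, f) (t, w, f'). f = f' \<and> donates (fst xa) (snd xa) f t w) p1 b"
      "(\<lambda>(xa, f) (t, w, f'). f = f' \<and> donates (fst xa) (snd xa) f t w) p2 b"
    obtain t w f where b: "b = (t, w, f)" by (metis prod.collapse)
    obtain x1 a1 f1 where p1: "p1 = ((x1, a1), f1)" by (metis prod.collapse)
    obtain x2 a2 f2 where p2: "p2 = ((x2, a2), f2)" by (metis prod.collapse)
    have f12: "f1 = f" "f2 = f" "donates x1 a1 f t w" "donates x2 a2 f t w" using r unfolding b p1 p2 by auto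
    obtain w1 a1' w2 a2' where h: "hexa f x1 a1 w t w1 a1'" "hexa f x2 a2 w t w2 a2'"
      using f12 unfolding donates_def by blast
    have h1: "hexa f w t w1 a1' x1 a1" "hexa f a1 w t w1 a1' x1" using hexagon_rot[OF hexagon_rot[OF h(1)]] hexagon_rot[OF h(1)] .
    have h2: "hexa f w t w2 a2' x2 a2" "hexa f a2 w t w2 a2' x2" using hexagon_rot[OF hexagon_rot[OF h(2)]] hexagon_rot[OF h(2)] .
    have "{w, a2} \<in> B f" using hexagon_at[OF h2(1)] by simp
    then have "a2 = t \<or> a2 = a1" using hexagon_at[OF h1(1)] by simp
    then have a: "a2 = a1" using h(2) unfolding hexagon_def by auto
    have "{a1, x2} \<in> B f" using hexagon_at[OF h2(2)] a by simp
    then have "x2 = w \<or> x2 = x1" using hexagon_at[OF h1(2)] by simp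
    then have "x2 = x1" using h(2) unfolding hexagon_def by auto
    then show "p1 = p2" using p1 p2 f12 a by simp
  qed
  also have "card TW = (\<Sum>t\<in>Tc. \<Sum>w\<in>big_nbrs t. sides {t, w})"
    unfolding TW_def sides_def using finT by (subst card_SigmaI) (auto intro!: sum.cong card_SigmaI finite_SigmaI)
  also have "\<dots> \<le> (\<Sum>t\<in>Tc. \<Sum>w\<in>big_nbrs t. 2)"
    by (intro sum_mono sides_le2) (auto simp: big_nbrs_def)
  finally have "real (card TC) \<le> real (\<Sum>t\<in>Tc. \<Sum>w\<in>big_nbrs t. 2)" by (rule of_nat_mono)
  then have "real (card TC) / 4 \<le> (\<Sum>t\<in>Tc. real (card (big_nbrs t)) / 2)"
    by (simp add: sum_divide_distrib[symmetric] sum_distrib_right[symmetric])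
  also have "\<dots> = (\<Sum>t\<in>V. if donor t then real (card (big_nbrs t)) / 2 else 0)"
    unfolding Tc_def by (rule sum.mono_neutral_cong_left) (use finV in auto)
  finally show ?thesis unfolding 1 .
qed

text \<open>At most three poor neighbours get 1/4 each: the 3/4 set aside in
  \<open>charge_bound\<close>.\<close>

lemma sum_nbr_pay:
  "(\<Sum>(x, a)\<in>claims. nbr_pay x a) \<le> (\<Sum>y\<in>V. if deg y = 5 \<and> card (poor_nbrs y) \<le> 3 then 3/4 else 0)"
proof -
  define Y where "Y = {y \<in> V. deg y = 5 \<and> card (poor_nbrs y) \<le> 3}"
  define HC where "HC = {(x, a) \<in> claims. other_end x a \<in> Y}"
  have finY: "finite Y" unfolding Y_def using finV by simp
  have othV: "other_end x a \<in> V" if "(x, a) \<in> claims" for x a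
  proof -
    have "a \<in> two_nbrs x" using that unfolding claims_def by auto
    then obtain w where "other_end x a = w" "adj a w" by (rule two_nbrsE)
    then show ?thesis using adj_V by blast
  qed
  have "(\<Sum>(x, a)\<in>claims. nbr_pay x a) = (\<Sum>(x, a)\<in>HC. 1/4)"
    by (rule sum.mono_neutral_cong_right) (use fin_claims othV in \<open>auto simp: HC_def Y_def nbr_pay_def split: if_splits\<close>)
  also have "\<dots> = real (card HC) / 4" by (simp add: case_prod_beta)
  finally have 1: "(\<Sum>(x, a)\<in>claims. nbr_pay x a) = real (card HC) / 4" .
  have "card HC \<le> card (Sigma Y poor_nbrs)"
  proof (rule card_le_if_inj_on_rel[where r = "\<lambda>(x, a) (y, b). a = b \<and> x \<noteq> y \<and> N a = {x, y}"])
    show "finite (Sigma Y poor_nbrs)" using finY by auto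
    fix p assume p: "p \<in> HC"
    obtain x a where pp: "p = (x, a)" by (metis prod.collapse)
    have xa: "a \<in> two_nbrs x" "other_end x a \<in> Y" using p unfolding pp HC_def claims_def by auto
    obtain w where w: "N a = {x, w}" "w \<noteq> x" "other_end x a = w" "adj a w" "deg a = 2" using two_nbrsE[OF xa(1)] .
    then have "(w, a) \<in> Sigma Y poor_nbrs" using xa adj_sym unfolding poor_nbrs_def by auto
    then show "\<exists>b. b \<in> Sigma Y poor_nbrs \<and> (\<lambda>(x, a) (y, b). a = b \<and> x \<noteq> y \<and> N a = {x, y}) p b"
      using w unfolding pp by (intro exI[of _ "(w, a)"]) auto
  qed (auto simp: doubleton_eq_iff)
  also have "card (Sigma Y poor_nbrs) = (\<Sum>y\<in>Y. card (poor_nbrs y))" using finY by (intro card_SigmaI) auto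
  also have "\<dots> \<le> (\<Sum>y\<in>Y. 3)" by (rule sum_mono) (auto simp: Y_def)
  finally have "real (card HC) \<le> 3 * real (card Y)" by simp
  then have "real (card HC) / 4 \<le> (\<Sum>y\<in>Y. 3/4)" by simp
  also have "\<dots> = (\<Sum>y\<in>V. if deg y = 5 \<and> card (poor_nbrs y) \<le> 3 then 3/4 else 0)"
    unfolding Y_def by (rule sum.mono_neutral_cong_left) (use finV in auto)
  finally show ?thesis unfolding 1 .
qed

section \<open>What deficient vertices gain\<close>

lemma gained_ge:
  assumes "adj x a" "S \<subseteq> F"
  shows "edge_pay x a + (\<Sum>f\<in>S. face_pay x a f + donor_pay x a f) + nbr_pay x a \<le> gained x a"
proof -
  have "(\<Sum>f\<in>S. face_pay x a f + donor_pay x a f) \<le> (\<Sum>f\<in>F. face_pay x a f + donor_pay x a f)"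
    by (rule sum_mono2) (use finF assms(2) pay_nonneg(2,3) in \<open>auto intro!: add_nonneg_nonneg\<close>)
  then show ?thesis unfolding gained_def by simp
qed

lemma gained_nonneg: "adj x a \<Longrightarrow> 0 \<le> gained x a"
  using gained_ge[of x a "{}"] pay_nonneg(1)[of x a] pay_nonneg(4)[of x a] by simp

lemma gained_face:
  assumes "adj x a" "f \<in> F"
  shows "face_pay x a f \<le> gained x a" "donor_pay x a f \<le> gained x a" "nbr_pay x a \<le> gained x a" "edge_pay x a \<le> gained x a"
  using gained_ge[OF assms(1), of "{f}"] pay_nonneg(1)[OF assms(1)] pay_nonneg(2,3)[of x a f]
    pay_nonneg(4)[of x a] assms(2) by simp_all

text \<open>Here \<open>z\<close> is the exceptional neighbour of \<open>x\<close>. A hexagon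
  between \<open>a\<close> and \<open>z\<close> has no second 2-neighbour next to \<open>x\<close>,
  so the recolouring arguments do not apply and this side is written off.\<close>

definition shared_hexagons :: "'a \<Rightarrow> 'a \<Rightarrow> 'a \<Rightarrow> 'f set" where
  "shared_hexagons x z a = {f \<in> F. {x, a} \<in> B f \<and> card (B f) = 6 \<and> {x, z} \<in> B f}"

text \<open>A hexagon through \<open>{x, z}\<close> has only one other edge at \<open>x\<close>, so
  it counts for one \<open>a\<close>; and \<open>{x, z}\<close> has at most two sides.\<close>

lemma sum_shared_hexagons:
  assumes A: "A \<subseteq> N x" "z \<notin> A" and z: "adj x z"
  shows "(\<Sum>a\<in>A. card (shared_hexagons x z a)) \<le> 2"
proof -
  have finA: "finite A" using A(1) by (rule finite_subset) simp
  have "(\<Sum>a\<in>A. card (shared_hexagons x z a)) = card (\<Union>a\<in>A. shared_hexagons x z a)"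
  proof (rule card_UN_disjoint[symmetric, OF finA])
    show "\<forall>a\<in>A. finite (shared_hexagons x z a)" unfolding shared_hexagons_def by simp
    show "\<forall>a\<in>A. \<forall>b\<in>A. a \<noteq> b \<longrightarrow> shared_hexagons x z a \<inter> shared_hexagons x z b = {}"
    proof (intro ballI impI, rule ccontr)
      fix a b assume ab: "a \<in> A" "b \<in> A" "a \<noteq> b" "shared_hexagons x z a \<inter> shared_hexagons x z b \<noteq> {}"
      then obtain f where "f \<in> shared_hexagons x z a" "f \<in> shared_hexagons x z b" by blast
      then have f: "f \<in> F" "card (B f) = 6" "{x, a} \<in> B f" "{x, b} \<in> B f" "{x, z} \<in> B f"
        unfolding shared_hexagons_def by simp_all
      obtain p q r s where h: "hexa f x z p q r s" using hexa_from[OF f(1,2,5)] .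
      have "a = z \<or> a = s" using f(3) unfolding hexagon_at[OF h] .
      moreover have "b = z \<or> b = s" using f(4) unfolding hexagon_at[OF h] .
      moreover have "a \<noteq> z" using ab(1) A(2) by blast
      moreover have "b \<noteq> z" using ab(2) A(2) by blast
      ultimately show False using ab(3) by simp
    qed
  qed
  also have "\<dots> \<le> card {f \<in> F. {x, z} \<in> B f}" by (rule card_mono) (auto simp: shared_hexagons_def)
  also have "\<dots> \<le> 2" using B_two z by simp
  finally show ?thesis .
qed

text \<open>Each side of \<open>{x, a}\<close> outside the shared hexagons brings 1/4: a missing
  side through the edge, a long face undivided, as \<open>w\<close> has degree \<open>D\<close> and
  is not deficient, and any other hexagon through its opposite vertex, a donor.\<close>

lemma bad4_side:
  assumes x: "bad4 x" and z: "N x = insert z (two_nbrs x)" "z \<notin> two_nbrs x" and a: "a \<in> two_nbrs x"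
  shows "(2 - real (card (shared_hexagons x z a))) / 4 \<le> gained x a"
proof -
  have x4: "deg x = 4" "card (two_nbrs x) = 3" "big_nbrs x = {}" using x unfolding bad4_def by auto
  have A2: "\<forall>a\<in>two_nbrs x. deg a = 2" unfolding two_nbrs_def by simp
  have xz: "adj x z" using z(1) by (metis N_iff insertI1)
  have z5: "deg z \<le> 5" using x4(3) xz unfolding big_nbrs_def by fastforce
  obtain w where w: "N a = {x, w}" "w \<noteq> x" "other_end x a = w" "adj a w" "adj x a" "deg a = 2" using two_nbrsE[OF a] .
  note fv = four_vertex[OF x4(1,2) A2 z]
  have dw: "deg w = D" using fv(2)[OF z5 a w(1)] .
  have nbw: "\<not> bad w" using bad_deg[of w] dw D_ge6 by auto
  show ?thesis
  proof (cases "cy {x, a}")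
    case False
    then have "edge_pay x a = 1/2" unfolding edge_pay_def by simp
    moreover have "edge_pay x a \<le> gained x a" using gained_ge[OF w(5), of "{}"] pay_nonneg(4)[of x a] by simp
    ultimately show ?thesis by simp
  next
    case cy: True
    define Fa where "Fa = {f \<in> F. {x, a} \<in> B f}"
    have ZFa: "shared_hexagons x z a \<subseteq> Fa" unfolding shared_hexagons_def Fa_def by auto
    have finFa: "finite Fa" unfolding Fa_def by simp
    have each: "1/4 \<le> face_pay x a f + donor_pay x a f" if f: "f \<in> Fa - shared_hexagons x z a" for f
    proof -
      have fF: "f \<in> F" "{x, a} \<in> B f" using f unfolding Fa_def by auto
      show ?thesis
      proof (cases "7 \<le> card (B f)")
        case True
        then have "face_pay x a f = 1/4" using cy fF nbw w(3) unfolding face_pay_def by simp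
        then show ?thesis using pay_nonneg(2,3)[of x a f] by simp
      next
        case False
        then have c6: "card (B f) = 6" using B_six[OF fF(1)] by simp
        obtain b c d g where h: "hexa f x a b c d g" using hexa_from[OF fF(1) c6 fF(2)] .
        note ha = hexa_adj[OF fF(1) h]
        have dist: "distinct [x, a, b, c, d, g]" using h unfolding hexagon_def by simp
        have "b \<in> N a" using ha by simp
        then have bw: "b = w" using w(1) dist by auto
        have "{x, g} \<in> B f" using hexagon_at[OF h] by simp
        then have "g \<noteq> z" using f c6 fF unfolding shared_hexagons_def by auto
        moreover have "g \<in> N x" using ha adj_sym by simp
        ultimately have g: "g \<in> two_nbrs x" using z by auto
        obtain w' where w': "N g = {x, w'}" "w' \<noteq> x" "other_end x g = w'" "adj g w'" "adj x g" "deg g = 2" using two_nbrsE[OF g] .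
        have "d \<in> N g" using ha adj_sym by simp
        then have dw': "d = w'" using w'(1) dist by auto
        have dw2: "deg w' = D" using fv(2)[OF z5 g w'(1)] .
        have cw: "adj c w" "adj c w'" using ha bw dw' adj_sym by blast+
        have ne: "w \<noteq> w'" using dist bw dw' by auto
        \<comment> \<open>A 2-vertex in this position is the vertex \<open>t\<close> excluded by
          \<open>four_vertex\<close>.\<close>
        have "deg c \<noteq> 2"
        proof
          assume c2: "deg c = 2"
          obtain q where "N c = {w, q}" using deg2E[OF c2 cw(1)] by blast
          moreover have "w' \<in> N c" using cw by simp
          ultimately have "N c = {w, w'}" using ne by auto
          then show False using fv(3)[OF z5 a g _ w(1) w'(1)] dist by auto
        qed
        then have "3 \<le> deg c" using deg_ge2[of c] cw adj_V by force
        then have "donor c" unfolding donor_def using ne cw dw dw2 D_ge6 by force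
        then have "donates x a f c w" unfolding donates_def using h bw dw D_ge6 by auto
        then have "donor_pay x a f = 1/4" unfolding donor_pay_def by auto
        then show ?thesis using pay_nonneg(2,3)[of x a f] by simp
      qed
    qed
    have "real (card (Fa - shared_hexagons x z a)) / 4 = (\<Sum>f\<in>Fa - shared_hexagons x z a. 1/4)" by simp
    also have "\<dots> \<le> (\<Sum>f\<in>Fa - shared_hexagons x z a. face_pay x a f + donor_pay x a f)" by (rule sum_mono[OF each])
    finally have s: "real (card (Fa - shared_hexagons x z a)) / 4 \<le> (\<Sum>f\<in>Fa - shared_hexagons x z a. face_pay x a f + donor_pay x a f)" .
    have "card (Fa - shared_hexagons x z a) = card Fa - card (shared_hexagons x z a)" "card (shared_hexagons x z a) \<le> card Fa"
      using card_Diff_subset[OF finite_subset[OF ZFa finFa] ZFa] card_mono[OF finFa ZFa] by auto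
    then have cd: "real (card (Fa - shared_hexagons x z a)) = real (card Fa) - real (card (shared_hexagons x z a))" by (simp add: of_nat_diff)
    have ep: "edge_pay x a = (2 - real (card Fa)) / 4" using cy unfolding edge_pay_def sides_def Fa_def by simp
    have "edge_pay x a + (\<Sum>f\<in>Fa - shared_hexagons x z a. face_pay x a f + donor_pay x a f) + nbr_pay x a \<le> gained x a"
      by (rule gained_ge[OF w(5)]) (auto simp: Fa_def)
    then show ?thesis using s cd ep pay_nonneg(4)[of x a] by (simp add: field_simps)
  qed
qed

text \<open>The three 2-neighbours have six sides, at most two of which are lost; four quarters
  remain.\<close>

lemma bad4_need:
  assumes x: "bad4 x"
  shows "need x \<le> (\<Sum>a\<in>two_nbrs x. gained x a)"
proof -
  have x4: "deg x = 4" "card (two_nbrs x) = 3" using x unfolding bad4_def by auto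
  obtain z where z: "N x = insert z (two_nbrs x)" "z \<notin> two_nbrs x" "adj x z"
    by (rule four_three_two_nbrs[OF x4(1)]) (use x4 in auto)
  have "real (\<Sum>a\<in>two_nbrs x. card (shared_hexagons x z a)) \<le> real 2"
    by (rule of_nat_mono, rule sum_shared_hexagons) (use sets_sub z in auto)
  then have "(6 - 2) / 4 \<le> (6 - (\<Sum>a\<in>two_nbrs x. real (card (shared_hexagons x z a)))) / 4" by simp
  also have "\<dots> = (\<Sum>a\<in>two_nbrs x. (2 - real (card (shared_hexagons x z a))) / 4)"
    using x4 by (simp add: sum_divide_distrib[symmetric] sum_subtractf)
  also have "\<dots> \<le> (\<Sum>a\<in>two_nbrs x. gained x a)" by (rule sum_mono) (rule bad4_side[OF x z(1,2)])
  finally show ?thesis using x unfolding need_def by simp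
qed

lemma full_hexa:
  assumes y: "full y" and f: "f \<in> F" "card (B f) = 6" "{y, a} \<in> B f"
    and a: "N a = {y, w}" "w \<noteq> y"
    and two: "\<And>u. {y, u} \<in> B f \<Longrightarrow> deg u = 2"
  obtains t w' a' where "hexa f y a w t w' a'" "adj y a'" "N a' = {y, w'}" "w' \<noteq> y" "a' \<noteq> a"
    "adj t w" "adj t w'" "w \<noteq> w'" "5 \<le> deg w'" "t \<noteq> y"
proof -
  obtain b c d g where h: "hexa f y a b c d g" using hexa_from[OF f] .
  note ha = hexa_adj[OF f(1) h]
  have dist: "distinct [y, a, b, c, d, g]" using h unfolding hexagon_def by simp
  have "b \<in> N a" using ha by simp
  then have bw: "b = w" using a(1) dist by auto
  have yg: "adj y g" using ha adj_sym by blast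
  have "{y, g} \<in> B f" using hexagon_at[OF h] by simp
  then have g2: "deg g = 2" using two by blast
  obtain w' where w': "w' \<noteq> y" "N g = {y, w'}" using deg2E[OF g2 adj_sym[OF yg]] by blast
  have "d \<in> N g" using ha adj_sym by simp
  then have dw: "d = w'" using w' dist by auto
  have "5 \<le> deg w'" using full_outer_deg[OF y yg w'(2,1)] D_ge6 by simp
  moreover have "adj c w" "adj c w'" using ha bw dw adj_sym by blast+
  moreover have "hexa f y a w c w' g" using h bw dw by simp
  moreover have "g \<noteq> a" "w \<noteq> w'" "c \<noteq> y" using dist bw dw by auto
  ultimately show ?thesis using that[of c w' g] yg w' by blast
qed

text \<open>Beyond \<open>a\<close> the degree of \<open>w\<close> is at least 5. If it is at least
  6, a long face pays, or one of the two opposite vertices has degree at least 3 and is a donor. If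
  it is 5, two long faces pay 1/8 each even when \<open>w\<close> is deficient; a hexagon shows that
  \<open>w\<close> is not full, and then a long face pays 1/4 or \<open>w\<close> itself
  does.\<close>

lemma bad5_side:
  assumes y: "bad5 y" and a: "a \<in> two_nbrs y"
    and two: "\<And>f u. f \<in> F \<Longrightarrow> {y, a} \<in> B f \<Longrightarrow> card (B f) = 6 \<Longrightarrow> {y, u} \<in> B f \<Longrightarrow> deg u = 2"
  shows "1/4 \<le> gained y a"
proof -
  have fy: "full y" and y5: "deg y = 5" using y unfolding bad5_def full_def by auto
  obtain w where w: "N a = {y, w}" "w \<noteq> y" "other_end y a = w" "adj a w" "adj y a" "deg a = 2" using two_nbrsE[OF a] .
  have w5: "5 \<le> deg w" using full_outer_deg[OF fy w(5,1,2)] D_ge6 by simp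
  have ep: "edge_pay y a \<le> gained y a" using gained_ge[OF w(5), of "{}"] pay_nonneg(4)[of y a] by simp
  define Fa where "Fa = {f \<in> F. {y, a} \<in> B f}"
  have bnFa: "sides {y, a} = card Fa" unfolding sides_def Fa_def ..
  consider "\<not> cy {y, a}" | "cy {y, a}" "card Fa \<le> 1" | "cy {y, a}" "card Fa = 2"
    using sides_le2[OF w(5)] bnFa by linarith
  then show ?thesis
  proof cases
    case 1
    then show ?thesis using ep unfolding edge_pay_def by simp
  next
    case 2
    then have "1/4 \<le> edge_pay y a" unfolding edge_pay_def bnFa by simp
    then show ?thesis using ep by simp
  next
    case 3
    note cy = 3(1)
    obtain f1 f2 where ff: "Fa = {f1, f2}" "f1 \<noteq> f2" using 3(2) by (auto simp: card_2_iff)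
    have f1: "f1 \<in> F" "{y, a} \<in> B f1" and f2: "f2 \<in> F" "{y, a} \<in> B f2" using ff(1) unfolding Fa_def by auto
    have seven: "face_pay y a f = (if bad w then 1/8 else 1/4)" if "7 \<le> card (B f)" "f \<in> Fa" for f
      using that cy w(3) unfolding face_pay_def Fa_def by simp
    note sf = gained_face[OF w(5)]
    have six: "card (B f) = 6" if "f \<in> F" "\<not> 7 \<le> card (B f)" for f using B_six[OF that(1)] that(2) by simp
    \<comment> \<open>Two hexagons with two common edges at \<open>y\<close> would make
      \<open>y\<close> a 2-vertex.\<close>
    have share_y: False if "card (B f1) = 6" "card (B f2) = 6" "{y, a'} \<in> B f1" "{y, a'} \<in> B f2" "a' \<noteq> a" for a'
    proof -
      have "{a, y} \<in> B f1" "{a, y} \<in> B f2" using f1 f2 by (simp_all add: insert_commute)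
      then have "N y = {a, a'}" using B_shared[OF f1(1) f2(1) ff(2) that(1,2), of a a' y] that by auto
      then show False using y5 unfolding deg_def by (auto simp: card_insert_if split: if_splits)
    qed
    show ?thesis
    proof (cases "6 \<le> deg w")
      case w6: True
      have nb: "\<not> bad w" using bad_deg[of w] w6 by auto
      have tpay_t: "1/4 \<le> gained y a"
        if f: "f \<in> F" and h: "hexa f y a w t w' a'" and g: "adj y a'" "N a' = {y, w'}" "w' \<noteq> y" "a' \<noteq> a"
          "adj t w" "adj t w'" "w \<noteq> w'" "5 \<le> deg w'" and t2: "deg t \<noteq> 2" for f t w' a'
      proof -
        have "3 \<le> deg t" using deg_ge2[of t] g(5) adj_V t2 by force
        moreover have "6 \<le> deg w'" if "deg t = 3 \<and> two_nbrs t \<noteq> {}"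
        proof (rule ccontr)
          assume "\<not> 6 \<le> deg w'"
          then have "deg w' \<le> 5" by simp
          moreover have "deg t = 2 \<or> deg t = 3 \<and> (\<exists>l. adj t l \<and> deg l = 2)" using that unfolding two_nbrs_def by auto
          ultimately show False using full_common_small[OF fy g(1-3) w(5,1,2) g(4) _ g(6,5)] by blast
        qed
        ultimately have "donor t" unfolding donor_def using g w6 by blast
        then have "donates y a f t w" unfolding donates_def using h w6 by auto
        then have "donor_pay y a f = 1/4" unfolding donor_pay_def by auto
        then show ?thesis using sf(2)[OF f] by simp
      qed
      show ?thesis
      proof (cases "7 \<le> card (B f1) \<or> 7 \<le> card (B f2)")
        case True
        then show ?thesis using seven[of f1] seven[of f2] ff nb sf(1)[OF f1(1)] sf(1)[OF f2(1)] by auto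
      next
        case False
        then have c6: "card (B f1) = 6" "card (B f2) = 6" using six[OF f1(1)] six[OF f2(1)] by blast+
        obtain t1 w1 a1 where h1: "hexa f1 y a w t1 w1 a1" and g1: "adj y a1" "N a1 = {y, w1}" "w1 \<noteq> y" "a1 \<noteq> a"
          "adj t1 w" "adj t1 w1" "w \<noteq> w1" "5 \<le> deg w1"
          by (rule full_hexa[OF fy f1(1) c6(1) f1(2) w(1,2) two[OF f1 c6(1)]])
        obtain t2 w2 a2 where h2: "hexa f2 y a w t2 w2 a2" and g2: "adj y a2" "N a2 = {y, w2}" "w2 \<noteq> y" "a2 \<noteq> a"
          "adj t2 w" "adj t2 w2" "w \<noteq> w2" "5 \<le> deg w2"
          by (rule full_hexa[OF fy f2(1) c6(2) f2(2) w(1,2) two[OF f2 c6(2)]])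
        show ?thesis
        proof (cases "deg t1 = 2 \<and> deg t2 = 2")
          case False
          then show ?thesis using tpay_t[OF f1(1) h1 g1] tpay_t[OF f2(1) h2 g2] by blast
        next
          case True
          have "N t = {w, w'}" if d: "deg t = 2" "adj t w" "adj t w'" "w \<noteq> w'" for t w'
          proof -
            obtain q where "N t = {w, q}" using deg2E[OF d(1,2)] by blast
            moreover have "w' \<in> N t" using d by simp
            ultimately show ?thesis using d(4) by auto
          qed
          then have Nt: "N t1 = {w, w1}" "N t2 = {w, w2}" using True g1 g2 by blast+
          have Nt1: "N t1 = {w1, w}" using Nt by (simp add: insert_commute)
          have "{y, a1} \<in> B f1" "{y, a2} \<in> B f2" using hexagon_at[OF h1] hexagon_at[OF h2] by simp_all
          then have "a1 \<noteq> a2" using share_y[OF c6, of a1] g1(4) by blast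
          \<comment> \<open>Here \<open>a\<close> is the middle one of three 2-neighbours:
            \<open>t1\<close> and \<open>t2\<close> both hang on \<open>w\<close>.\<close>
          then show ?thesis
            using full_two_common[OF fy g1(1-3) w(5,1,2) g2(1-3) g1(4) _ g2(4)[symmetric] Nt1 Nt(2)] by blast
        qed
      qed
    next
      case False
      then have dw5: "deg w = 5" using w5 by simp
      show ?thesis
      proof (cases "7 \<le> card (B f1) \<and> 7 \<le> card (B f2)")
        case True
        then have "1/8 \<le> face_pay y a f1" "1/8 \<le> face_pay y a f2" using seven[of f1] seven[of f2] ff by auto
        moreover have "edge_pay y a + (\<Sum>f\<in>{f1, f2}. face_pay y a f + donor_pay y a f) + nbr_pay y a \<le> gained y a"
          by (rule gained_ge[OF w(5)]) (use f1 f2 in auto)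
        ultimately show ?thesis using ff(2) pay_nonneg(2,3)[of y a f1] pay_nonneg(2,3)[of y a f2]
          pay_nonneg(4)[of y a] pay_nonneg(1)[OF w(5)] by simp
      next
        case F67: False
        \<comment> \<open>By \<open>full_common_small\<close> the opposite vertex is neither a
          2-vertex nor needy, so it has no claim on its neighbour \<open>w\<close>.\<close>
        have rich: "\<exists>t. adj w t \<and> t \<notin> poor_nbrs w \<and> {w, t} \<in> B f \<and> t \<noteq> a" if f: "f \<in> F" "{y, a} \<in> B f" "card (B f) = 6" for f
        proof -
          obtain t w' a' where h: "hexa f y a w t w' a'" and g: "adj y a'" "N a' = {y, w'}" "w' \<noteq> y" "a' \<noteq> a"
            "adj t w" "adj t w'" "w \<noteq> w'" "5 \<le> deg w'"
            by (rule full_hexa[OF fy f(1) f(3) f(2) w(1,2) two[OF f]])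
          have "\<not> (deg t = 2 \<or> deg t = 3 \<and> (\<exists>l. adj t l \<and> deg l = 2))"
            using full_common_small[OF fy w(5,1,2) g(1-3) g(4)[symmetric] _ g(5,6)] dw5 by auto
          then have "t \<notin> poor_nbrs w" unfolding poor_nbrs_def needy_def by auto
          moreover have "{w, t} \<in> B f" "t \<noteq> a" using h unfolding hexagon_def by auto
          ultimately show ?thesis using g(5) adj_sym by blast
        qed
        have "\<exists>f\<in>{f1, f2}. card (B f) = 6" using F67 six f1 f2 by auto
        then obtain t where t: "adj w t" "t \<notin> poor_nbrs w" using rich f1 f2 by blast
        then have "\<not> full w" unfolding full_def poor_nbrs_def by auto
        then have nb: "\<not> bad w" unfolding bad_def bad4_def bad5_def using dw5 by simp
        show ?thesis
        proof (cases "7 \<le> card (B f1) \<or> 7 \<le> card (B f2)")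
          case True
          then show ?thesis using seven[of f1] seven[of f2] ff nb sf(1)[OF f1(1)] sf(1)[OF f2(1)] by auto
        next
          case False
          then have c6: "card (B f1) = 6" "card (B f2) = 6" using six[OF f1(1)] six[OF f2(1)] by blast+
          obtain t1 where t1: "adj w t1" "t1 \<notin> poor_nbrs w" "{w, t1} \<in> B f1" "t1 \<noteq> a" using rich[OF f1 c6(1)] by blast
          obtain t2 where t2: "adj w t2" "t2 \<notin> poor_nbrs w" "{w, t2} \<in> B f2" "t2 \<noteq> a" using rich[OF f2 c6(2)] by blast
          have aw: "{a, w} \<in> B f" if f: "f \<in> F" "{y, a} \<in> B f" "card (B f) = 6" for f
          proof -
            obtain t w' a' where "hexa f y a w t w' a'"
              by (rule full_hexa[OF fy f(1) f(3) f(2) w(1,2) two[OF f]])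
            then show ?thesis unfolding hexagon_def by auto
          qed
          have "t1 \<noteq> t2"
          proof
            assume e: "t1 = t2"
            have "N w = {a, t1}"
              by (rule B_shared[OF f1(1) f2(1) ff(2) c6 t1(4)[symmetric]]) (use aw f1 f2 c6 t1 t2 e in auto)
            then show False using dw5 unfolding deg_def by (auto simp: card_insert_if split: if_splits)
          qed
          then have "card (poor_nbrs w) + 2 \<le> 5"
            using card_disj_N[OF sets_sub(3), of "{t1, t2}" w] t1 t2 dw5 by auto
          then have "nbr_pay y a = 1/4" unfolding nbr_pay_def using w(3) dw5 by simp
          then show ?thesis using sf(3)[OF f1(1)] by simp
        qed
      qed
    qed
  qed
qed

text \<open>Five 2-neighbours bring 5/4 for a deficit of 1. With four of them the two sides of the
  edge to the fifth neighbour spoil at most two, and the others bring the 1/2 that is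
  needed.\<close>

lemma bad5_need:
  assumes y: "bad5 y"
  shows "need y \<le> (\<Sum>a\<in>two_nbrs y. gained y a)"
proof -
  have fy: "full y" and y5: "deg y = 5" and p4: "4 \<le> card (two_nbrs y)" using y unfolding bad5_def full_def by auto
  have n4: "\<not> bad4 y" using y5 unfolding bad4_def by simp
  have p5: "card (two_nbrs y) \<le> 5" using card_sub_N[OF sets_sub(1), of y] y5 by simp
  have adjt: "adj y a" if "a \<in> two_nbrs y" for a using that unfolding two_nbrs_def by simp
  have Badj: "adj y u" if "f \<in> F" "{y, u} \<in> B f" for f u using B_sub[OF that(1)] that(2) by auto
  consider "card (two_nbrs y) = 5" | "card (two_nbrs y) = 4" using p4 p5 by linarith
  then show ?thesis
  proof cases
    case 1
    then have "card (two_nbrs y) = card (N y)" using y5 unfolding deg_def by simp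
    then have "two_nbrs y = N y" by (rule card_subset_eq[OF fin_N sets_sub(1)])
    then have all2: "deg u = 2" if "adj y u" for u 
    proof -
      have "u \<in> two_nbrs y" unfolding \<open>two_nbrs y = N y\<close> using that by simp
      then show ?thesis by (simp add: two_nbrs_def)
    qed
    have "(\<Sum>a\<in>two_nbrs y. 1/4) \<le> (\<Sum>a\<in>two_nbrs y. gained y a)"
      by (rule sum_mono, rule bad5_side[OF y]) (use all2 Badj in auto)
    then show ?thesis using 1 n4 y unfolding need_def by simp
  next
    case 2
    have "card (N y - two_nbrs y) = 1" using 2 y5 card_Diff_subset[OF sets_fin(1) sets_sub(1), of y] unfolding deg_def by simp
    then obtain u where u: "N y - two_nbrs y = {u}" by (auto simp: card_1_singleton_iff)
    have "u \<in> N y - two_nbrs y" unfolding u by simp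
    then have uu: "adj y u" "u \<notin> two_nbrs y" by auto
    have side: "(1 - real (card (shared_hexagons y u a))) / 4 \<le> gained y a" if a: "a \<in> two_nbrs y" for a
    proof (cases "shared_hexagons y u a = {}")
      case True
      have "1/4 \<le> gained y a"
      proof (rule bad5_side[OF y a])
        fix f v assume f: "f \<in> F" "{y, a} \<in> B f" "card (B f) = 6" "{y, v} \<in> B f"
        then have "v \<noteq> u" using True unfolding shared_hexagons_def by blast
        moreover have "v \<in> N y" using Badj f by simp
        ultimately have "v \<in> two_nbrs y" using u by blast
        then show "deg v = 2" unfolding two_nbrs_def by simp
      qed
      then show ?thesis using True by simp
    next
      case False
      then have "1 \<le> card (shared_hexagons y u a)" by (simp add: shared_hexagons_def Suc_le_eq card_gt_0_iff)
      then have "(1 - real (card (shared_hexagons y u a))) / 4 \<le> 0" by simp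
      then show ?thesis using gained_nonneg[OF adjt[OF a]] by linarith
    qed
    have "real (\<Sum>a\<in>two_nbrs y. card (shared_hexagons y u a)) \<le> real 2"
      by (rule of_nat_mono, rule sum_shared_hexagons) (use sets_sub uu in auto)
    then have "(4 - 2) / 4 \<le> (4 - (\<Sum>a\<in>two_nbrs y. real (card (shared_hexagons y u a)))) / 4" by simp
    also have "\<dots> = (\<Sum>a\<in>two_nbrs y. (1 - real (card (shared_hexagons y u a))) / 4)"
      using 2 by (simp add: sum_divide_distrib[symmetric] sum_subtractf)
    also have "\<dots> \<le> (\<Sum>a\<in>two_nbrs y. gained y a)" by (rule sum_mono) (rule side)
    finally show ?thesis using 2 n4 y unfolding need_def by simp
  qed
qed

text \<open>All deficits are covered by payments that stay within the surpluses of vertices, edges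
  and faces, so the total charge is nonnegative, against the bound -12.\<close>

theorem discharged: False
proof -
  let ?c = "\<lambda>v. if donor v then real (card (big_nbrs v)) / 2 else 0"
  let ?h = "\<lambda>v. if deg v = 5 \<and> card (poor_nbrs v) \<le> 3 then 3/4 else (0::real)"
  have 1: "(\<Sum>v\<in>V. ?c v + ?h v) \<le> (\<Sum>v\<in>V. charge v + need v)" by (rule sum_mono) (rule charge_bound)
  define Bd where "Bd = {v \<in> V. bad v}"
  have finBd: "finite Bd" unfolding Bd_def using finV by simp
  have badV: "bad x \<Longrightarrow> a \<in> two_nbrs x \<Longrightarrow> x \<in> V" for x a using adj_V unfolding two_nbrs_def by auto
  have ClS: "claims = Sigma Bd two_nbrs" unfolding claims_def Bd_def using badV by auto
  have "(\<Sum>v\<in>V. need v) = (\<Sum>v\<in>Bd. need v)"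
    by (rule sum.mono_neutral_right) (use finV in \<open>auto simp: Bd_def bad_def need_def\<close>)
  also have "\<dots> \<le> (\<Sum>v\<in>Bd. \<Sum>a\<in>two_nbrs v. gained v a)"
    by (rule sum_mono) (use bad4_need bad5_need in \<open>auto simp: Bd_def bad_def\<close>)
  also have "\<dots> = (\<Sum>(x, a)\<in>claims. gained x a)" unfolding ClS using finBd by (intro sum.Sigma) auto
  also have "\<dots> = (\<Sum>(x, a)\<in>claims. edge_pay x a) + (\<Sum>(x, a)\<in>claims. \<Sum>f\<in>F. face_pay x a f) + (\<Sum>(x, a)\<in>claims. \<Sum>f\<in>F. donor_pay x a f) + (\<Sum>(x, a)\<in>claims. nbr_pay x a)"
    unfolding gained_def case_prod_beta by (simp add: sum.distrib)
  also have "(\<Sum>(x, a)\<in>claims. \<Sum>f\<in>F. face_pay x a f) = (\<Sum>f\<in>F. \<Sum>(x, a)\<in>claims. face_pay x a f)"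
    unfolding case_prod_beta by (rule sum.swap)
  finally have 2: "(\<Sum>v\<in>V. need v) \<le> (\<Sum>(x, a)\<in>claims. edge_pay x a) + (\<Sum>f\<in>F. \<Sum>(x, a)\<in>claims. face_pay x a f)
      + (\<Sum>(x, a)\<in>claims. \<Sum>f\<in>F. donor_pay x a f) + (\<Sum>(x, a)\<in>claims. nbr_pay x a)" .
  have 3: "(\<Sum>f\<in>F. \<Sum>(x, a)\<in>claims. face_pay x a f) \<le> (\<Sum>f\<in>F. real (card (B f)) - 6)"
    by (rule sum_mono) (rule sum_face_pay)
  have 4: "(\<Sum>v\<in>V. ?c v + ?h v) = (\<Sum>v\<in>V. ?c v) + (\<Sum>v\<in>V. ?h v)" by (rule sum.distrib)
  have 5: "(\<Sum>v\<in>V. charge v + need v) = (\<Sum>v\<in>V. charge v) + (\<Sum>v\<in>V. need v)" by (rule sum.distrib)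
  show False using 1 2 3 4 5 sum_edge_pay sum_donor_pay sum_nbr_pay total_charge by linarith
qed

end

section \<open>Plane graphs of girth 6\<close>

lemma rtrancl_distinct_path:
  assumes "(u, v) \<in> R\<^sup>*"
  shows "\<exists>vs. vs \<noteq> [] \<and> distinct vs \<and> hd vs = u \<and> last vs = v \<and> successively (\<lambda>p q. (p, q) \<in> R) vs"
  using assms
proof (induction rule: rtrancl_induct)
  case base
  show ?case by (rule exI[of _ "[u]"]) simp
next
  case (step y z)
  then obtain vs where vs: "vs \<noteq> []" "distinct vs" "hd vs = u" "last vs = y" "successively (\<lambda>p q. (p, q) \<in> R) vs"
    by blast
  show ?case
  proof (cases "z \<in> set vs")
    case True
    then obtain xs ys where s: "vs = xs @ z # ys" by (meson split_list)
    have "successively (\<lambda>p q. (p, q) \<in> R) (xs @ [z])"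
      using vs(5) unfolding s by (auto simp: successively_append_iff)
    moreover have "hd (xs @ [z]) = u" using vs(3) unfolding s by (cases xs) auto
    ultimately show ?thesis using vs(2) unfolding s by (intro exI[of _ "xs @ [z]"]) auto
  next
    case False
    then show ?thesis using vs step(2) by (intro exI[of _ "vs @ [z]"]) (auto simp: successively_append_iff)
  qed
qed

lemma length_ge6E:
  assumes "6 \<le> length vs"
  obtains a b c d e g r where "vs = a # b # c # d # e # g # r"
  using assms by (auto simp: Suc_le_length_iff numeral_eq_Suc)

lemma card_path_edges:
  assumes "distinct [a, b, c, d, e, g]"
  shows "card {{a, b}, {b, c}, {c, d}, {d, e}, {e, g}} = 5"
  using assms by (simp add: card_insert_if doubleton_eq_iff)

theorem no_plane_critical:
  assumes critical: "critical V adj D k" and draw: "drawing V (sgraph.edges adj) pos A"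
  shows False
proof -
  interpret C: critical V adj D k by fact
  interpret P: drawing V C.edges pos A by fact
  let ?E = "C.edges"
  have ne: "V \<noteq> {}" using C.noncol by auto
  \<comment> \<open>Minimum degree 2 gives at least as many edges as vertices, hence at least two
    faces in \<open>F\<close>; so every border contains a cycle.\<close>
  have "(\<Sum>v\<in>V. 2) \<le> (\<Sum>v\<in>V. C.deg v)" by (rule sum_mono) (rule C.deg_ge2)
  then have VE: "card V \<le> card ?E" using C.handshake by simp
  obtain F where F: "F \<subseteq> P.faces ?E" "finite F" "card ?E + 2 \<le> card V + card F"
    using P.exists_faces[OF order_refl ne] by blast
  have F2: "2 \<le> card F" using F VE by linarith
  have other: "\<exists>f'\<in>F. f' \<noteq> f" if "f \<in> F" for f
  proof (rule ccontr)
    assume "\<not> ?thesis"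
    then have "F \<subseteq> {f}" by blast
    then show False using F2 card_mono[of "{f}" F] by simp
  qed
  have Bsub: "P.border ?E f \<subseteq> ?E" for f unfolding P.border_def by blast
  have Bfin: "finite (P.border ?E f)" for f using Bsub C.fin_edges by (rule finite_subset)
  \<comment> \<open>A cycle in the border consists of \<open>\<epsilon>\<close> and a simple path
    between its ends, which by the girth has at least six vertices. Five path edges and
    \<open>\<epsilon>\<close> make six; a longer path would give a seventh edge, so a border of six
    edges is exactly this cycle.\<close>
  have six: "6 \<le> card (P.border ?E f) \<and>
      (card (P.border ?E f) = 6 \<longrightarrow> (\<exists>a b c d e g. hexagon (P.border ?E f) a b c d e g))" if f: "f \<in> F" for f
  proof -
    define X where "X = P.border ?E f"
    obtain f' where f': "f' \<in> F" "f' \<noteq> f" using other[OF f] by blast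
    obtain \<epsilon> where \<epsilon>: "\<epsilon> \<in> X" "P.cyc X \<epsilon>"
      using P.border_has_cycle[OF order_refl, of f f'] f f' F(1) unfolding X_def by blast
    obtain u v where uv: "\<epsilon> = {u, v}" "(u, v) \<in> P.reach (X - {\<epsilon>})" using \<epsilon>(2) unfolding P.cyc_def by blast
    have adjuv: "adj u v" using \<epsilon>(1) uv(1) Bsub unfolding X_def by (metis C.edge_iff subsetD)
    have uvn: "u \<noteq> v" using adjuv C.adj_irr by auto
    obtain vs where vs: "vs \<noteq> []" "distinct vs" "hd vs = u" "last vs = v"
      "successively (\<lambda>p q. {p, q} \<in> X - {\<epsilon>}) vs"
      using rtrancl_distinct_path[OF uv(2)[unfolded P.reach_def]] by auto
    have adjvs: "successively adj vs"
    proof (rule successively_mono[OF vs(5)])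
      fix p q assume "{p, q} \<in> X - {\<epsilon>}"
      then have "{p, q} \<in> ?E" using Bsub unfolding X_def by blast
      then show "adj p q" by simp
    qed
    have len3: "3 \<le> length vs"
    proof (rule ccontr)
      assume "\<not> 3 \<le> length vs"
      then consider x where "vs = [x]" | x y where "vs = [x, y]"
        using vs(1) by (cases vs; cases "tl vs") (auto simp: Suc_le_eq)
      then show False
      proof cases
        case 1 then show False using vs uvn by simp
      next
        case 2 then show False using vs uv(1) by simp
      qed
    qed
    have "6 \<le> length vs"
      using C.girth6[OF vs(2) len3 adjvs] adjuv C.adj_sym vs(3,4) by blast
    then obtain a b c d e g r where l: "vs = a # b # c # d # e # g # r" by (rule length_ge6E)
    have dist: "distinct [a, b, c, d, e, g]" using vs(2) unfolding l by auto
    define S where "S = {{a, b}, {b, c}, {c, d}, {d, e}, {e, g}}"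
    have S: "S \<subseteq> X - {\<epsilon>}" "card S = 5" "finite S"
      using vs(5) card_path_edges[OF dist] unfolding l S_def by auto
    have "\<epsilon> \<notin> S" using S(1) by blast
    then have S6: "insert \<epsilon> S \<subseteq> X" "card (insert \<epsilon> S) = 6"
      using S \<epsilon>(1) by (blast, simp)
    have ge6: "6 \<le> card X" using card_mono[OF Bfin[of f, folded X_def] S6(1)] S6(2) by simp
    moreover have "\<exists>a b c d e g. hexagon X a b c d e g" if c6: "card X = 6"
    proof (cases r)
      case Nil
      have "X = insert \<epsilon> S"
        by (rule card_subset_eq[OF Bfin[of f, folded X_def] S6(1), symmetric]) (use c6 S6 in simp)
      moreover have "\<epsilon> = {g, a}" using uv(1) vs(3,4) l Nil by (simp add: insert_commute)
      ultimately have "hexagon X a b c d e g" unfolding hexagon_def S_def using dist by auto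
      then show ?thesis by blast
    next
      case (Cons h s)
      have gh: "{g, h} \<in> X - {\<epsilon>}" using vs(5) unfolding l Cons by simp
      have "h \<notin> {a, b, c, d, e, g}" using vs(2) unfolding l Cons by auto
      then have "{g, h} \<notin> S" unfolding S_def by (auto simp: doubleton_eq_iff)
      then have "{g, h} \<notin> insert \<epsilon> S" using gh by blast
      then have "card (insert {g, h} (insert \<epsilon> S)) = 7" using S6(2) S(3) by simp
      moreover have "card (insert {g, h} (insert \<epsilon> S)) \<le> card X"
        using gh S6 by (intro card_mono Bfin[of f, folded X_def]) auto
      ultimately show ?thesis using c6 by simp
    qed
    ultimately show ?thesis unfolding X_def by blast
  qed
  have at_most: "card {f \<in> F. Q f} \<le> 2" if "\<forall>f\<in>P.faces ?E. Q f \<longrightarrow> f = g1 \<or> f = g2" for Q g1 g2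
  proof -
    have "card {f \<in> F. Q f} \<le> card {g1, g2}" using that F(1) by (intro card_mono) auto
    also have "\<dots> \<le> 2" by (simp add: card_insert_if)
    finally show ?thesis .
  qed
  have incident: "e = {u, v} \<or> e = {v, w}" if h: "C.N v = {u, w}" "e \<in> ?E" "v \<in> e" for e u v w
  proof -
    obtain x where "e = {v, x}" "adj v x" using C.edgeD[OF h(2,3)] by blast
    then have "x \<in> {u, w}" unfolding h(1)[symmetric] by simp
    then show ?thesis using \<open>e = {v, x}\<close> by auto
  qed
  interpret critical_faces V adj D k F "P.border ?E" "P.cyc ?E"
  proof
    show "finite F" by fact
    show "card ?E + 2 \<le> card V + card F" by fact
    show "P.border ?E f \<subseteq> ?E" for f by (rule Bsub)
    show "card {f \<in> F. e \<in> P.border ?E f} \<le> 2" if e: "e \<in> ?E" for e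
    proof -
      obtain g1 g2 where "\<forall>f\<in>P.faces ?E. e \<in> P.border ?E f \<longrightarrow> f = g1 \<or> f = g2"
        using P.border_two(1)[OF order_refl e] by blast
      then show ?thesis by (rule at_most)
    qed
    show "card {f \<in> F. e \<in> P.border ?E f} \<le> 1" if e: "e \<in> ?E" "\<not> P.cyc ?E e" for e
    proof -
      obtain g where "\<forall>f\<in>P.faces ?E. e \<in> P.border ?E f \<longrightarrow> f = g"
        using P.border_two(2)[OF order_refl e] by blast
      then have "card {f \<in> F. e \<in> P.border ?E f} \<le> card {g}" using F(1) by (intro card_mono) auto
      then show ?thesis by simp
    qed
    show "{v, w} \<in> P.border ?E f"
      if h: "C.N v = {u, w}" "u \<noteq> w" "P.cyc ?E {u, v}" "f \<in> F" "{u, v} \<in> P.border ?E f" for v u w f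
    proof (rule P.border_thread[OF order_refl _ _ h(2) _ h(3) _ h(5)])
      have "u \<in> C.N v" "w \<in> C.N v" using h(1) by auto
      then show "{u, v} \<in> ?E" "{v, w} \<in> ?E" using C.adj_sym by auto
      show "e = {u, v} \<or> e = {v, w}" if "e \<in> ?E" "v \<in> e" for e using incident[OF h(1) that] .
      show "f \<in> P.faces ?E" using h F by blast
    qed
    show "6 \<le> card (P.border ?E f)" if "f \<in> F" for f using six[OF that] by blast
    show "\<exists>a b c d e g. hexagon (P.border ?E f) a b c d e g" if "f \<in> F" "card (P.border ?E f) = 6" for f
      using six[OF that(1)] that(2) by blast
    show "C.N v = {u, w}"
      if ff: "f \<in> F" "f' \<in> F" "f \<noteq> f'" and c6: "card (P.border ?E f) = 6" "card (P.border ?E f') = 6" and uw: "u \<noteq> w"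
        and e: "{u, v} \<in> P.border ?E f" "{v, w} \<in> P.border ?E f" "{u, v} \<in> P.border ?E f'" "{v, w} \<in> P.border ?E f'"
      for f f' u v w
    proof -
      \<comment> \<open>In a hexagon the five edges other than \<open>{u, v}\<close> lead from
        \<open>v\<close> back to \<open>u\<close>.\<close>
      have two: "P.cyc (P.border ?E h) {u, v} \<and> (\<forall>x\<in>P.border ?E h. v \<in> x \<longrightarrow> x = {u, v} \<or> x = {v, w})"
        if h: "h \<in> F" "card (P.border ?E h) = 6" "{u, v} \<in> P.border ?E h" "{v, w} \<in> P.border ?E h" for h
      proof -
        let ?X = "P.border ?E h"
        obtain p1 p2 p3 p4 p5 p6 where "hexagon ?X p1 p2 p3 p4 p5 p6" using six[OF h(1)] h(2) by blast
        then obtain q1 q2 q3 q4 where q: "hexagon ?X u v q1 q2 q3 q4" using h(3) by (rule hexagon_from)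
        have "w = q1 \<or> w = u" using hexagon_at[OF hexagon_rot[OF q]] h(4) by blast
        then have w: "w = q1" using uw by simp
        have dist: "distinct [u, v, q1, q2, q3, q4]" and Xq: "?X = {{u, v}, {v, q1}, {q1, q2}, {q2, q3}, {q3, q4}, {q4, u}}"
          using q unfolding hexagon_def by auto
        have "{v, q1} \<in> ?X - {{u, v}}" "{q1, q2} \<in> ?X - {{u, v}}" "{q2, q3} \<in> ?X - {{u, v}}"
          "{q3, q4} \<in> ?X - {{u, v}}" "{q4, u} \<in> ?X - {{u, v}}"
          unfolding Xq using dist by (auto simp: doubleton_eq_iff)
        then have "(v, u) \<in> P.reach (?X - {{u, v}})"
          by (meson P.reach_edge P.reach_trans)
        then have "P.cyc ?X {u, v}" unfolding P.cyc_iff by (rule P.reach_sym)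
        moreover have "\<forall>x\<in>?X. v \<in> x \<longrightarrow> x = {u, v} \<or> x = {v, w}"
          unfolding Xq w using dist by auto
        ultimately show ?thesis by blast
      qed
      note t = two[OF ff(1) c6(1) e(1,2)] two[OF ff(2) c6(2) e(3,4)]
      have key: "x = {u, v} \<or> x = {v, w}" if "x \<in> ?E" "v \<in> x" for x
        by (rule P.shared_sides[OF order_refl uw _ _ ff(3) e(1-3) _ _ that]) (use ff F t in auto)
      have "{u, v} \<in> ?E" "{v, w} \<in> ?E" using e Bsub by blast+
      then have "adj v u" "adj v w" using C.adj_sym by auto
      moreover have "x = u \<or> x = w" if "adj v x" for x
        using key[of "{v, x}"] that by (auto simp: doubleton_eq_iff)
      ultimately have "adj v x \<longleftrightarrow> x \<in> {u, w}" for x by blast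
      then show ?thesis unfolding set_eq_iff by simp
    qed
  qed
  show False by (rule discharged)
qed

section \<open>Cycles and degrees of the digraph in undirected terms\<close>

context graph
begin

lemma awalk_of_list:
  assumes "successively (dominates G) (v # vs)" "v \<in> verts G"
  shows "\<exists>p. awalk v p (last (v # vs)) \<and> awalk_verts v p = v # vs \<and> length p = length vs"
  using assms
proof (induction vs arbitrary: v)
  case Nil
  then show ?case by (intro exI[of _ "[]"]) (auto simp: awalk_Nil_iff)
next
  case (Cons w vs)
  have vw: "v \<rightarrow>\<^bsub>G\<^esub> w" and s: "successively (dominates G) (w # vs)" using Cons.prems(1) by auto
  obtain a where a: "a \<in> arcs G" "tail G a = v" "head G a = w" using vw by (auto simp: arcs_ends_def arc_to_ends_def)
  obtain p where p: "awalk w p (last (w # vs))" "awalk_verts w p = w # vs" "length p = length vs"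
    using Cons.IH[OF s] a head_in_verts by blast
  show ?case
    using a p by (intro exI[of _ "a # p"]) (auto simp: awalk_Cons_iff)
qed

lemma girth_le_cycle:
  assumes vs: "distinct vs" "3 \<le> length vs" "successively (dominates G) vs" "last vs \<rightarrow>\<^bsub>G\<^esub> hd vs"
  shows "girth G \<le> enat (length vs)"
proof -
  obtain v ws where vw: "vs = v # ws" using vs(2) by (cases vs) auto
  obtain a where a: "a \<in> arcs G" "tail G a = last vs" "head G a = v"
    using vs(4) unfolding vw by (auto simp: arcs_ends_def arc_to_ends_def)
  have vV: "v \<in> verts G" using a head_in_verts by metis
  obtain p where p: "awalk v p (last vs)" "awalk_verts v p = vs" "length p = length ws"
    using awalk_of_list[of v ws] vs(3) vV unfolding vw by blast
  have e: "awalk (last vs) [a] v" using a by (auto simp: awalk_Cons_iff awalk_Nil_iff)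
  have w: "awalk v (p @ [a]) v" using p(1) e by (rule awalk_appendI)
  have "awalk_verts v (p @ [a]) = vs @ [v]"
    using awalk_verts_append[OF w] p(2) a by simp
  then have "tl (awalk_verts v (p @ [a])) = ws @ [v]" unfolding vw by simp
  then have "cycle (p @ [a])" unfolding cycle_def using w vs(1) vw by auto
  moreover have "length (p @ [a]) = length vs" using p(3) vw by simp
  ultimately show ?thesis unfolding girth_def using vs(2) by (metis (mono_tags, lifting) INF_lower mem_Collect_eq)
qed

lemma out_degree_card: "out_degree G v = card {w. v \<rightarrow>\<^bsub>G\<^esub> w}"
proof -
  have "bij_betw (head G) (out_arcs G v) {w. v \<rightarrow>\<^bsub>G\<^esub> w}"
    unfolding bij_betw_def
  proof
    show "inj_on (head G) (out_arcs G v)"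
      using no_multi_arcs by (auto simp: inj_on_def out_arcs_def arc_to_ends_def)
    show "head G ` out_arcs G v = {w. v \<rightarrow>\<^bsub>G\<^esub> w}"
      by (auto simp: out_arcs_def arcs_ends_def arc_to_ends_def)
  qed
  then show ?thesis unfolding out_degree_def by (rule bij_betw_same_card)
qed

lemma out_degree_le_max: "v \<in> verts G \<Longrightarrow> out_degree G v \<le> max_degree G"
  unfolding max_degree_def by (rule cSUP_upper) auto

end

theorem theorem1p2:
  fixes G :: "('a, 'b) pre_digraph"
  assumes "graph G"
    and "planar G"
    and "girth G \<ge> 6"
    and "max_degree G \<ge> 6"
  shows "chi2 G \<le> max_degree G + 4"
proof -
  interpret G: graph G by fact
  let ?D = "max_degree G" and ?adj = "dominates G"
  have adj_sym: "?adj v u" if "?adj u v" for u v using that G.sym_arcs by (meson symmetric_def symE)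
  have adj_irr: "\<not> ?adj v v" for v using G.no_loops by (auto simp: arcs_ends_def arc_to_ends_def)
  have adj_V: "u \<in> verts G \<and> v \<in> verts G" if "?adj u v" for u v
    using that by (auto simp: arcs_ends_def arc_to_ends_def)
  obtain pos A where draw: "plane_drawing G pos A" using assms(2) unfolding planar_def by blast
  \<comment> \<open>The common neighbour must lie in \<open>S\<close>: colourability refers to the
    induced subgraph, but the number of colours stays that of \<open>G\<close>. A minimal set that
    fails is then critical.\<close>
  define colourable where "colourable S \<longleftrightarrow> (\<exists>c::'a \<Rightarrow> nat. (\<forall>v\<in>S. c v < ?D + 4) \<and>
    (\<forall>u\<in>S. \<forall>v\<in>S. u \<noteq> v \<and> (?adj u v \<or> (\<exists>w\<in>S. ?adj u w \<and> ?adj w v)) \<longrightarrow> c u \<noteq> c v))" for S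
  have all: "S \<subseteq> verts G \<longrightarrow> colourable S" if "finite S" for S
    using that
  proof (induction S rule: finite_psubset_induct)
    case (psubset S)
    show ?case
    proof (intro impI, rule ccontr)
      assume SV: "S \<subseteq> verts G" and nc: "\<not> colourable S"
      define adj where "adj u v \<longleftrightarrow> ?adj u v \<and> u \<in> S \<and> v \<in> S" for u v
      interpret H: sgraph S adj
        by unfold_locales (use psubset.hyps adj_sym adj_irr in \<open>auto simp: adj_def\<close>)
      have "critical S adj ?D (?D + 4)"
      proof
        show "6 \<le> ?D" by fact
        show "?D + 4 = ?D + 4" ..
        show "H.deg v \<le> ?D" for v
        proof (cases "v \<in> S")
          case True
          have "{w. ?adj v w} \<subseteq> verts G" using adj_V by blast
          then have "finite {w. ?adj v w}" using G.finite_verts by (rule finite_subset)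
          then have "card (H.N v) \<le> card {w. ?adj v w}" by (intro card_mono) (auto simp: adj_def)
          also have "\<dots> \<le> ?D" using G.out_degree_le_max[of v] G.out_degree_card[of v] SV True by auto
          finally show ?thesis unfolding H.deg_def .
        next
          case False
          then have "H.N v = {}" by (auto simp: adj_def)
          then show ?thesis unfolding H.deg_def by simp
        qed
        show "\<not> (\<exists>c::'a \<Rightarrow> nat. (\<forall>v\<in>S. c v < ?D + 4) \<and> (\<forall>u\<in>S. \<forall>v\<in>S. H.sq u v \<longrightarrow> c u \<noteq> c v))"
        proof
          assume "\<exists>c::'a \<Rightarrow> nat. (\<forall>v\<in>S. c v < ?D + 4) \<and> (\<forall>u\<in>S. \<forall>v\<in>S. H.sq u v \<longrightarrow> c u \<noteq> c v)"
          then obtain c :: "'a \<Rightarrow> nat" where c: "\<forall>v\<in>S. c v < ?D + 4" "\<forall>u\<in>S. \<forall>v\<in>S. H.sq u v \<longrightarrow> c u \<noteq> c v" by blast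
          have "H.sq u v" if "u \<in> S" "v \<in> S" "u \<noteq> v \<and> (?adj u v \<or> (\<exists>w\<in>S. ?adj u w \<and> ?adj w v))" for u v
            using that unfolding H.sq_def adj_def by blast
          then have "colourable S" unfolding colourable_def using c by blast
          then show False using nc by simp
        qed
        show "\<exists>c::'a \<Rightarrow> nat. (\<forall>v\<in>S - {r}. c v < ?D + 4) \<and>
            (\<forall>u\<in>S - {r}. \<forall>v\<in>S - {r}. u \<noteq> v \<and> (adj u v \<or> (\<exists>w\<in>S - {r}. adj u w \<and> adj w v)) \<longrightarrow> c u \<noteq> c v)"
          if r: "r \<in> S" for r
        proof -
          have "colourable (S - {r})" using psubset.IH[of "S - {r}"] r SV by blast
          then obtain c :: "'a \<Rightarrow> nat" where c: "\<forall>v\<in>S - {r}. c v < ?D + 4"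
            "\<forall>u\<in>S - {r}. \<forall>v\<in>S - {r}. u \<noteq> v \<and> (?adj u v \<or> (\<exists>w\<in>S - {r}. ?adj u w \<and> ?adj w v)) \<longrightarrow> c u \<noteq> c v"
            unfolding colourable_def by (elim exE conjE)
          show ?thesis
          proof (intro exI[of _ c] conjI ballI impI)
            fix u v assume uv: "u \<in> S - {r}" "v \<in> S - {r}"
              and a: "u \<noteq> v \<and> (adj u v \<or> (\<exists>w\<in>S - {r}. adj u w \<and> adj w v))"
            have "u \<noteq> v \<and> (?adj u v \<or> (\<exists>w\<in>S - {r}. ?adj u w \<and> ?adj w v))"
              using a unfolding adj_def by blast
            then show "c u \<noteq> c v" using c(2) uv by blast
          qed (use c(1) in blast)
        qed
        show "6 \<le> length vs" if vs: "distinct vs" "3 \<le> length vs" "successively adj vs" "adj (last vs) (hd vs)" for vs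
        proof -
          have "successively ?adj vs" by (rule successively_mono[OF vs(3)]) (simp add: adj_def)
          moreover have "?adj (last vs) (hd vs)" using vs(4) unfolding adj_def by simp
          ultimately have "girth G \<le> enat (length vs)" using G.girth_le_cycle vs by blast
          with assms(3) have "6 \<le> enat (length vs)" by (rule order_trans)
          then show ?thesis by (simp add: numeral_eq_enat)
        qed
      qed
      moreover have "drawing S (sgraph.edges adj) pos A"
      proof
        have inj: "inj_on pos (verts G)"
          and D1: "\<And>u v. ?adj u v \<Longrightarrow> (\<exists>g. arc g \<and> pathstart g = pos u \<and> pathfinish g = pos v \<and> path_image g = A {u, v}) \<and>
                A {u, v} \<inter> pos ` verts G = {pos u, pos v}"
          and D2: "\<And>u v x y. ?adj u v \<Longrightarrow> ?adj x y \<Longrightarrow> {u, v} \<noteq> {x, y} \<Longrightarrow> A {u, v} \<inter> A {x, y} \<subseteq> pos ` verts G"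
          using draw unfolding plane_drawing_def by blast+
        have edgeE: "\<exists>u v. e = {u, v} \<and> ?adj u v \<and> u \<in> S \<and> v \<in> S" if "e \<in> H.edges" for e
          using that unfolding H.edges_def adj_def by blast
        show "finite S" by fact
        show "inj_on pos S" using inj SV by (rule inj_on_subset)
        show "\<exists>u v g. e = {u, v} \<and> u \<noteq> v \<and> u \<in> S \<and> v \<in> S \<and> arc g \<and>
            pathstart g = pos u \<and> pathfinish g = pos v \<and> path_image g = A e" if e: "e \<in> H.edges" for e
        proof -
          obtain u v where uv: "e = {u, v}" "?adj u v" "u \<in> S" "v \<in> S" using edgeE[OF e] by blast
          then obtain g where "arc g" "pathstart g = pos u" "pathfinish g = pos v" "path_image g = A e" using D1 by blast
          moreover have "u \<noteq> v" using uv(2) adj_irr by blast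
          ultimately show ?thesis using uv by blast
        qed
        show ends: "A e \<inter> pos ` S = pos ` e" if e: "e \<in> H.edges" for e
        proof -
          obtain u v where uv: "e = {u, v}" "?adj u v" "u \<in> S" "v \<in> S" using edgeE[OF e] by blast
          then have "A e \<inter> pos ` verts G = {pos u, pos v}" using D1 by blast
          then show ?thesis using uv SV by blast
        qed
        \<comment> \<open>The arcs may meet in a vertex of \<open>G\<close>, but such a vertex is an
          end of \<open>e\<close> and so lies in \<open>S\<close>.\<close>
        show "A e \<inter> A e' \<subseteq> pos ` S" if e: "e \<in> H.edges" "e' \<in> H.edges" "e \<noteq> e'" for e e'
        proof -
          obtain u v where uv: "e = {u, v}" "?adj u v" "u \<in> S" "v \<in> S" using edgeE[OF e(1)] by blast
          obtain x y where xy: "e' = {x, y}" "?adj x y" "x \<in> S" "y \<in> S" using edgeE[OF e(2)] by blast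
          have "A e \<inter> A e' \<subseteq> pos ` verts G" using D2 uv xy e(3) by blast
          moreover have "A e \<inter> pos ` verts G = {pos u, pos v}" using D1 uv by blast
          ultimately show ?thesis using uv by blast
        qed
      qed
      ultimately show False by (rule no_plane_critical)
    qed
  qed
  then have "colourable (verts G)" using G.finite_verts by blast
  then obtain c :: "'a \<Rightarrow> nat" where c: "\<forall>v\<in>verts G. c v < ?D + 4"
    "\<forall>u\<in>verts G. \<forall>v\<in>verts G. u \<noteq> v \<and> (?adj u v \<or> (\<exists>w\<in>verts G. ?adj u w \<and> ?adj w v)) \<longrightarrow> c u \<noteq> c v"
    unfolding colourable_def by (elim exE conjE)
  have "two_distance_coloring G c"
    unfolding two_distance_coloring_def
  proof (intro ballI impI)
    fix u v assume uv: "u \<in> verts G" "v \<in> verts G" and a: "u \<noteq> v \<and> (?adj u v \<or> (\<exists>w. ?adj u w \<and> ?adj w v))"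
    have "u \<noteq> v \<and> (?adj u v \<or> (\<exists>w\<in>verts G. ?adj u w \<and> ?adj w v))" using a adj_V by blast
    then show "c u \<noteq> c v" using c(2) uv by blast
  qed
  moreover have "c ` verts G \<subseteq> {..<?D + 4}" using c(1) by auto
  ultimately show ?thesis unfolding chi2_def by (intro Least_le) blast
qed

end
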